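(* Let $d\ge1$ and let $X,X_1,X_2,\ldots$ be i.i.d. $\mathbb{R}^d$-valued random vectors with $S_n=\sum_{j=1}^nX_j$, such that $\mathcal{L}(S_n/n^{1/2})$ converges weakly to a (centered) Gaussian measure $\gamma$ on $\mathbb{R}^d$ whose support is all of $\mathbb{R}^d$. Assume that for every $f\in\mathbb{R}^d$ there is $t_f>0$ with $E(e^{t|\langle f,X\rangle|})<\infty$ for $0<t<t_f$. Let $\{b_n\}$ be positive constants with $b_n/n^{1/2}\to\infty$ and $b_n/n^{2/3}\to0$. Let $D\subset\mathbb{R}^d$ be open and convex with $D\cap H_\gamma\neq\emptyset$ and $0\notin\overline D$, let $a_0$ be the unique dominating point for $(D,\gamma)$, and assume that for some $\beta>0$, $D$ contains slices whose diameters near $a_0$ dominate the function $\tau(s)=\beta s^{1/2}$. Then $$\lim_{n\to\infty}P(S_n\in b_nD)/P(G\in n^{-1/2}b_nD)=1,$$ where $G$ is a random vector with $\mathcal{L}(G)=\gamma$.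
   Context: Notation (with $B=\mathbb{R}^d$, Euclidean norm): $\hat\gamma(f)=\int_B e^{f(x)}\,d\gamma(x)$ for $f\in B^*$. $H_\gamma\subset B$ is the Hilbert space generating $\gamma$: the completion of $S(B^* )$, where $Sf=\int_B xf(x)\,d\gamma(x)$, under the inner product $\langle Sf,Sg\rangle_\gamma=\int_B fg\,d\gamma$ (here $H_\gamma=\mathbb{R}^d$ as a set). The rate function is $\lambda_\gamma(x)=\sup_{f\in B^*}[f(x)-\log\hat\gamma(f)]=\|x\|_\gamma^2/2$ for $x\in H_\gamma$. Dominating point (known facts): for open convex $D$ with $D\cap H_\gamma\ne\emptyset$ and $0\notin\overline D$, there is a unique point $a_0\in\partial D$ (the dominating point for $(D,\gamma)$) such that (i) $\lambda_\gamma(a_0)=\inf_{x\in D}\lambda_\gamma(x)=\inf_{x\in\overline D}\lambda_\gamma(x)<\infty$, and for some $g\in B^*$: (ii) $D\subset\{x:g(x)\ge g(a_0)\}$; (iii) $\lambda_\gamma(a_0)=g(a_0)-\log\hat\gamma(g)$; (iv) $a_0=\int_B x\exp\{g(x)-\log\hat\gamma(g)\}\,d\gamma(x)$. Slices: $D$ contains slices whose diameters near $a_0$ dominate the function $\tau(s)$ if for some $f\in B^*$ satisfying $$\sup_{\{z:\lambda_\gamma(z)\le\lambda_\gamma(a_0)\}}f(z)=f(a_0)<f(x)\quad\forall x\in D$$ there exist $x_0\in B$ and $\delta>0$ such that $f(x_0)>0$ and $$\{y+sx_0: f(y)=0,\ \|y\|\le\tau(s),\ 0<s\le\delta\}\subset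 D-a_0.$$ *)

theory Defs
  imports "HOL-Probability.Probability"
begin

text \<open>
  Throughout, the space \<open>B\<close> is a Euclidean space \<open>'a\<close> and its dual \<open>B*\<close> is the type
  \<open>'a \<Rightarrow>\<^sub>L real\<close> of bounded linear functionals.
\<close>

definition weakly_converges ::
    "(nat \<Rightarrow> 'a::metric_space measure) \<Rightarrow> 'a measure \<Rightarrow> bool" where
  "weakly_converges \<mu> \<nu> \<longleftrightarrow>
     (\<forall>\<phi> :: 'a \<Rightarrow>\<^sub>C real. (\<lambda>n. \<integral>x. apply_bcontfun \<phi> x \<partial>\<mu> n) \<longlonglongrightarrow> (\<integral>x. apply_bcontfun \<phi> x \<partial>\<nu>))"

definition gaussian_law :: "real measure \<Rightarrow> bool" where
  "gaussian_law \<nu> \<longleftrightarrow>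
     (\<exists>m. \<nu> = return borel m \<or>
          (\<exists>\<sigma>>0. \<nu> = density lborel (\<lambda>x. ennreal (normal_density m \<sigma> x))))"

definition gaussian_measure :: "'a::euclidean_space measure \<Rightarrow> bool" where
  "gaussian_measure \<gamma> \<longleftrightarrow> sets \<gamma> = sets borel \<and>
     (\<forall>f :: 'a \<Rightarrow>\<^sub>L real. gaussian_law (distr \<gamma> borel (blinfun_apply f)))"

definition centered :: "'a::euclidean_space measure \<Rightarrow> bool" where
  "centered \<gamma> \<longleftrightarrow> (\<forall>f :: 'a \<Rightarrow>\<^sub>L real. (\<integral>x. blinfun_apply f x \<partial>\<gamma>) = 0)"

definition measure_support :: "'a::topological_space measure \<Rightarrow> 'a set" where
  "measure_support \<gamma> = {x. \<forall>U. open U \<and> x \<in> U \<longrightarrow> 0 < emeasure \<gamma> U}"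

definition laplace :: "'a::euclidean_space measure \<Rightarrow> ('a \<Rightarrow>\<^sub>L real) \<Rightarrow> real" where
  "laplace \<gamma> f = (\<integral>x. exp (blinfun_apply f x) \<partial>\<gamma>)"

definition S_map :: "'a::euclidean_space measure \<Rightarrow> ('a \<Rightarrow>\<^sub>L real) \<Rightarrow> 'a" where
  "S_map \<gamma> f = (\<integral>x. blinfun_apply f x *\<^sub>R x \<partial>\<gamma>)"

text \<open>
  The completion of \<open>S(B*)\<close> under \<open>\<langle>Sf, Sg\<rangle> = \<integral> f g d\<gamma>\<close>, realised inside \<open>B\<close>. A sequence
  \<open>S f\<^sub>n\<close> is Cauchy for this inner product iff \<open>f\<^sub>n\<close> is Cauchy in \<open>L\<^sup>2(\<gamma>)\<close>; it then
  converges in \<open>B\<close>, and its limit there determines its class in the completion.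
\<close>

definition H_space :: "'a::euclidean_space measure \<Rightarrow> 'a set" where
  "H_space \<gamma> = {x. \<exists>f :: nat \<Rightarrow> ('a \<Rightarrow>\<^sub>L real).
     (\<forall>e>0. \<exists>N. \<forall>m\<ge>N. \<forall>n\<ge>N. (\<integral>z. (blinfun_apply (f m) z - blinfun_apply (f n) z)\<^sup>2 \<partial>\<gamma>) < e) \<and>
     (\<lambda>n. S_map \<gamma> (f n)) \<longlonglongrightarrow> x}"

definition rate :: "'a::euclidean_space measure \<Rightarrow> 'a \<Rightarrow> ereal" where
  "rate \<gamma> x = (SUP f :: 'a \<Rightarrow>\<^sub>L real. ereal (blinfun_apply f x - ln (laplace \<gamma> f)))"

definition dominating_point ::
    "'a::euclidean_space set \<Rightarrow> 'a measure \<Rightarrow> 'a \<Rightarrow> bool" where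
  "dominating_point D \<gamma> a \<longleftrightarrow>
     a \<in> frontier D \<and>
     rate \<gamma> a = (INF x\<in>D. rate \<gamma> x) \<and>
     rate \<gamma> a = (INF x\<in>closure D. rate \<gamma> x) \<and>
     rate \<gamma> a < \<infinity> \<and>
     (\<exists>g :: 'a \<Rightarrow>\<^sub>L real.
        D \<subseteq> {x. blinfun_apply g x \<ge> blinfun_apply g a} \<and>
        rate \<gamma> a = ereal (blinfun_apply g a - ln (laplace \<gamma> g)) \<and>
        a = (\<integral>x. exp (blinfun_apply g x - ln (laplace \<gamma> g)) *\<^sub>R x \<partial>\<gamma>))"

definition contains_slices ::
    "'a::euclidean_space measure \<Rightarrow> 'a set \<Rightarrow> 'a \<Rightarrow> (real \<Rightarrow> real) \<Rightarrow> bool" where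
  "contains_slices \<gamma> D a \<tau> \<longleftrightarrow>
     (\<exists>f :: 'a \<Rightarrow>\<^sub>L real.
        (SUP z\<in>{z. rate \<gamma> z \<le> rate \<gamma> a}. ereal (blinfun_apply f z)) = ereal (blinfun_apply f a) \<and>
        (\<forall>x\<in>D. blinfun_apply f a < blinfun_apply f x) \<and>
        (\<exists>x0 \<delta>. \<delta> > 0 \<and> blinfun_apply f x0 > 0 \<and>
           {y + s *\<^sub>R x0 | y s. blinfun_apply f y = 0 \<and> norm y \<le> \<tau> s \<and> 0 < s \<and> s \<le> \<delta>}
             \<subseteq> (\<lambda>x. x - a) ` D))"

end

theory Submission
  imports Defs "HOL-Real_Asymp.Real_Asymp"
begin

text \<open>
  Weak convergence forces the steps to be centred with nondegenerate covariance, so a linear change of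
  coordinates makes the covariance the identity. A Lindeberg argument then identifies the limit as
  the standard Gaussian measure, and the dominating point \<open>v\<close> represents its own supporting functional
  \<open>x \<mapsto> v \<bullet> x\<close>.

  Tilting both the steps and the Gaussian measure by \<open>v\<close> extracts the factor \<open>exp (- x\<^sup>2 (v \<bullet> v) / 2)\<close>,
  where \<open>x = b n / sqrt n\<close>; the two factors agree asymptotically because the third-order term of the
  cumulant generating function contributes \<open>O(b n ^ 3 / n\<^sup>2)\<close>, which tends to 0. What remains is the integral
  of \<open>exp (- x (v \<bullet> z))\<close> over \<open>x (D - v)\<close>, a function with convex level sets. For the Gaussian measure
  the slice condition bounds this integral from below by \<open>c / x\<close>. The tilted steps give the same
  integral up to the Berry--Esseen error on convex sets; a smoothing argument bounds that error
  by \<open>o(n powr (- 1/6))\<close>, which is negligible compared to \<open>1 / x\<close>.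

  The smoothing argument needs no derivatives: by the Cameron--Martin formula a translate of a Gaussian
  average is an average against \<open>exp (u \<bullet> z - (norm u)\<^sup>2 / 2)\<close>, whose expansion in \<open>u\<close> is explicit.
\<close>

section \<open>The standard Gaussian measure\<close>

text \<open>The accuracy demanded of the normal approximation is dictated by the slices. Where
  \<open>x * (v \<bullet> z)\<close> is bounded, the point \<open>v + z / x\<close> can lie at
  height of order \<open>1 / x ^ 2\<close> above the supporting hyperplane; there a slice of
  diameter \<open>\<beta> * sqrt s\<close> is of width \<open>1 / x\<close>, which dilation by
  \<open>x\<close> turns into a constant. Hence the lower bound \<open>c / x\<close>, with
  \<open>x = o(n powr (1/6))\<close>. The tilt varies with \<open>n\<close>, so the approximation
  must be uniform in the law of the step, and tilted steps are only approximately standardized;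
  defects of mean and covariance are therefore carried through the whole Lindeberg argument. The
  mean is the critical one: a tilt of norm \<open>t\<close> misplaces it by \<open>O(t ^ 2)\<close>,
  which after \<open>n\<close> normalized steps is
  \<open>O(sqrt n * t ^ 2) = o(n powr (-1/6))\<close>, with nothing to spare. The other errors leave
  room: smoothing with variance about \<open>n powr (-1/2)\<close> costs about
  \<open>n powr (-1/4)\<close>, so a single smoothing scale suffices. Sums of independent steps are
  represented by iterates of an averaging operator, so that tilting a step needs no new probability
  space.\<close>

definition gauss_density :: "'a::euclidean_space \<Rightarrow> real" where
  "gauss_density x = (\<Prod>b\<in>Basis. std_normal_density (x \<bullet> b))"

definition std_gauss :: "'a::euclidean_space measure" where
  "std_gauss = density lborel (\<lambda>x. ennreal (gauss_density x))"

lemma gauss_density_nonneg [simp]: "0 \<le> gauss_density x"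
  unfolding gauss_density_def by (intro prod_nonneg) auto

lemma gauss_density_measurable [measurable]: "gauss_density \<in> borel_measurable borel"
  unfolding gauss_density_def by measurable

lemma gauss_density_eq:
  "gauss_density x = (1 / sqrt (2 * pi)) ^ DIM('a) * exp (- (norm x)\<^sup>2 / 2)"
  for x :: "'a::euclidean_space"
proof -
  have "(norm x)\<^sup>2 = (\<Sum>b\<in>Basis. (x \<bullet> b)\<^sup>2)"
    unfolding power2_norm_eq_inner by (subst euclidean_inner) (simp add: power2_eq_square)
  then have "exp (- (norm x)\<^sup>2 / 2) = (\<Prod>b\<in>Basis. exp (- (x \<bullet> b)\<^sup>2 / 2))"
    by (simp add: exp_sum[symmetric] sum_divide_distrib[symmetric] sum_negf)
  then show ?thesis
    unfolding gauss_density_def std_normal_density_def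
    by (simp only: prod.distrib prod_constant)
qed

text \<open>Completing the square. This is the pointwise form of the Cameron--Martin
  formula.\<close>

lemma gauss_density_diff:
  "gauss_density (x - w) = gauss_density x * exp (w \<bullet> x - (norm w)\<^sup>2 / 2)"
proof -
  have "exp (- (norm (x - w))\<^sup>2 / 2) = exp (- (norm x)\<^sup>2 / 2) * exp (w \<bullet> x - (norm w)\<^sup>2 / 2)"
    unfolding exp_add[symmetric] power2_norm_eq_inner
    by (rule arg_cong[where f=exp]) (simp add: inner_diff inner_commute field_simps)
  then show ?thesis unfolding gauss_density_eq by simp
qed

lemma sets_std_gauss [simp, measurable_cong]: "sets std_gauss = sets borel"
  and space_std_gauss [simp]: "space std_gauss = UNIV"
  by (auto simp: std_gauss_def)

lemma nn_integral_std_gauss: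
  "f \<in> borel_measurable borel \<Longrightarrow> (\<integral>\<^sup>+x. f x \<partial>std_gauss) = (\<integral>\<^sup>+x. ennreal (gauss_density x) * f x \<partial>lborel)"
  unfolding std_gauss_def by (subst nn_integral_density) auto

lemma prob_space_std_gauss: "prob_space (std_gauss :: 'a::euclidean_space measure)"
proof
  have "(\<integral>\<^sup>+x. ennreal (gauss_density (x::'a)) \<partial>lborel)
      = (\<integral>\<^sup>+x. (\<Prod>b\<in>Basis. ennreal (std_normal_density ((x::'a) \<bullet> b))) \<partial>lborel)"
    unfolding gauss_density_def by (simp add: prod_ennreal)
  also have "\<dots> = (\<Prod>b\<in>(Basis::'a set). (\<integral>\<^sup>+x. ennreal (std_normal_density x) \<partial>lborel))"
    by (subst nn_integral_lborel_prod) auto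
  also have "(\<integral>\<^sup>+x. ennreal (std_normal_density x) \<partial>lborel) = 1"
    by (subst nn_integral_eq_integral) auto
  finally show "emeasure std_gauss (space std_gauss :: 'a set) = 1"
    unfolding std_gauss_def by (subst emeasure_density) auto
qed

interpretation std_gauss: prob_space std_gauss
  by (rule prob_space_std_gauss)

text \<open>Translation invariance of Lebesgue measure moves the shift onto the density.
  Integrability transfers in both directions, and where it fails both Bochner integrals take the
  default value 0.\<close>

lemma
  fixes f :: "'a::euclidean_space \<Rightarrow> 'b::{banach, second_countable_topology}"
  assumes [measurable]: "f \<in> borel_measurable borel"
  shows std_gauss_shift_integral:
      "(\<integral>x. f (x + w) \<partial>std_gauss) = (\<integral>x. exp (w \<bullet> x - (norm w)\<^sup>2 / 2) *\<^sub>R f x \<partial>std_gauss)" (is ?th1)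
    and std_gauss_shift_integrable:
      "integrable std_gauss (\<lambda>x. f (x + w)) \<longleftrightarrow>
        integrable std_gauss (\<lambda>x. exp (w \<bullet> x - (norm w)\<^sup>2 / 2) *\<^sub>R f x)" (is ?th2)
proof -
  have "(\<integral>x. gauss_density (x - w) *\<^sub>R f x \<partial>lborel) = (\<integral>x. gauss_density (x - w) *\<^sub>R f x \<partial>distr lborel borel ((+) w))"
    by (subst lborel_distr_plus) simp
  also have "\<dots> = (\<integral>x. gauss_density x *\<^sub>R f (x + w) \<partial>lborel)"
    by (subst integral_distr) (auto simp: add.commute)
  finally show ?th1
    unfolding std_gauss_def by (subst (1 2) integral_density) (auto simp: gauss_density_diff)
  have "integrable lborel (\<lambda>x. gauss_density (x - w) *\<^sub>R f x) \<longleftrightarrow>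
      integrable (distr lborel borel ((+) w)) (\<lambda>x. gauss_density (x - w) *\<^sub>R f x)"
    by (subst lborel_distr_plus) simp
  also have "\<dots> \<longleftrightarrow> integrable lborel (\<lambda>x. gauss_density x *\<^sub>R f (x + w))"
    by (subst integrable_distr_eq) (auto simp: add.commute)
  finally show ?th2
    unfolding std_gauss_def by (subst (1 2) integrable_density) (auto simp: gauss_density_diff)
qed

lemma
  fixes w :: "'a::euclidean_space"
  shows std_gauss_mgf_integrable: "integrable std_gauss (\<lambda>x. exp (w \<bullet> x))"
    and std_gauss_mgf: "(\<integral>x. exp (w \<bullet> x) \<partial>std_gauss) = exp ((norm w)\<^sup>2 / 2)"
proof -
  \<comment> \<open>The shift formula for the constant function 1 already evaluates the exponential
    integral.\<close>
  have 1: "integrable std_gauss (\<lambda>x. exp (w \<bullet> x - (norm w)\<^sup>2 / 2))"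
    using std_gauss_shift_integrable[of "\<lambda>_. 1::real" w] by simp
  have 2: "(\<integral>x. exp (w \<bullet> x - (norm w)\<^sup>2 / 2) \<partial>std_gauss) = 1"
    using std_gauss_shift_integral[of "\<lambda>_. 1::real" w] by (simp add: std_gauss.prob_space[simplified])
  have eq: "exp (w \<bullet> x) = exp (w \<bullet> x - (norm w)\<^sup>2 / 2) * exp ((norm w)\<^sup>2 / 2)" for x
    by (simp add: exp_add[symmetric])
  show "integrable std_gauss (\<lambda>x. exp (w \<bullet> x))"
    unfolding eq using 1 by (rule integrable_mult_left)
  show "(\<integral>x. exp (w \<bullet> x) \<partial>std_gauss) = exp ((norm w)\<^sup>2 / 2)"
    unfolding eq using 2 by simp
qed

text \<open>The norm is at most the sum of the absolute coordinates, hence at most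
  \<open>DIM('a)\<close> times the largest of them. This reduces exponential moments of the norm to
  those of finitely many linear functionals.\<close>

lemma exp_norm_le_sum:
  fixes x :: "'a::euclidean_space"
  assumes "0 \<le> c"
  shows "exp (c * norm x) \<le> (\<Sum>b\<in>Basis. exp (c * DIM('a) * \<bar>b \<bullet> x\<bar>))"
proof -
  have "norm x \<le> (\<Sum>b\<in>Basis. \<bar>x \<bullet> b\<bar>)" by (rule norm_le_l1)
  moreover have "\<exists>b\<in>Basis. (\<Sum>b\<in>Basis. \<bar>x \<bullet> b\<bar>) \<le> DIM('a) * \<bar>x \<bullet> b\<bar>"
  proof (rule ccontr)
    assume "\<not> ?thesis"
    then have "\<And>b. b \<in> Basis \<Longrightarrow> \<bar>x \<bullet> b\<bar> < (\<Sum>b\<in>Basis. \<bar>x \<bullet> b\<bar>) / DIM('a)"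
      by (auto simp: field_simps)
    then have "(\<Sum>b\<in>(Basis::'a set). \<bar>x \<bullet> b\<bar>) < (\<Sum>b\<in>(Basis::'a set). (\<Sum>b\<in>Basis. \<bar>x \<bullet> b\<bar>) / DIM('a))"
      by (intro sum_strict_mono) auto
    then show False by simp
  qed
  ultimately obtain b where b: "b \<in> Basis" "norm x \<le> DIM('a) * \<bar>x \<bullet> b\<bar>" by force
  have "c * norm x \<le> c * (DIM('a) * \<bar>x \<bullet> b\<bar>)" using b(2) assms by (rule mult_left_mono)
  then have "exp (c * norm x) \<le> exp (c * DIM('a) * \<bar>b \<bullet> x\<bar>)" by (simp add: inner_commute mult_ac)
  also have "\<dots> \<le> (\<Sum>b\<in>Basis. exp (c * DIM('a) * \<bar>b \<bullet> x\<bar>))"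
    using b(1) by (intro member_le_sum) auto
  finally show ?thesis .
qed

lemma integrable_exp_norm_std_gauss:
  "integrable (std_gauss :: 'a::euclidean_space measure) (\<lambda>x. exp (c * norm x))"
proof (rule Bochner_Integration.integrable_bound)
  let ?e = "\<lambda>b x::'a. exp ((\<bar>c\<bar> * DIM('a)) *\<^sub>R b \<bullet> x) + exp (-(\<bar>c\<bar> * DIM('a)) *\<^sub>R b \<bullet> x)"
  show "integrable std_gauss (\<lambda>x::'a. \<Sum>b\<in>Basis. ?e b x)"
    by (intro Bochner_Integration.integrable_sum Bochner_Integration.integrable_add std_gauss_mgf_integrable)
  have "norm (exp (c * norm x)) \<le> norm (\<Sum>b\<in>Basis. ?e b x)" for x :: 'a
  proof -
    have "exp (c * norm x) \<le> exp (\<bar>c\<bar> * norm x)" by (simp add: mult_right_mono)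
    also have "\<dots> \<le> (\<Sum>b\<in>Basis. exp (\<bar>c\<bar> * DIM('a) * \<bar>b \<bullet> x\<bar>))" by (rule exp_norm_le_sum) simp
    also have "\<dots> \<le> (\<Sum>b\<in>Basis. ?e b x)"
      by (intro sum_mono) (auto simp: abs_if)
    also have "\<dots> \<le> norm (\<Sum>b\<in>Basis. ?e b x)" by simp
    finally show ?thesis by simp
  qed
  then show "AE x in std_gauss. norm (exp (c * norm (x::'a))) \<le> norm (\<Sum>b\<in>Basis. ?e b x)"
    by simp
qed auto

lemma power_le_exp: "0 \<le> y \<Longrightarrow> y ^ k \<le> exp (real k * y)" for y :: real
  using power_mono[of y "exp y" k] exp_ge_add_one_self[of y] by (simp add: exp_of_nat_mult)

lemma integrable_norm_power_std_gauss:
  "integrable (std_gauss :: 'a::euclidean_space measure) (\<lambda>x. norm x ^ k)"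
  by (rule Bochner_Integration.integrable_bound[OF integrable_exp_norm_std_gauss[of "real k"]])
     (auto intro!: power_le_exp)

text \<open>Reflections in coordinate hyperplanes preserve Lebesgue measure and the density. A
  suitable choice of signs makes the first moments and the mixed second moments vanish.\<close>

lemma integral_std_gauss_flip:
  fixes f :: "'a::euclidean_space \<Rightarrow> real"
  assumes [measurable]: "f \<in> borel_measurable borel" and c: "\<And>j. j \<in> Basis \<Longrightarrow> \<bar>c j\<bar> = 1"
  shows "(\<integral>x. f (\<Sum>j\<in>Basis. (c j * (x \<bullet> j)) *\<^sub>R j) \<partial>std_gauss) = (\<integral>x. f x \<partial>std_gauss)"
proof -
  let ?T = "\<lambda>x::'a. \<Sum>j\<in>Basis. (c j * (x \<bullet> j)) *\<^sub>R j"
  have [measurable]: "?T \<in> borel_measurable borel" by measurable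
  have "\<And>j. j \<in> Basis \<Longrightarrow> c j \<noteq> 0" using c by force
  from lborel_affine_euclidean[where c=c and t=0, OF this]
  have lb: "distr lborel borel ?T = lborel"
    using c by (simp add: density_1)
  have "(c j * a)\<^sup>2 = a\<^sup>2" if "j \<in> Basis" for j a
    using c[OF that] by (metis abs_mult mult_1 power2_abs)
  then have g: "gauss_density (?T x) = gauss_density x" for x
    unfolding gauss_density_def std_normal_density_def by (intro prod.cong) (auto simp: inner_sum_left inner_Basis if_distrib cong: if_cong)
  have "(\<integral>x. gauss_density x *\<^sub>R f x \<partial>lborel) = (\<integral>x. gauss_density x *\<^sub>R f x \<partial>distr lborel borel ?T)"
    by (simp add: lb)
  also have "\<dots> = (\<integral>x. gauss_density x *\<^sub>R f (?T x) \<partial>lborel)"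
    by (subst integral_distr) (auto simp: g)
  finally show ?thesis unfolding std_gauss_def by (subst (1 2) integral_density) auto
qed

lemma std_gauss_mean:
  fixes i :: "'a::euclidean_space"
  assumes "i \<in> Basis"
  shows "(\<integral>x. x \<bullet> i \<partial>std_gauss) = 0"
proof -
  have "(\<integral>x. (\<Sum>j\<in>Basis. ((-1) * (x \<bullet> j)) *\<^sub>R j) \<bullet> i \<partial>std_gauss) = (\<integral>x. x \<bullet> i \<partial>std_gauss)"
    by (rule integral_std_gauss_flip) auto
  then show ?thesis
    using assms by (simp add: inner_sum_left inner_Basis if_distrib sum_negf cong: if_cong)
qed

lemma std_gauss_cov:
  fixes i j :: "'a::euclidean_space"
  assumes ij: "i \<in> Basis" "j \<in> Basis"
  shows "(\<integral>x. (x \<bullet> i) * (x \<bullet> j) \<partial>std_gauss) = (if i = j then 1 else 0)"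
proof (cases "i = j")
  case False
  \<comment> \<open>Reflecting coordinate \<open>i\<close> alone changes the sign of the
    integrand.\<close>
  have "(\<integral>x. ((\<Sum>k\<in>Basis. ((if k = i then -1 else 1) * (x \<bullet> k)) *\<^sub>R k) \<bullet> i) * ((\<Sum>k\<in>Basis. ((if k = i then -1 else 1) * (x \<bullet> k)) *\<^sub>R k) \<bullet> j) \<partial>std_gauss)
      = (\<integral>x. (x \<bullet> i) * (x \<bullet> j) \<partial>std_gauss)"
    by (rule integral_std_gauss_flip) auto
  moreover have "((\<Sum>k\<in>Basis. ((if k = i then -1 else 1) * (x \<bullet> k)) *\<^sub>R k) \<bullet> l) = (if l = i then -1 else 1) * (x \<bullet> l)"
    if "l \<in> Basis" for x l
    using that by (simp add: inner_sum_left inner_Basis if_distrib cong: if_cong)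
  ultimately show ?thesis using ij False by simp
next
  case True
  \<comment> \<open>On the diagonal the integral factors over the coordinates: a second moment in
    coordinate \<open>i\<close>, a total mass in every other one.\<close>
  let ?f = "\<lambda>b x. ennreal (std_normal_density x * (if b = i then x\<^sup>2 else 1))"
  have one: "(\<integral>\<^sup>+x. ?f b x \<partial>lborel) = 1" for b
    using integral_std_normal_moment_even[of 1] integrable_std_normal_moment[of 2]
    by (cases "b = i"; subst nn_integral_eq_integral) (auto simp: fact_numeral)
  have prod_if: "(\<Prod>b\<in>Basis. (if b = i then (x \<bullet> b)\<^sup>2 else 1)) = (x \<bullet> i)\<^sup>2" for x
    using ij by simp
  have "(\<integral>\<^sup>+x. ennreal ((x \<bullet> i)\<^sup>2) \<partial>std_gauss) = (\<integral>\<^sup>+x. (\<Prod>b\<in>Basis. ?f b (x \<bullet> b)) \<partial>lborel)"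
    by (subst nn_integral_std_gauss) (auto simp: gauss_density_def prod_ennreal prod.distrib prod_if ennreal_mult prod_nonneg)
  also have "\<dots> = (\<Prod>b\<in>(Basis::'a set). (\<integral>\<^sup>+x. ?f b x \<partial>lborel))"
    by (subst nn_integral_lborel_prod) auto
  also have "\<dots> = 1" by (simp only: one) simp
  finally have "(\<integral>\<^sup>+x. ennreal ((x \<bullet> i)\<^sup>2) \<partial>std_gauss) = 1" .
  then have "(\<integral>x. (x \<bullet> i)\<^sup>2 \<partial>std_gauss) = 1"
    by (subst integral_eq_nn_integral) auto
  then show ?thesis using True by (simp add: power2_eq_square)
qed

text \<open>Rotation invariance in terms of densities. For fixed \<open>y\<close> the variable
  \<open>z\<close> is replaced by \<open>u\<close> with \<open>s y + r z = \<rho> u\<close>; the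
  resulting joint density is symmetric in \<open>y\<close> and \<open>u\<close>, so integrating out
  \<open>y\<close> leaves the standard density in \<open>u\<close>. Nonnegative functions allow
  Tonelli without any integrability condition.\<close>

lemma std_gauss_conv_nn:
  fixes F :: "'a::euclidean_space \<Rightarrow> ennreal"
  assumes [measurable]: "F \<in> borel_measurable borel" and r: "0 < r"
  shows "(\<integral>\<^sup>+y. (\<integral>\<^sup>+z. F (s *\<^sub>R y + r *\<^sub>R z) \<partial>std_gauss) \<partial>std_gauss)
       = (\<integral>\<^sup>+z. F (sqrt (s\<^sup>2 + r\<^sup>2) *\<^sub>R z) \<partial>std_gauss)"
proof -
  define \<rho> where "\<rho> = sqrt (s\<^sup>2 + r\<^sup>2)"
  have \<rho>: "\<rho> > 0" "\<rho>\<^sup>2 = s\<^sup>2 + r\<^sup>2" using r by (auto simp: \<rho>_def sum_power2_gt_zero_iff)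
  \<comment> \<open>The Jacobian of the substitution
    \<open>z = t + (\<rho> / r) *\<^sub>R u\<close>.\<close>
  let ?c = "(\<rho> / r) ^ DIM('a)"
  have sub: "(\<integral>\<^sup>+z. H z \<partial>lborel) = (\<integral>\<^sup>+u. ennreal ?c * H (t + (\<rho> / r) *\<^sub>R u) \<partial>lborel)"
    if [measurable]: "H \<in> borel_measurable borel" for H :: "'a \<Rightarrow> ennreal" and t
  proof -
    have "lborel = density (distr lborel borel (\<lambda>x::'a. t + (\<rho> / r) *\<^sub>R x)) (\<lambda>_. ennreal ?c)"
      using lborel_affine[of "\<rho> / r" t] \<rho> r by (simp add: ennreal_power)
    then have "(\<integral>\<^sup>+z. H z \<partial>lborel) = (\<integral>\<^sup>+z. H z \<partial>density (distr lborel borel (\<lambda>x::'a. t + (\<rho> / r) *\<^sub>R x)) (\<lambda>_. ennreal ?c))"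
      by simp
    also have "\<dots> = (\<integral>\<^sup>+u. ennreal ?c * H (t + (\<rho> / r) *\<^sub>R u) \<partial>lborel)"
      by (subst nn_integral_density) (auto simp: nn_integral_distr)
    finally show ?thesis .
  qed
  let ?g = "\<lambda>u y::'a. gauss_density ((\<rho> / r) *\<^sub>R y - (s / r) *\<^sub>R u)"
  have swap: "gauss_density y * ?g y u = gauss_density u * ?g u y" for u y
  proof -
    have n2: "(norm ((\<rho> / r) *\<^sub>R u - (s / r) *\<^sub>R y))\<^sup>2 = (\<rho>\<^sup>2 * (norm u)\<^sup>2 - 2 * \<rho> * s * (u \<bullet> y) + s\<^sup>2 * (norm y)\<^sup>2) / r\<^sup>2" for u y :: 'a
      unfolding power2_norm_eq_inner using r
      by (simp add: inner_diff inner_commute power2_eq_square field_simps)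
    have "(norm y)\<^sup>2 + (norm ((\<rho> / r) *\<^sub>R u - (s / r) *\<^sub>R y))\<^sup>2 = (norm u)\<^sup>2 + (norm ((\<rho> / r) *\<^sub>R y - (s / r) *\<^sub>R u))\<^sup>2"
      unfolding n2 \<rho>(2) using r by (simp add: inner_commute field_simps)
    then have "exp (- (norm y)\<^sup>2 / 2) * exp (- (norm ((\<rho> / r) *\<^sub>R u - (s / r) *\<^sub>R y))\<^sup>2 / 2)
      = exp (- (norm u)\<^sup>2 / 2) * exp (- (norm ((\<rho> / r) *\<^sub>R y - (s / r) *\<^sub>R u))\<^sup>2 / 2)"
      unfolding exp_add[symmetric] by (intro arg_cong[where f=exp]) (simp add: field_simps)
    then show ?thesis unfolding gauss_density_eq by (simp add: mult_ac)
  qed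
  have inner: "(\<integral>\<^sup>+y. ennreal ?c * ennreal (?g u y) \<partial>lborel) = 1" for u
  proof -
    have "(\<integral>\<^sup>+y. ennreal ?c * ennreal (?g u y) \<partial>lborel) = (\<integral>\<^sup>+y. ennreal ?c * ennreal (gauss_density (- (s / r) *\<^sub>R u + (\<rho> / r) *\<^sub>R y)) \<partial>lborel)"
      by (simp add: algebra_simps)
    also have "\<dots> = (\<integral>\<^sup>+y. ennreal (gauss_density y) \<partial>(lborel :: 'a measure))"
      by (rule sub[symmetric]) measurable
    also have "\<dots> = (\<integral>\<^sup>+y. 1 \<partial>(std_gauss :: 'a measure))" by (subst nn_integral_std_gauss) auto
    also have "\<dots> = 1" using std_gauss.emeasure_space_1 by simp
    finally show ?thesis .
  qed
  have "(\<integral>\<^sup>+z. F (s *\<^sub>R y + r *\<^sub>R z) \<partial>std_gauss) = (\<integral>\<^sup>+u. ennreal ?c * (ennreal (?g y u) * F (\<rho> *\<^sub>R u)) \<partial>lborel)" for y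
  proof -
    have e: "s *\<^sub>R y + r *\<^sub>R (- (s / r) *\<^sub>R y + (\<rho> / r) *\<^sub>R u) = \<rho> *\<^sub>R u" for u
      using r by (simp add: scaleR_add_right scaleR_diff_right)
    have "(\<integral>\<^sup>+z. F (s *\<^sub>R y + r *\<^sub>R z) \<partial>std_gauss) = (\<integral>\<^sup>+z. ennreal (gauss_density z) * F (s *\<^sub>R y + r *\<^sub>R z) \<partial>lborel)"
      by (rule nn_integral_std_gauss) measurable
    also have "\<dots> = (\<integral>\<^sup>+u. ennreal ?c * (ennreal (gauss_density (- (s / r) *\<^sub>R y + (\<rho> / r) *\<^sub>R u)) * F (s *\<^sub>R y + r *\<^sub>R (- (s / r) *\<^sub>R y + (\<rho> / r) *\<^sub>R u))) \<partial>lborel)"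
      by (rule sub) measurable
    finally show ?thesis unfolding e by (simp add: algebra_simps)
  qed
  then have "(\<integral>\<^sup>+y. (\<integral>\<^sup>+z. F (s *\<^sub>R y + r *\<^sub>R z) \<partial>std_gauss) \<partial>std_gauss)
      = (\<integral>\<^sup>+y. ennreal (gauss_density y) * (\<integral>\<^sup>+u. ennreal ?c * (ennreal (?g y u) * F (\<rho> *\<^sub>R u)) \<partial>lborel) \<partial>lborel)"
    by (simp add: nn_integral_std_gauss)
  also have "\<dots> = (\<integral>\<^sup>+y. (\<integral>\<^sup>+u. ennreal (gauss_density u) * F (\<rho> *\<^sub>R u) * (ennreal ?c * ennreal (?g u y)) \<partial>lborel) \<partial>lborel)"
  proof (intro nn_integral_cong, subst nn_integral_cmult[symmetric])
    fix y :: 'a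
    have "ennreal (gauss_density y) * (ennreal ?c * (ennreal (?g y u) * F (\<rho> *\<^sub>R u)))
      = ennreal (gauss_density u) * F (\<rho> *\<^sub>R u) * (ennreal ?c * ennreal (?g u y))" for u
    proof -
      have "ennreal (gauss_density y) * ennreal (?g y u) = ennreal (gauss_density u) * ennreal (?g u y)"
        using swap[of y u] by (simp add: ennreal_mult[symmetric])
      then have "(ennreal ?c * F (\<rho> *\<^sub>R u)) * (ennreal (gauss_density y) * ennreal (?g y u))
          = (ennreal ?c * F (\<rho> *\<^sub>R u)) * (ennreal (gauss_density u) * ennreal (?g u y))"
        by (rule arg_cong)
      then show ?thesis by (simp only: mult_ac)
    qed
    then show "(\<integral>\<^sup>+u. ennreal (gauss_density y) * (ennreal ?c * (ennreal (?g y u) * F (\<rho> *\<^sub>R u))) \<partial>lborel)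
      = (\<integral>\<^sup>+u. ennreal (gauss_density u) * F (\<rho> *\<^sub>R u) * (ennreal ?c * ennreal (?g u y)) \<partial>lborel)"
      by simp
  qed measurable
  also have "\<dots> = (\<integral>\<^sup>+u. (\<integral>\<^sup>+y. ennreal (gauss_density u) * F (\<rho> *\<^sub>R u) * (ennreal ?c * ennreal (?g u y)) \<partial>lborel) \<partial>lborel)"
    by (subst lborel_pair.Fubini') auto
  also have "\<dots> = (\<integral>\<^sup>+u. ennreal (gauss_density u) * F (\<rho> *\<^sub>R u) \<partial>lborel)"
    by (subst nn_integral_cmult) (auto simp: inner)
  also have "\<dots> = (\<integral>\<^sup>+z. F (\<rho> *\<^sub>R z) \<partial>std_gauss)"
    by (subst nn_integral_std_gauss) auto
  finally show ?thesis unfolding \<rho>_def .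
qed

section \<open>Lindeberg replacement with Gaussian smoothing\<close>

lemma exp_taylor_bounds:
  fixes r :: real
  shows "\<bar>exp r - 1\<bar> \<le> \<bar>r\<bar> * exp \<bar>r\<bar>"
    and "\<bar>exp r - 1 - r\<bar> \<le> r\<^sup>2 * exp \<bar>r\<bar>"
    and "\<bar>exp r - 1 - r - r\<^sup>2 / 2\<bar> \<le> \<bar>r\<bar> ^ 3 * exp \<bar>r\<bar>"
proof -
  have *: "\<bar>exp r - (\<Sum>m<n. r ^ m / fact m)\<bar> \<le> \<bar>r\<bar> ^ n * exp \<bar>r\<bar>" for n
  proof -
    obtain t where t: "\<bar>t\<bar> \<le> \<bar>r\<bar>" "exp r = (\<Sum>m<n. r ^ m / fact m) + exp t / fact n * r ^ n"
      using Maclaurin_exp_le by blast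
    have "exp t \<le> exp \<bar>r\<bar>" using t(1) by simp
    moreover have "exp t / fact n \<le> exp t / 1" by (intro divide_left_mono) (auto simp: fact_ge_1)
    then have "exp t / fact n \<le> exp t" by simp
    ultimately have "exp t / fact n \<le> exp \<bar>r\<bar>" by (rule order_trans[rotated])
    then have "exp t / fact n * \<bar>r\<bar> ^ n \<le> exp \<bar>r\<bar> * \<bar>r\<bar> ^ n"
      by (intro mult_right_mono) auto
    then show ?thesis using t(2) by (simp add: abs_mult power_abs mult.commute)
  qed
  show "\<bar>exp r - 1\<bar> \<le> \<bar>r\<bar> * exp \<bar>r\<bar>" using *[of 1] by simp
  show "\<bar>exp r - 1 - r\<bar> \<le> r\<^sup>2 * exp \<bar>r\<bar>" using *[of 2] by (simp add: numeral_2_eq_2 diff_diff_eq)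
  show "\<bar>exp r - 1 - r - r\<^sup>2 / 2\<bar> \<le> \<bar>r\<bar> ^ 3 * exp \<bar>r\<bar>"
    using *[of 3] by (simp add: numeral_3_eq_3 diff_diff_eq power2_eq_square add.assoc)
qed

lemma integrable_std_gauss_exp_bound:
  fixes f :: "'a::euclidean_space \<Rightarrow> real"
  assumes [measurable]: "f \<in> borel_measurable borel" and le: "\<And>z. \<bar>f z\<bar> \<le> K * exp (k * norm z)"
  shows "integrable std_gauss f"
proof (rule Bochner_Integration.integrable_bound)
  show "integrable std_gauss (\<lambda>x::'a. K * exp (k * norm x))"
    using integrable_exp_norm_std_gauss by (rule integrable_mult_right)
  show "AE x in std_gauss. norm (f x) \<le> norm (K * exp (k * norm x))"
    unfolding real_norm_def by (intro always_eventually allI order_trans[OF le abs_ge_self])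
qed auto

text \<open>What is subtracted are the Hermite terms of degree 0, 1 and 2 of the generating function
  \<open>exp (u \<bullet> z - (norm u)\<^sup>2 / 2)\<close>, ordered by powers of \<open>u\<close>
  and not by powers of the exponent.\<close>

definition gauss_remainder :: "'a::euclidean_space \<Rightarrow> 'a \<Rightarrow> real" where
  "gauss_remainder u z = exp (u \<bullet> z - (norm u)\<^sup>2 / 2) - (1 + u \<bullet> z + ((u \<bullet> z)\<^sup>2 - (norm u)\<^sup>2) / 2)"

lemma gauss_remainder_measurable [measurable]: "gauss_remainder u \<in> borel_measurable borel"
  unfolding gauss_remainder_def by measurable

lemma gauss_polynomial_bound:
  fixes u z :: "'a::euclidean_space"
  shows "\<bar>1 + u \<bullet> z + ((u \<bullet> z)\<^sup>2 - (norm u)\<^sup>2) / 2\<bar> \<le> (1 + norm u)\<^sup>2 * exp (2 * norm z)"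
proof -
  have a: "\<bar>u \<bullet> z\<bar> \<le> norm u * norm z" by (rule Cauchy_Schwarz_ineq2)
  then have a2: "(u \<bullet> z)\<^sup>2 \<le> (norm u * norm z)\<^sup>2" by (metis abs_ge_zero power2_abs power_mono)
  have z: "norm z \<le> exp (2 * norm z)" "(norm z)\<^sup>2 \<le> exp (2 * norm z)" "1 \<le> exp (2 * norm z)"
    using power_le_exp[of "norm z" 2] exp_ge_add_one_self[of "2 * norm z"] by (auto intro: order_trans[of _ "1 + 2 * norm z"])
  have "\<bar>1 + u \<bullet> z + ((u \<bullet> z)\<^sup>2 - (norm u)\<^sup>2) / 2\<bar> \<le> 1 + norm u * norm z + ((norm u)\<^sup>2 * (norm z)\<^sup>2 + (norm u)\<^sup>2) / 2"
  proof -
    have "0 \<le> (u \<bullet> z)\<^sup>2" "0 \<le> (norm u)\<^sup>2" "(u \<bullet> z)\<^sup>2 \<le> (norm u)\<^sup>2 * (norm z)\<^sup>2"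
      using a2[unfolded power_mult_distrib] by auto
    moreover have "\<bar>1 + p + (P - U) / 2\<bar> \<le> 1 + N + (Q + U) / 2"
      if "\<bar>p\<bar> \<le> N" "0 \<le> P" "0 \<le> U" "P \<le> Q" for p N P U Q :: real
    proof (rule abs_leI)
      have "p \<le> N" "- p \<le> N" using that(1) by auto
      then show "1 + p + (P - U) / 2 \<le> 1 + N + (Q + U) / 2" "- (1 + p + (P - U) / 2) \<le> 1 + N + (Q + U) / 2"
        using that(2-4) by (simp_all add: field_simps)
    qed
    ultimately show ?thesis using a by blast
  qed
  also have "\<dots> \<le> exp (2 * norm z) + norm u * exp (2 * norm z) + ((norm u)\<^sup>2 * exp (2 * norm z) + (norm u)\<^sup>2 * exp (2 * norm z)) / 2"
    using z by (intro add_mono divide_right_mono mult_left_mono) (auto simp: mult_le_cancel_left1)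
  also have "\<dots> \<le> (1 + norm u)\<^sup>2 * exp (2 * norm z)"
    by (simp add: power2_sum algebra_simps)
  finally show ?thesis .
qed

lemma exp_tilt_integrable: "integrable std_gauss (\<lambda>z. exp (u \<bullet> z - (norm u)\<^sup>2 / 2))"
  unfolding exp_diff by (intro integrable_divide std_gauss_mgf_integrable)

lemma integrable_gauss_remainder: "integrable std_gauss (gauss_remainder u)"
  unfolding gauss_remainder_def
  by (intro Bochner_Integration.integrable_diff exp_tilt_integrable
      integrable_std_gauss_exp_bound[OF _ gauss_polynomial_bound]) measurable

text \<open>For \<open>norm u \<ge> 1\<close> the exponential and the polynomial are each of order
  \<open>norm u ^ 3\<close> in mean. For smaller \<open>u\<close> the exponential is expanded to
  second order in its exponent \<open>r\<close>; the error is cubic in \<open>norm u\<close>, and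
  growth in \<open>z\<close> is absorbed by an exponential of \<open>norm z\<close>.\<close>

lemma gauss_remainder_bound:
  "\<exists>C\<ge>0. \<forall>u::'a::euclidean_space. (\<integral>z. \<bar>gauss_remainder u z\<bar> \<partial>std_gauss) \<le> C * norm u ^ 3"
proof -
  let ?I = "\<integral>z. 4 * exp (2 * norm (z::'a)) \<partial>std_gauss"
  let ?J = "\<integral>z. 2 * exp (4 * (norm (z::'a) + 1)) \<partial>std_gauss"
  have iI: "integrable std_gauss (\<lambda>z::'a. 4 * exp (2 * norm z))"
    by (intro integrable_mult_right integrable_exp_norm_std_gauss)
  have iJ: "integrable std_gauss (\<lambda>z::'a. 2 * exp (4 * (norm z + 1)))"
  proof -
    have "(\<lambda>z::'a. 2 * exp (4 * (norm z + 1))) = (\<lambda>z. (2 * exp 4) * exp (4 * norm z))"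
      by (simp add: distrib_left exp_add mult_ac)
    then show ?thesis
      using integrable_mult_right[OF integrable_exp_norm_std_gauss[of 4], of "2 * exp 4"] by simp
  qed
  have nn: "0 \<le> ?I" "0 \<le> ?J" by (auto intro!: integral_nonneg_AE)
  have "(\<integral>z. \<bar>gauss_remainder u z\<bar> \<partial>std_gauss) \<le> (1 + ?I + ?J) * norm u ^ 3" for u :: 'a
  proof (cases "1 \<le> norm u")
    case True
    have "\<bar>gauss_remainder u z\<bar> \<le> exp (u \<bullet> z - (norm u)\<^sup>2 / 2) + norm u ^ 3 * (4 * exp (2 * norm z))" for z
    proof -
      have "(1 + norm u)\<^sup>2 \<le> (2 * norm u)\<^sup>2" using True by (intro power_mono) auto
      also have "\<dots> \<le> 4 * norm u ^ 3" using True by (simp add: power_mult_distrib power_increasing)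
      finally have "(1 + norm u)\<^sup>2 * exp (2 * norm z) \<le> 4 * norm u ^ 3 * exp (2 * norm z)"
        by (rule mult_right_mono) simp
      then have "\<bar>1 + u \<bullet> z + ((u \<bullet> z)\<^sup>2 - (norm u)\<^sup>2) / 2\<bar> \<le> norm u ^ 3 * (4 * exp (2 * norm z))"
        using gauss_polynomial_bound[of u z] by (simp only: mult_ac)
      then show ?thesis
        unfolding gauss_remainder_def using exp_gt_zero[of "u \<bullet> z - (norm u)\<^sup>2 / 2"] by linarith
    qed
    then have "(\<integral>z. \<bar>gauss_remainder u z\<bar> \<partial>std_gauss)
        \<le> (\<integral>z. exp (u \<bullet> z - (norm u)\<^sup>2 / 2) + norm u ^ 3 * (4 * exp (2 * norm z)) \<partial>std_gauss)"
      using integrable_abs[OF integrable_gauss_remainder]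
        Bochner_Integration.integrable_add[OF exp_tilt_integrable integrable_mult_right[OF iI]]
      by (rule integral_mono[rotated 2])
    also have "\<dots> = (\<integral>z. exp (u \<bullet> z - (norm u)\<^sup>2 / 2) \<partial>std_gauss) + norm u ^ 3 * ?I"
      by (subst Bochner_Integration.integral_add)
        (auto intro!: exp_tilt_integrable integrable_exp_norm_std_gauss)
    also have "(\<integral>z. exp (u \<bullet> z - (norm u)\<^sup>2 / 2) \<partial>std_gauss) = 1"
      using std_gauss_mgf[of u] by (simp add: exp_diff)
    also have "1 + norm u ^ 3 * ?I \<le> (1 + ?I + ?J) * norm u ^ 3"
    proof -
      have "1 + t * a \<le> (1 + a + b) * t" if "1 \<le> t" "0 \<le> b" for t a b :: real
      proof -
        have "0 \<le> b * t" using that by (intro mult_nonneg_nonneg) auto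
        moreover have "(1 + a + b) * t = t + t * a + b * t" by (simp add: algebra_simps)
        ultimately show ?thesis using that(1) by linarith
      qed
      then show ?thesis using one_le_power[OF True, of 3] nn(2) by blast
    qed
    finally show ?thesis .
  next
    case False
    have "\<bar>gauss_remainder u z\<bar> \<le> norm u ^ 3 * (2 * exp (4 * (norm z + 1)))" for z
    proof -
      define \<tau> a m where "\<tau> = norm u" and "a = u \<bullet> z" and "m = norm z + 1"
      have \<tau>: "0 \<le> \<tau>" "\<tau> \<le> 1" "1 \<le> m" using False by (auto simp: \<tau>_def m_def)
      have a: "\<bar>a\<bar> \<le> \<tau> * (m - 1)" unfolding \<tau>_def a_def m_def using Cauchy_Schwarz_ineq2[of u z] by simp
      define r where "r = a - \<tau>\<^sup>2 / 2"
      have t2: "\<tau>\<^sup>2 \<le> \<tau>" using \<tau> by (simp add: power2_eq_square mult_left_le)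
      have r: "\<bar>r\<bar> \<le> \<tau> * m" using a t2 \<tau> zero_le_power2[of \<tau>]
        unfolding r_def abs_le_iff right_diff_distrib mult_1_right by linarith
      have r1: "\<bar>r\<bar> \<le> m" using r \<tau> by (meson mult_left_le_one_le order_trans order_trans[OF zero_le_one])
      have "\<bar>exp r - 1 - r - r\<^sup>2 / 2\<bar> \<le> \<bar>r\<bar> ^ 3 * exp \<bar>r\<bar>" by (rule exp_taylor_bounds)
      also have "\<dots> \<le> (\<tau> * m) ^ 3 * exp m" using r r1 by (intro mult_mono power_mono) auto
      also have "\<dots> \<le> \<tau> ^ 3 * exp (3 * m) * exp m"
        using power_le_exp[of m 3] \<tau> unfolding power_mult_distrib by (intro mult_right_mono mult_left_mono) auto
      also have "\<dots> = \<tau> ^ 3 * exp (4 * m)" by (simp add: mult.assoc exp_add[symmetric])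
      finally have 1: "\<bar>exp r - 1 - r - r\<^sup>2 / 2\<bar> \<le> \<tau> ^ 3 * exp (4 * m)" .
      \<comment> \<open>Twice the discrepancy between \<open>1 + r + r\<^sup>2 / 2\<close> and the
        Hermite polynomial: the part of \<open>r\<^sup>2\<close> that has order three and four in
        \<open>\<tau>\<close>.\<close>
      have "\<bar>- a * \<tau>\<^sup>2 + \<tau> ^ 4 / 4\<bar> \<le> \<bar>a\<bar> * \<tau>\<^sup>2 + \<tau> ^ 4 / 4"
        by (rule order_trans[OF abs_triangle_ineq]) (simp add: abs_mult)
      also have "\<dots> \<le> \<tau> * (m - 1) * \<tau>\<^sup>2 + \<tau> ^ 3"
      proof (rule add_mono)
        show "\<bar>a\<bar> * \<tau>\<^sup>2 \<le> \<tau> * (m - 1) * \<tau>\<^sup>2" using a by (rule mult_right_mono) simp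
        have "\<tau> ^ 4 \<le> \<tau> ^ 3" using \<tau> by (intro power_decreasing) auto
        then show "\<tau> ^ 4 / 4 \<le> \<tau> ^ 3" using zero_le_power[OF \<tau>(1), of 3] by linarith
      qed
      also have "\<dots> = \<tau> ^ 3 * m" by (simp add: algebra_simps power2_eq_square power3_eq_cube)
      also have "\<dots> \<le> \<tau> ^ 3 * exp (4 * m)"
        using power_le_exp[of m 1] \<tau> by (intro mult_left_mono) (auto intro: order_trans[of m "exp m"])
      finally have 2: "\<bar>- a * \<tau>\<^sup>2 + \<tau> ^ 4 / 4\<bar> \<le> \<tau> ^ 3 * exp (4 * m)" .
      have "gauss_remainder u z = (exp r - 1 - r - r\<^sup>2 / 2) + (- a * \<tau>\<^sup>2 + \<tau> ^ 4 / 4) / 2"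
        unfolding gauss_remainder_def r_def a_def \<tau>_def
        by (simp add: power2_eq_square power4_eq_xxxx field_simps)
      moreover have "\<bar>A + B / 2\<bar> \<le> 2 * E" if "\<bar>A\<bar> \<le> E" "\<bar>B\<bar> \<le> E" for A B E :: real
        using that by linarith
      ultimately have "\<bar>gauss_remainder u z\<bar> \<le> 2 * (\<tau> ^ 3 * exp (4 * m))"
        using 1 2 by simp
      then show ?thesis unfolding \<tau>_def m_def by simp
    qed
    then have "(\<integral>z. \<bar>gauss_remainder u z\<bar> \<partial>std_gauss) \<le> (\<integral>z. norm u ^ 3 * (2 * exp (4 * (norm (z::'a) + 1))) \<partial>std_gauss)"
      using integrable_abs[OF integrable_gauss_remainder] integrable_mult_right[OF iJ]
      by (rule integral_mono[rotated 2])
    also have "(\<integral>z. norm u ^ 3 * (2 * exp (4 * (norm (z::'a) + 1))) \<partial>std_gauss) = norm u ^ 3 * ?J" by simp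
    also have "\<dots> \<le> (1 + ?I + ?J) * norm u ^ 3"
      using mult_right_mono[of ?J "1 + ?I + ?J" "norm u ^ 3"] nn by (simp only: mult.commute) simp
    finally show ?thesis .
  qed
  then show ?thesis using nn by (intro exI[of _ "1 + ?I + ?J"]) auto
qed

section \<open>Averaging operators and their iterates\<close>

text \<open>Averaging over one step \<open>s W\<close>, with \<open>W\<close> of law
  \<open>\<rho>\<close>. The \<open>n\<close>-th iterate at \<open>x\<close> is the expectation of
  \<open>f\<close> at \<open>x\<close> plus \<open>s\<close> times a sum of \<open>n\<close>
  independent copies of \<open>W\<close>, so sums are handled without product spaces.\<close>

definition avg_op :: "'a::euclidean_space measure \<Rightarrow> real \<Rightarrow> ('a \<Rightarrow> real) \<Rightarrow> 'a \<Rightarrow> real" where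
  "avg_op \<rho> s f x = (\<integral>w. f (x + s *\<^sub>R w) \<partial>\<rho>)"

definition bdd_borel :: "('a::euclidean_space \<Rightarrow> real) \<Rightarrow> bool" where
  "bdd_borel f \<longleftrightarrow> f \<in> borel_measurable borel \<and> (\<exists>B. \<forall>x. \<bar>f x\<bar> \<le> B)"

locale borel_prob = prob_space \<rho> for \<rho> :: "'a::euclidean_space measure" +
  assumes sets_eq [simp, measurable_cong]: "sets \<rho> = sets borel"
begin

lemma space_eq [simp]: "space \<rho> = UNIV"
  using sets_eq_imp_space_eq[OF sets_eq] by simp

lemma integrable_bdd_borel:
  assumes "bdd_borel f"
  shows "integrable \<rho> f"
proof -
  from assms obtain B where "f \<in> borel_measurable borel" "\<And>x. \<bar>f x\<bar> \<le> B"
    unfolding bdd_borel_def by auto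
  then show ?thesis by (intro integrable_const_bound[where B=B]) auto
qed

lemma bdd_borel_affine:
  "bdd_borel f \<Longrightarrow> bdd_borel (\<lambda>w. f (x + s *\<^sub>R w))"
  unfolding bdd_borel_def by auto

lemma measurable_avg_op:
  assumes [measurable]: "f \<in> borel_measurable borel"
  shows "avg_op \<rho> s f \<in> borel_measurable borel"
  unfolding avg_op_def[abs_def] by (rule borel_measurable_lebesgue_integral) measurable

lemma avg_op_bound:
  assumes f: "f \<in> borel_measurable borel" "\<And>x. \<bar>f x\<bar> \<le> B"
  shows "\<bar>avg_op \<rho> s f x\<bar> \<le> B"
proof -
  have i: "integrable \<rho> (\<lambda>w. f (x + s *\<^sub>R w))"
    using f by (intro integrable_bdd_borel bdd_borel_affine) (auto simp: bdd_borel_def)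
  have "\<bar>avg_op \<rho> s f x\<bar> \<le> (\<integral>w. \<bar>f (x + s *\<^sub>R w)\<bar> \<partial>\<rho>)" unfolding avg_op_def by (rule integral_abs_bound)
  also have "\<dots> \<le> (\<integral>w. B \<partial>\<rho>)" using i f by (intro integral_mono) auto
  finally show ?thesis using prob_space by simp
qed

lemma bdd_borel_avg_op: "bdd_borel f \<Longrightarrow> bdd_borel (avg_op \<rho> s f)"
  using measurable_avg_op avg_op_bound unfolding bdd_borel_def by blast

lemma bdd_borel_avg_op_pow: "bdd_borel f \<Longrightarrow> bdd_borel ((avg_op \<rho> s ^^ n) f)"
  by (induction n) (auto intro: bdd_borel_avg_op)

lemma avg_op_0: "avg_op \<rho> 0 f = f"
  unfolding avg_op_def using prob_space by (simp add: fun_eq_iff)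

lemma avg_op_diff_bound:
  assumes "bdd_borel f" "bdd_borel g" "\<And>x. \<bar>f x - g x\<bar> \<le> e"
  shows "\<bar>avg_op \<rho> s f x - avg_op \<rho> s g x\<bar> \<le> e"
proof -
  have "avg_op \<rho> s f x - avg_op \<rho> s g x = avg_op \<rho> s (\<lambda>x. f x - g x) x"
    unfolding avg_op_def using assms(1,2)
    by (subst Bochner_Integration.integral_diff) (auto intro!: integrable_bdd_borel bdd_borel_affine)
  also have "\<bar>\<dots>\<bar> \<le> e" using assms by (intro avg_op_bound) (auto simp: bdd_borel_def)
  finally show ?thesis .
qed

end

interpretation std_gauss: borel_prob std_gauss
  by unfold_locales simp

text \<open>With \<open>A\<close> and \<open>B\<close> the two averaging operators,
  \<open>A ^ n - B ^ n\<close> is the sum of \<open>A ^ (n - 1 - k) (A - B) B ^ k\<close>, and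
  \<open>A\<close> is a contraction in the supremum norm. In this order the difference
  \<open>A - B\<close> only meets functions already averaged by \<open>B\<close>, which in the
  application is Gaussian and smoothing.\<close>

lemma avg_op_telescope:
  assumes "borel_prob \<nu>" "borel_prob \<nu>'" "bdd_borel g"
    and step: "\<And>k x. k < n \<Longrightarrow> \<bar>avg_op \<nu> s ((avg_op \<nu>' s' ^^ k) g) x - avg_op \<nu>' s' ((avg_op \<nu>' s' ^^ k) g) x\<bar> \<le> e k"
  shows "\<bar>(avg_op \<nu> s ^^ n) g x - (avg_op \<nu>' s' ^^ n) g x\<bar> \<le> (\<Sum>k<n. e k)"
  using step
proof (induction n arbitrary: x)
  case (Suc n)
  interpret \<nu>: borel_prob \<nu> by fact
  interpret \<nu>': borel_prob \<nu>' by fact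
  have "\<bar>avg_op \<nu> s ((avg_op \<nu> s ^^ n) g) x - avg_op \<nu> s ((avg_op \<nu>' s' ^^ n) g) x\<bar> \<le> (\<Sum>k<n. e k)"
    using Suc.IH Suc.prems assms(3) by (intro \<nu>.avg_op_diff_bound \<nu>.bdd_borel_avg_op_pow \<nu>'.bdd_borel_avg_op_pow) auto
  moreover have "\<bar>avg_op \<nu> s ((avg_op \<nu>' s' ^^ n) g) x - avg_op \<nu>' s' ((avg_op \<nu>' s' ^^ n) g) x\<bar> \<le> e n"
    using Suc.prems by auto
  ultimately show ?case by simp
qed simp

lemma emeasure_distr_nn_integral:
  "g \<in> measurable N L \<Longrightarrow> A \<in> sets L \<Longrightarrow> emeasure (distr N L g) A = (\<integral>\<^sup>+p. indicator A (g p) \<partial>N)"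
  by (simp add: nn_integral_indicator[symmetric] nn_integral_distr del: nn_integral_indicator)

lemma avg_op_std_gauss_semigroup:
  fixes f :: "'a::euclidean_space \<Rightarrow> real"
  assumes f: "bdd_borel f" and r: "0 < r"
  shows "avg_op std_gauss s (avg_op std_gauss r f) = avg_op std_gauss (sqrt (s\<^sup>2 + r\<^sup>2)) f"
proof
  fix x
  interpret P: pair_prob_space "std_gauss :: 'a measure" "std_gauss :: 'a measure" ..
  let ?P = "std_gauss \<Otimes>\<^sub>M std_gauss :: ('a \<times> 'a) measure"
  have [measurable]: "f \<in> borel_measurable borel" using f by (simp add: bdd_borel_def)
  have d: "distr ?P borel (\<lambda>(y, z). s *\<^sub>R y + r *\<^sub>R z) = distr std_gauss borel (\<lambda>z. sqrt (s\<^sup>2 + r\<^sup>2) *\<^sub>R z)"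
  proof (rule measure_eqI)
    fix A assume "A \<in> sets (distr ?P borel (\<lambda>(y, z). s *\<^sub>R y + r *\<^sub>R z))"
    then have A[measurable]: "A \<in> sets borel" by simp
    have "emeasure (distr ?P borel (\<lambda>(y, z). s *\<^sub>R y + r *\<^sub>R z)) A
        = (\<integral>\<^sup>+p. indicator A ((\<lambda>(y, z). s *\<^sub>R y + r *\<^sub>R z) p) \<partial>?P)"
      by (rule emeasure_distr_nn_integral) auto
    also have "\<dots> = (\<integral>\<^sup>+y. (\<integral>\<^sup>+z. indicator A (s *\<^sub>R y + r *\<^sub>R z) \<partial>std_gauss) \<partial>std_gauss)"
      by (subst std_gauss.nn_integral_fst[symmetric]) auto
    also have "\<dots> = (\<integral>\<^sup>+z. indicator A (sqrt (s\<^sup>2 + r\<^sup>2) *\<^sub>R z) \<partial>std_gauss)"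
      by (rule std_gauss_conv_nn[OF _ r]) measurable
    also have "\<dots> = emeasure (distr std_gauss borel (\<lambda>z. sqrt (s\<^sup>2 + r\<^sup>2) *\<^sub>R z)) A"
      by (rule emeasure_distr_nn_integral[symmetric]) auto
    finally show "emeasure (distr ?P borel (\<lambda>(y, z). s *\<^sub>R y + r *\<^sub>R z)) A
      = emeasure (distr std_gauss borel (\<lambda>z. sqrt (s\<^sup>2 + r\<^sup>2) *\<^sub>R z)) A" .
  qed simp
  obtain B where B: "\<And>x. \<bar>f x\<bar> \<le> B" using f by (auto simp: bdd_borel_def)
  have int: "integrable ?P (\<lambda>(y, z). f (x + s *\<^sub>R y + r *\<^sub>R z))"
    by (rule P.integrable_const_bound[where B=B]) (auto simp: B)
  have "avg_op std_gauss s (avg_op std_gauss r f) x = (\<integral>y. (\<integral>z. f (x + s *\<^sub>R y + r *\<^sub>R z) \<partial>std_gauss) \<partial>std_gauss)"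
    by (simp add: avg_op_def)
  also have "\<dots> = (\<integral>p. (\<lambda>(y, z). f (x + s *\<^sub>R y + r *\<^sub>R z)) p \<partial>?P)"
    using P.integral_fst'[OF int] by simp
  also have "\<dots> = (\<integral>w. f (x + w) \<partial>distr ?P borel (\<lambda>(y, z). s *\<^sub>R y + r *\<^sub>R z))"
    by (subst integral_distr) (auto simp: add.assoc split_beta' cong: Bochner_Integration.integral_cong)
  also have "\<dots> = avg_op std_gauss (sqrt (s\<^sup>2 + r\<^sup>2)) f x"
    unfolding d avg_op_def by (subst integral_distr) auto
  finally show "avg_op std_gauss s (avg_op std_gauss r f) x = avg_op std_gauss (sqrt (s\<^sup>2 + r\<^sup>2)) f x" .
qed

text \<open>This lets a preliminary smoothing be counted as a number of extra Gaussian
  steps.\<close>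

lemma avg_op_std_gauss_pow:
  assumes f: "bdd_borel f" and n: "n > 0"
  shows "(avg_op std_gauss (1 / sqrt (real n)) ^^ k) f = avg_op std_gauss (sqrt (real k / real n)) f"
proof (induction k)
  case 0
  show ?case by (simp add: std_gauss.avg_op_0)
next
  case (Suc k)
  show ?case
  proof (cases "k = 0")
    \<comment> \<open>The semigroup law asks for a positive inner scale, so the first step is
      treated apart.\<close>
    case True
    then show ?thesis by (simp add: real_sqrt_divide)
  next
    case False
    then have "avg_op std_gauss (1 / sqrt (real n)) (avg_op std_gauss (sqrt (real k / real n)) f)
      = avg_op std_gauss (sqrt ((1 / sqrt (real n))\<^sup>2 + (sqrt (real k / real n))\<^sup>2)) f"
      using n by (intro avg_op_std_gauss_semigroup[OF f]) auto
    also have "(1 / sqrt (real n))\<^sup>2 + (sqrt (real k / real n))\<^sup>2 = real (Suc k) / real n"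
      using n by (simp add: power_divide add_divide_distrib)
    finally show ?thesis using Suc by simp
  qed
qed

lemma integrable_real_bound:
  fixes f g :: "'a \<Rightarrow> real"
  assumes "integrable M g" "f \<in> borel_measurable M" "\<And>x. \<bar>f x\<bar> \<le> g x"
  shows "integrable M f"
  using assms by (intro Bochner_Integration.integrable_bound[of M g f]) (auto intro: order_trans[OF _ abs_ge_self])

text \<open>The coefficients are bounded because the laws to be compared agree only approximately in
  their first and second moments. The constant term \<open>c\<close> is left unbounded: it cancels
  between two probability measures.\<close>

definition quadratic_approx :: "('a::euclidean_space \<Rightarrow> real) \<Rightarrow> real \<Rightarrow> real \<Rightarrow> bool" where
  "quadratic_approx h C s \<longleftrightarrow> (\<exists>c A q. (\<forall>i\<in>Basis. \<bar>A i\<bar> \<le> C / s) \<and> (\<forall>i\<in>Basis. \<forall>j\<in>Basis. \<bar>q i j\<bar> \<le> C / s\<^sup>2) \<and>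
     (\<forall>w. \<bar>h w - (c + (\<Sum>i\<in>Basis. A i * (w \<bullet> i)) + (\<Sum>i\<in>Basis. \<Sum>j\<in>Basis. q i j * ((w \<bullet> i) * (w \<bullet> j))))\<bar>
        \<le> C * (norm w / s) ^ 3))"

text \<open>By the Cameron--Martin formula with \<open>u = w / s\<close>, the dependence on
  \<open>w\<close> sits in an exponential weight alone. The coefficients are integrals of
  \<open>f\<close> against Hermite polynomials, and \<open>C\<close> depends only on the dimension,
  so the expansion serves indicators of arbitrary Borel sets at every smoothing scale.\<close>

lemma gauss_smooth_expansion:
  "\<exists>C\<ge>0. \<forall>s>0. \<forall>f x. f \<in> borel_measurable borel \<longrightarrow> (\<forall>y. \<bar>f y\<bar> \<le> 1) \<longrightarrow>
     quadratic_approx (\<lambda>w::'a::euclidean_space. avg_op std_gauss s f (x + w)) C s"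
proof -
  obtain C0 where C0: "C0 \<ge> 0" "\<And>u::'a. (\<integral>z. \<bar>gauss_remainder u z\<bar> \<partial>std_gauss) \<le> C0 * norm u ^ 3"
    using gauss_remainder_bound by blast
  define n1 n2 where "n1 = (\<integral>z. norm (z::'a) ^ 1 \<partial>std_gauss)" and "n2 = (\<integral>z. norm (z::'a) ^ 2 + 1 \<partial>std_gauss)"
  have nn: "0 \<le> n1" "0 \<le> n2" unfolding n1_def n2_def by (auto intro!: integral_nonneg_AE)
  define C where "C = C0 + n1 + n2"
  have "quadratic_approx (\<lambda>w::'a. avg_op std_gauss s f (x + w)) C s"
    if s: "0 < s" and f[measurable]: "f \<in> borel_measurable borel" and f1: "\<And>y. \<bar>f y\<bar> \<le> 1" for s x and f :: "'a \<Rightarrow> real"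
  proof -
    define h where "h z = f (x + s *\<^sub>R z)" for z
    have [measurable]: "h \<in> borel_measurable borel" unfolding h_def by measurable
    have h1: "\<bar>h z\<bar> \<le> 1" for z unfolding h_def by (rule f1)
    define e1 where "e1 i z = h z * (z \<bullet> i)" for i z
    define \<delta> where "\<delta> i j = (if i = j then 1 else 0 :: real)" for i j :: 'a
    define e2 where "e2 i j z = h z * ((z \<bullet> i) * (z \<bullet> j) - \<delta> i j)" for i j z
    have [measurable]: "e1 i \<in> borel_measurable borel" "e2 i j \<in> borel_measurable borel" for i j
      unfolding e1_def e2_def by measurable
    have p1: "\<bar>e1 i z\<bar> \<le> norm z ^ 1" if "i \<in> Basis" for i z
      using mult_mono[OF h1[of z] Basis_le_norm[OF that, of z]] by (simp add: e1_def abs_mult)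
    have p2: "\<bar>e2 i j z\<bar> \<le> norm z ^ 2 + 1" if "i \<in> Basis" "j \<in> Basis" for i j z
    proof -
      have "\<bar>(z \<bullet> i) * (z \<bullet> j)\<bar> \<le> norm z * norm z"
        unfolding abs_mult using that by (intro mult_mono Basis_le_norm) auto
      moreover have "\<bar>\<delta> i j\<bar> \<le> 1" unfolding \<delta>_def by auto
      ultimately have "\<bar>(z \<bullet> i) * (z \<bullet> j) - \<delta> i j\<bar> \<le> norm z ^ 2 + 1"
        using abs_triangle_ineq4[of "(z \<bullet> i) * (z \<bullet> j)" "\<delta> i j"] unfolding power2_eq_square by linarith
      from mult_mono[OF h1[of z] this] show ?thesis by (simp add: e2_def abs_mult)
    qed
    have in1: "integrable std_gauss (\<lambda>z::'a. norm z ^ 1)" and in2: "integrable std_gauss (\<lambda>z::'a. norm z ^ 2 + 1)"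
      by (intro integrable_norm_power_std_gauss Bochner_Integration.integrable_add std_gauss.integrable_const)+
    have i0: "integrable std_gauss h"
      using h1 by (intro std_gauss.integrable_const_bound[where B=1]) auto
    have i1: "integrable std_gauss (e1 i)" if "i \<in> Basis" for i
      using p1[OF that] by (intro integrable_real_bound[OF in1]) auto
    have i2: "integrable std_gauss (e2 i j)" if "i \<in> Basis" "j \<in> Basis" for i j
      using p2[OF that] by (intro integrable_real_bound[OF in2]) auto
    define A where "A i = (\<integral>z. e1 i z \<partial>std_gauss) / s" for i
    define q where "q i j = (\<integral>z. e2 i j z \<partial>std_gauss) / (2 * s\<^sup>2)" for i j
    have A: "\<bar>A i\<bar> \<le> C / s" if "i \<in> Basis" for i
    proof -
      have "\<bar>\<integral>z. e1 i z \<partial>std_gauss\<bar> \<le> (\<integral>z. \<bar>e1 i z\<bar> \<partial>std_gauss)" by (rule integral_abs_bound)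
      also have "\<dots> \<le> n1" unfolding n1_def
        by (rule integral_mono[OF integrable_abs[OF i1[OF that]] in1 p1[OF that]])
      also have "\<dots> \<le> C" unfolding C_def using nn C0 by simp
      finally show ?thesis unfolding A_def using s by (simp add: abs_divide divide_right_mono)
    qed
    have q: "\<bar>q i j\<bar> \<le> C / s\<^sup>2" if "i \<in> Basis" "j \<in> Basis" for i j
    proof -
      have "\<bar>\<integral>z. e2 i j z \<partial>std_gauss\<bar> \<le> (\<integral>z. \<bar>e2 i j z\<bar> \<partial>std_gauss)"
        by (rule integral_abs_bound)
      also have "\<dots> \<le> n2" unfolding n2_def
        by (rule integral_mono[OF integrable_abs[OF i2[OF that]] in2 p2[OF that]])
      finally have "\<bar>q i j\<bar> \<le> n2 / (2 * s\<^sup>2)" unfolding q_def using s by (simp add: abs_divide divide_right_mono)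
      also have "\<dots> \<le> C / s\<^sup>2" unfolding C_def using nn C0 s by (intro frac_le) auto
      finally show ?thesis .
    qed
    define c where "c = (\<integral>z. h z \<partial>std_gauss)"
    have main: "\<bar>avg_op std_gauss s f (x + w) -
          (c + (\<Sum>i\<in>Basis. A i * (w \<bullet> i)) + (\<Sum>i\<in>Basis. \<Sum>j\<in>Basis. q i j * ((w \<bullet> i) * (w \<bullet> j))))\<bar>
          \<le> C * (norm w / s) ^ 3" for w
    proof -
      define u where "u = (1 / s) *\<^sub>R w"
      define P where "P z = 1 + u \<bullet> z + ((u \<bullet> z)\<^sup>2 - (norm u)\<^sup>2) / 2" for z
      have ui: "u \<bullet> i = (w \<bullet> i) / s" for i unfolding u_def by simp
      have "avg_op std_gauss s f (x + w) = (\<integral>z. h (z + u) \<partial>std_gauss)"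
        unfolding avg_op_def h_def u_def using s by (simp add: algebra_simps)
      also have "\<dots> = (\<integral>z. exp (u \<bullet> z - (norm u)\<^sup>2 / 2) * h z \<partial>std_gauss)"
        by (subst std_gauss_shift_integral) auto
      finally have avg: "avg_op std_gauss s f (x + w) = (\<integral>z. exp (u \<bullet> z - (norm u)\<^sup>2 / 2) * h z \<partial>std_gauss)" .
      have Peq: "h z * P z = h z + (\<Sum>i\<in>Basis. (w \<bullet> i) / s * e1 i z)
          + (\<Sum>i\<in>Basis. \<Sum>j\<in>Basis. (w \<bullet> i) * (w \<bullet> j) / (2 * s\<^sup>2) * e2 i j z)" for z
      proof -
        have uz: "u \<bullet> z = (\<Sum>i\<in>Basis. (w \<bullet> i) / s * (z \<bullet> i))"
          by (subst euclidean_inner) (simp add: ui)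
        have "(norm u)\<^sup>2 = (\<Sum>i\<in>Basis. (u \<bullet> i) * (u \<bullet> i))"
          unfolding power2_norm_eq_inner by (rule euclidean_inner)
        also have "\<dots> = (\<Sum>i\<in>Basis. \<Sum>j\<in>Basis. (u \<bullet> i) * (u \<bullet> j) * \<delta> i j)"
          unfolding \<delta>_def by (intro sum.cong refl) (simp add: if_distrib cong: if_cong)
        finally have nu: "(norm u)\<^sup>2 = (\<Sum>i\<in>Basis. \<Sum>j\<in>Basis. (u \<bullet> i) * (u \<bullet> j) * \<delta> i j)" .
        have "(u \<bullet> z)\<^sup>2 = (\<Sum>i\<in>Basis. (u \<bullet> i) * (z \<bullet> i)) * (\<Sum>j\<in>Basis. (u \<bullet> j) * (z \<bullet> j))"
          unfolding power2_eq_square by (subst (1 2) euclidean_inner) simp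
        also have "\<dots> = (\<Sum>i\<in>Basis. \<Sum>j\<in>Basis. (u \<bullet> i) * (u \<bullet> j) * ((z \<bullet> i) * (z \<bullet> j)))"
          unfolding sum_product by (simp add: mult_ac)
        finally have "(u \<bullet> z)\<^sup>2 - (norm u)\<^sup>2 = (\<Sum>i\<in>Basis. \<Sum>j\<in>Basis. (u \<bullet> i) * (u \<bullet> j) * ((z \<bullet> i) * (z \<bullet> j) - \<delta> i j))"
          unfolding nu by (simp only: sum_subtractf right_diff_distrib)
        then have sq: "((u \<bullet> z)\<^sup>2 - (norm u)\<^sup>2) / 2 = (\<Sum>i\<in>Basis. \<Sum>j\<in>Basis. (w \<bullet> i) * (w \<bullet> j) / (2 * s\<^sup>2) * ((z \<bullet> i) * (z \<bullet> j) - \<delta> i j))"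
          using s by (simp add: ui sum_divide_distrib power2_eq_square mult_ac)
        show ?thesis
          unfolding P_def sq unfolding uz e1_def e2_def by (simp add: distrib_left sum_distrib_left mult_ac)
      qed
      have "(\<integral>z. h z * P z \<partial>std_gauss) = c + (\<Sum>i\<in>Basis. (w \<bullet> i) / s * (\<integral>z. e1 i z \<partial>std_gauss))
          + (\<Sum>i\<in>Basis. \<Sum>j\<in>Basis. (w \<bullet> i) * (w \<bullet> j) / (2 * s\<^sup>2) * (\<integral>z. e2 i j z \<partial>std_gauss))"
        unfolding Peq c_def by (simp add: i0 i1 i2 cong: sum.cong)
      also have "\<dots> = c + (\<Sum>i\<in>Basis. A i * (w \<bullet> i)) + (\<Sum>i\<in>Basis. \<Sum>j\<in>Basis. q i j * ((w \<bullet> i) * (w \<bullet> j)))"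
        unfolding A_def q_def by (simp add: mult_ac)
      finally have hP: "(\<integral>z. h z * P z \<partial>std_gauss) = \<dots>" .
      have ihP: "integrable std_gauss (\<lambda>z. h z * P z)"
        unfolding Peq by (intro i0 i1 i2 Bochner_Integration.integrable_add Bochner_Integration.integrable_sum integrable_mult_right)
      have ie: "integrable std_gauss (\<lambda>z. exp (u \<bullet> z - (norm u)\<^sup>2 / 2) * h z)"
        by (rule Bochner_Integration.integrable_bound[OF exp_tilt_integrable[of u]])
           (auto simp: abs_mult mult_le_cancel_left1 h1)
      have "avg_op std_gauss s f (x + w) - (\<integral>z. h z * P z \<partial>std_gauss) = (\<integral>z. h z * gauss_remainder u z \<partial>std_gauss)"
        unfolding avg Bochner_Integration.integral_diff[OF ie ihP, symmetric]
        by (intro Bochner_Integration.integral_cong) (auto simp: gauss_remainder_def P_def algebra_simps)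
      also have "\<bar>\<dots>\<bar> \<le> (\<integral>z. \<bar>h z * gauss_remainder u z\<bar> \<partial>std_gauss)" by (rule integral_abs_bound)
      also have "\<dots> \<le> (\<integral>z. \<bar>gauss_remainder u z\<bar> \<partial>std_gauss)"
      proof (rule integral_mono)
        show le: "\<bar>h z * gauss_remainder u z\<bar> \<le> \<bar>gauss_remainder u z\<bar>" for z
          using h1[of z] by (simp add: abs_mult mult_left_le_one_le)
        show "integrable std_gauss (\<lambda>z. \<bar>gauss_remainder u z\<bar>)" by (rule integrable_abs[OF integrable_gauss_remainder])
        show "integrable std_gauss (\<lambda>z. \<bar>h z * gauss_remainder u z\<bar>)"
          by (intro integrable_abs Bochner_Integration.integrable_bound[OF integrable_gauss_remainder[of u]]) (auto intro: le)
      qed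
      also have "\<dots> \<le> C0 * norm u ^ 3" by (rule C0)
      also have "\<dots> \<le> C * (norm w / s) ^ 3"
        unfolding C_def u_def using s nn C0(1) by (intro mult_mono) auto
      finally show ?thesis unfolding hP .
    qed
    show ?thesis unfolding quadratic_approx_def using A q main by blast
  qed
  then show ?thesis using C0(1) nn unfolding C_def by (intro exI[of _ C]) (auto simp: C_def)
qed

text \<open>The defects of mean and covariance and the third moment are kept apart: they enter the
  error with different powers of the ratio of step to smoothing scale, and tilting perturbs mean and
  covariance at different orders.\<close>

definition approx_isotropic :: "'a::euclidean_space measure \<Rightarrow> real \<Rightarrow> real \<Rightarrow> real \<Rightarrow> bool" where
  "approx_isotropic \<nu> m1 m2 m3 \<longleftrightarrow> borel_prob \<nu> \<and> integrable \<nu> (\<lambda>w. norm w ^ 3) \<and>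
     (\<forall>i\<in>Basis. \<bar>\<integral>w. w \<bullet> i \<partial>\<nu>\<bar> \<le> m1) \<and>
     (\<forall>i\<in>Basis. \<forall>j\<in>Basis. \<bar>(\<integral>w. (w \<bullet> i) * (w \<bullet> j) \<partial>\<nu>) - (if i = j then 1 else 0)\<bar> \<le> m2) \<and>
     (\<integral>w. norm w ^ 3 \<partial>\<nu>) \<le> m3"

lemma approx_isotropic_nonneg:
  assumes "approx_isotropic (\<nu> :: 'a::euclidean_space measure) m1 m2 m3"
  shows "0 \<le> m1" "0 \<le> m2" "0 \<le> m3"
proof -
  obtain b :: 'a where b: "b \<in> Basis" using nonempty_Basis by blast
  have "\<bar>\<integral>w. w \<bullet> b \<partial>\<nu>\<bar> \<le> m1"
    using assms b unfolding approx_isotropic_def by blast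
  then show "0 \<le> m1" by linarith
  have "\<bar>(\<integral>w. (w \<bullet> b) * (w \<bullet> b) \<partial>\<nu>) - (if b = b then 1 else 0)\<bar> \<le> m2"
    using assms b unfolding approx_isotropic_def by blast
  then show "0 \<le> m2" by linarith
  have "0 \<le> (\<integral>w. norm w ^ 3 \<partial>\<nu>)" by (intro integral_nonneg_AE) auto
  then show "0 \<le> m3" using assms unfolding approx_isotropic_def by linarith
qed

lemma (in borel_prob) integrable_coords:
  assumes int: "integrable \<rho> (\<lambda>w. norm w ^ 3)" and i: "i \<in> Basis" and j: "j \<in> Basis"
  shows "integrable \<rho> (\<lambda>w. w \<bullet> i)" "integrable \<rho> (\<lambda>w. (w \<bullet> i) * (w \<bullet> j))"
proof -
  have b: "integrable \<rho> (\<lambda>w. 1 + norm w ^ 3)" using int by auto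
  have pw: "norm w \<le> 1 + norm w ^ 3 \<and> norm w ^ 2 \<le> 1 + norm w ^ 3" for w :: 'a
  proof (cases "norm w \<le> 1")
    case True
    then have "norm w ^ 2 \<le> 1" by (simp add: power_le_one)
    moreover have "0 \<le> norm w ^ 3" by simp
    ultimately show ?thesis using True by linarith
  next
    case False
    then have "norm w ^ 1 \<le> norm w ^ 3" "norm w ^ 2 \<le> norm w ^ 3" by (intro power_increasing; simp)+
    then show ?thesis by simp
  qed
  have ij: "\<bar>w \<bullet> i\<bar> \<le> norm w" "\<bar>w \<bullet> j\<bar> \<le> norm w" for w using i j by (auto intro: Basis_le_norm)
  show "integrable \<rho> (\<lambda>w. w \<bullet> i)"
    using order_trans[OF ij(1) conjunct1[OF pw]] by (intro integrable_real_bound[OF b]) auto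
  have "\<bar>(w \<bullet> i) * (w \<bullet> j)\<bar> \<le> norm w ^ 2" for w
    unfolding abs_mult power2_eq_square using ij by (intro mult_mono) auto
  from order_trans[OF this conjunct2[OF pw]]
  show "integrable \<rho> (\<lambda>w. (w \<bullet> i) * (w \<bullet> j))"
    by (intro integrable_real_bound[OF b]) auto
qed

text \<open>Both averages are replaced by integrals of one quadratic polynomial, with a cubic error.
  The moment defects are charged to its coefficients; the 1 added to \<open>m3\<close> pays for the
  third moment of the Gaussian step.\<close>

lemma lindeberg_step:
  "\<exists>C\<ge>0. \<forall>\<nu> m1 m2 m3 a s f x. approx_isotropic (\<nu> :: 'a::euclidean_space measure) m1 m2 m3 \<longrightarrow> 0 < s \<longrightarrow> 0 \<le> a \<longrightarrow>
     f \<in> borel_measurable borel \<longrightarrow> (\<forall>y. \<bar>f y\<bar> \<le> 1) \<longrightarrow>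
     \<bar>avg_op \<nu> a (avg_op std_gauss s f) x - avg_op std_gauss a (avg_op std_gauss s f) x\<bar>
       \<le> C * (m1 * (a / s) + m2 * (a / s)\<^sup>2 + (m3 + 1) * (a / s) ^ 3)"
proof -
  obtain C where C: "C \<ge> 0" and exp: "\<And>s f x. 0 < s \<Longrightarrow> f \<in> borel_measurable borel \<Longrightarrow> (\<forall>y. \<bar>f y\<bar> \<le> 1) \<Longrightarrow>
      quadratic_approx (\<lambda>w::'a. avg_op std_gauss s f (x + w)) C s"
    using gauss_smooth_expansion by blast
  define d g3 where "d = real DIM('a)" and "g3 = (\<integral>w. norm (w::'a) ^ 3 \<partial>std_gauss)"
  have g3: "0 \<le> g3" unfolding g3_def by (auto intro!: integral_nonneg_AE)
  define C' where "C' = C * (d + d\<^sup>2 + 1 + g3)"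
  have "\<bar>avg_op \<nu> a (avg_op std_gauss s f) x - avg_op std_gauss a (avg_op std_gauss s f) x\<bar>
       \<le> C' * (m1 * (a / s) + m2 * (a / s)\<^sup>2 + (m3 + 1) * (a / s) ^ 3)"
    if iso: "approx_isotropic \<nu> m1 m2 m3" and s: "0 < s" and a: "0 \<le> a"
      and f[measurable]: "f \<in> borel_measurable borel" and f1: "\<forall>y. \<bar>f y\<bar> \<le> 1"
    for \<nu> :: "'a measure" and m1 m2 m3 a s f x
  proof -
    obtain c A q where A: "\<And>i. i \<in> Basis \<Longrightarrow> \<bar>A i\<bar> \<le> C / s" and q: "\<And>i j. i \<in> Basis \<Longrightarrow> j \<in> Basis \<Longrightarrow> \<bar>q i j\<bar> \<le> C / s\<^sup>2"
      and main: "\<And>w::'a. \<bar>avg_op std_gauss s f (x + w) -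
          (c + (\<Sum>i\<in>Basis. A i * (w \<bullet> i)) + (\<Sum>i\<in>Basis. \<Sum>j\<in>Basis. q i j * ((w \<bullet> i) * (w \<bullet> j))))\<bar>
          \<le> C * (norm w / s) ^ 3"
      using exp[OF s f f1, of x] unfolding quadratic_approx_def by blast
    define L where "L \<rho> = c + (\<Sum>i\<in>Basis. A i * a * (\<integral>w. w \<bullet> i \<partial>\<rho>))
        + (\<Sum>i\<in>Basis. \<Sum>j\<in>Basis. q i j * a\<^sup>2 * (\<integral>w. (w \<bullet> i) * (w \<bullet> j) \<partial>\<rho>))" for \<rho> :: "'a measure"
    have approx: "\<bar>avg_op \<rho> a (avg_op std_gauss s f) x - L \<rho>\<bar> \<le> C * (a / s) ^ 3 * (\<integral>w. norm w ^ 3 \<partial>\<rho>)"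
      if "borel_prob \<rho>" and int: "integrable \<rho> (\<lambda>w. norm w ^ 3)" for \<rho>
    proof -
      interpret borel_prob \<rho> by fact
      define p where "p w = c + (\<Sum>i\<in>Basis. A i * a * (w \<bullet> i)) + (\<Sum>i\<in>Basis. \<Sum>j\<in>Basis. q i j * a\<^sup>2 * ((w \<bullet> i) * (w \<bullet> j)))" for w
      have ip: "integrable \<rho> p" unfolding p_def
        by (intro Bochner_Integration.integrable_add Bochner_Integration.integrable_sum integrable_mult_right integrable_coords[OF int] integrable_const)
      have Lp: "L \<rho> = (\<integral>w. p w \<partial>\<rho>)"
        unfolding p_def L_def
        by (simp add: integrable_coords[OF int] prob_space[simplified] cong: sum.cong)
      have bb: "bdd_borel f" using f f1 by (auto simp: bdd_borel_def)
      have ia: "integrable \<rho> (\<lambda>w. avg_op std_gauss s f (x + a *\<^sub>R w))"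
        by (intro integrable_bdd_borel bdd_borel_affine std_gauss.bdd_borel_avg_op bb)
      have pt: "\<bar>avg_op std_gauss s f (x + a *\<^sub>R w) - p w\<bar> \<le> C * (a / s) ^ 3 * norm w ^ 3" for w
        using main[of "a *\<^sub>R w"] a unfolding p_def
        by (simp add: power_mult_distrib power_divide power2_eq_square mult_ac)
      have "avg_op \<rho> a (avg_op std_gauss s f) x - L \<rho> = (\<integral>w. avg_op std_gauss s f (x + a *\<^sub>R w) - p w \<partial>\<rho>)"
        unfolding Lp avg_op_def[of \<rho>] by (rule Bochner_Integration.integral_diff[OF ia ip, symmetric])
      also have "\<bar>\<dots>\<bar> \<le> (\<integral>w. \<bar>avg_op std_gauss s f (x + a *\<^sub>R w) - p w\<bar> \<partial>\<rho>)" by (rule integral_abs_bound)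
      also have "\<dots> \<le> (\<integral>w. C * (a / s) ^ 3 * norm w ^ 3 \<partial>\<rho>)"
        by (intro integral_mono integrable_abs Bochner_Integration.integrable_diff ia ip integrable_mult_right int pt)
      also have "\<dots> = C * (a / s) ^ 3 * (\<integral>w. norm w ^ 3 \<partial>\<rho>)" by simp
      finally show ?thesis .
    qed
    have \<nu>: "borel_prob \<nu>" "integrable \<nu> (\<lambda>w. norm w ^ 3)" "\<And>i. i \<in> Basis \<Longrightarrow> \<bar>\<integral>w. w \<bullet> i \<partial>\<nu>\<bar> \<le> m1"
      "\<And>i j. i \<in> Basis \<Longrightarrow> j \<in> Basis \<Longrightarrow> \<bar>(\<integral>w. (w \<bullet> i) * (w \<bullet> j) \<partial>\<nu>) - (if i = j then 1 else 0)\<bar> \<le> m2"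
      "(\<integral>w. norm w ^ 3 \<partial>\<nu>) \<le> m3"
      using iso unfolding approx_isotropic_def by auto
    note m12 = approx_isotropic_nonneg(1,2)[OF iso] and m3 = approx_isotropic_nonneg(3)[OF iso]
    define r where "r = a / s"
    have r: "0 \<le> r" using a s by (simp add: r_def)
    have t1: "\<bar>A i * a * (\<integral>w. w \<bullet> i \<partial>\<nu>) - A i * a * (\<integral>w. w \<bullet> i \<partial>std_gauss)\<bar> \<le> C * m1 * r" if "i \<in> Basis" for i
    proof -
      have "\<bar>A i\<bar> * a * \<bar>\<integral>w. w \<bullet> i \<partial>\<nu>\<bar> \<le> C / s * a * m1"
        using A[OF that] \<nu>(3)[OF that] a C s by (intro mult_mono) auto
      then show ?thesis using that a by (simp add: std_gauss_mean abs_mult r_def mult_ac)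
    qed
    have t2: "\<bar>q i j * a\<^sup>2 * (\<integral>w. (w \<bullet> i) * (w \<bullet> j) \<partial>\<nu>) - q i j * a\<^sup>2 * (\<integral>w. (w \<bullet> i) * (w \<bullet> j) \<partial>std_gauss)\<bar> \<le> C * m2 * r\<^sup>2"
      if "i \<in> Basis" "j \<in> Basis" for i j
    proof -
      have "\<bar>q i j\<bar> * a\<^sup>2 * \<bar>(\<integral>w. (w \<bullet> i) * (w \<bullet> j) \<partial>\<nu>) - (if i = j then 1 else 0)\<bar> \<le> C / s\<^sup>2 * a\<^sup>2 * m2"
        using q[OF that] \<nu>(4)[OF that] C s by (intro mult_mono) auto
      moreover have "\<bar>q i j * a\<^sup>2 * (\<integral>w. (w \<bullet> i) * (w \<bullet> j) \<partial>\<nu>) - q i j * a\<^sup>2 * (\<integral>w. (w \<bullet> i) * (w \<bullet> j) \<partial>std_gauss)\<bar>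
          = \<bar>q i j\<bar> * a\<^sup>2 * \<bar>(\<integral>w. (w \<bullet> i) * (w \<bullet> j) \<partial>\<nu>) - (if i = j then 1 else 0)\<bar>"
        unfolding std_gauss_cov[OF that] right_diff_distrib[symmetric] abs_mult by simp
      ultimately show ?thesis by (simp add: r_def power_divide mult_ac)
    qed
    have "\<bar>L \<nu> - L std_gauss\<bar> \<le> \<bar>\<Sum>i\<in>Basis. A i * a * (\<integral>w. w \<bullet> i \<partial>\<nu>) - A i * a * (\<integral>w. w \<bullet> i \<partial>std_gauss)\<bar>
        + \<bar>\<Sum>i\<in>Basis. \<Sum>j\<in>Basis. q i j * a\<^sup>2 * (\<integral>w. (w \<bullet> i) * (w \<bullet> j) \<partial>\<nu>) - q i j * a\<^sup>2 * (\<integral>w. (w \<bullet> i) * (w \<bullet> j) \<partial>std_gauss)\<bar>"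
      unfolding L_def sum_subtractf by linarith
    also have "\<dots> \<le> (\<Sum>i\<in>(Basis::'a set). C * m1 * r) + (\<Sum>i\<in>(Basis::'a set). \<Sum>j\<in>(Basis::'a set). C * m2 * r\<^sup>2)"
      by (intro add_mono order_trans[OF sum_abs] sum_mono t1 t2)
    also have "\<dots> = C * (d * (m1 * r) + d\<^sup>2 * (m2 * r\<^sup>2))" by (simp add: d_def power2_eq_square algebra_simps)
    finally have L: "\<bar>L \<nu> - L std_gauss\<bar> \<le> C * (d * (m1 * r) + d\<^sup>2 * (m2 * r\<^sup>2))" .
    have "\<bar>avg_op \<nu> a (avg_op std_gauss s f) x - L \<nu>\<bar> \<le> C * r ^ 3 * m3"
      using approx[OF \<nu>(1,2)] mult_left_mono[OF \<nu>(5), of "C * r ^ 3"] C r unfolding r_def by simp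
    moreover have "\<bar>avg_op std_gauss a (avg_op std_gauss s f) x - L std_gauss\<bar> \<le> C * r ^ 3 * g3"
      using approx[OF std_gauss.borel_prob_axioms integrable_norm_power_std_gauss] unfolding r_def g3_def .
    ultimately have "\<bar>avg_op \<nu> a (avg_op std_gauss s f) x - avg_op std_gauss a (avg_op std_gauss s f) x\<bar>
        \<le> C * r ^ 3 * m3 + C * r ^ 3 * g3 + C * (d * (m1 * r) + d\<^sup>2 * (m2 * r\<^sup>2))"
      using L by linarith
    also have "\<dots> = C * (d * (m1 * r) + d\<^sup>2 * (m2 * r\<^sup>2) + (m3 + g3) * r ^ 3)" by (simp add: algebra_simps)
    also have "\<dots> \<le> C * ((d + d\<^sup>2 + 1 + g3) * (m1 * r) + (d + d\<^sup>2 + 1 + g3) * (m2 * r\<^sup>2) + ((d + d\<^sup>2 + 1 + g3) * (m3 + 1)) * r ^ 3)"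
    proof (intro mult_left_mono add_mono mult_right_mono)
      have "0 \<le> d" "0 \<le> d\<^sup>2" by (auto simp: d_def)
      then show "m3 + g3 \<le> (d + d\<^sup>2 + 1 + g3) * (m3 + 1)"
        using g3 m3 mult_nonneg_nonneg[of d m3] mult_nonneg_nonneg[of "d\<^sup>2" m3] mult_nonneg_nonneg[of g3 m3]
        by (simp add: distrib_right distrib_left)
    qed (use C r m12 g3 in \<open>auto simp: d_def\<close>)
    also have "\<dots> = C' * (m1 * r + m2 * r\<^sup>2 + (m3 + 1) * r ^ 3)"
    proof -
      have "C * (K * e + K * g + (K * h) * k) = C * K * (e + g + h * k)" for K e g h k
        by (simp add: algebra_simps)
      then show ?thesis unfolding C'_def by blast
    qed
    finally show ?thesis unfolding r_def .
  qed
  moreover have "C' \<ge> 0" using C g3 by (auto simp: C'_def d_def)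
  ultimately show ?thesis by blast
qed

lemma sum_inverse_sqrt_le: "(\<Sum>k<n. 1 / sqrt (real (k + 1))) \<le> 2 * sqrt (real n)"
proof (induction n)
  case (Suc n)
  define s t where "s = sqrt (real n)" and "t = sqrt (real (n + 1))"
  have st: "0 \<le> s" "0 < t" "t\<^sup>2 = s\<^sup>2 + 1" by (auto simp: s_def t_def)
  have "2 * s * t \<le> s\<^sup>2 + t\<^sup>2" by (rule sum_squares_bound)
  then have "1 / t \<le> 2 * t - 2 * s" using st by (simp add: field_simps power2_eq_square)
  then show ?case using Suc unfolding s_def t_def by (simp add: add.commute)
qed simp

lemma sum_inverse_le_ln: "0 < n \<Longrightarrow> (\<Sum>k<n. 1 / real (k + 1)) \<le> 1 + ln (real n)"
proof (induction n)
  case (Suc n)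
  show ?case
  proof (cases "n = 0")
    case False
    have "ln (real n / real (n + 1)) \<le> real n / real (n + 1) - 1" using False by (intro ln_le_minus_one) auto
    then have "1 / real (n + 1) \<le> ln (real (n + 1)) - ln (real n)" using False by (simp add: ln_div field_simps)
    then show ?thesis using Suc False by (simp add: add.commute)
  qed simp
qed simp

text \<open>Telescoping against \<open>4 / sqrt j\<close>. The decay in \<open>q\<close> is the gain
  from smoothing before the first replacement.\<close>

lemma sum_inverse_three_halves_le:
  assumes "0 < q"
  shows "(\<Sum>k<n. 1 / sqrt (real (k + q)) ^ 3) \<le> 4 / sqrt (real q)"
proof -
  have step: "1 / sqrt (real j) ^ 3 \<le> 4 / sqrt (real j) - 4 / sqrt (real (j + 1))" if "0 < j" for j
  proof -
    define s t where "s = sqrt (real j)" and "t = sqrt (real (j + 1))"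
    have st: "1 \<le> s" "0 < t" "t\<^sup>2 = s\<^sup>2 + 1" using that by (auto simp: s_def t_def)
    have s1: "1 \<le> s\<^sup>2" using st(1) by simp
    have "2 * s * t \<le> s\<^sup>2 + t\<^sup>2" by (rule sum_squares_bound)
    then have "t * (t + s) \<le> 4 * s\<^sup>2" using st(3) s1 by (simp add: power2_eq_square algebra_simps)
    then have "1 / s ^ 3 \<le> 4 / (s * (t * (t + s)))"
      using st by (simp add: divide_simps power3_eq_cube power2_eq_square mult_ac)
    also have "\<dots> = 4 * (t - s) * (t + s) / (s * (t * (t + s)))"
      using st(3) by (simp add: power2_eq_square algebra_simps)
    also have "\<dots> = 4 / s - 4 / t" using st by (simp add: divide_simps)
    finally show ?thesis unfolding s_def t_def .
  qed
  have "(\<Sum>k<n. 1 / sqrt (real (k + q)) ^ 3) \<le> 4 / sqrt (real q) - 4 / sqrt (real (n + q))"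
  proof (induction n)
    case (Suc n)
    then show ?case using step[of "n + q"] assms by simp
  qed simp
  moreover have "0 \<le> 4 / sqrt (real (n + q))" by simp
  ultimately show ?thesis by linarith
qed

text \<open>Smoothing at scale \<open>sqrt (q / n)\<close> amounts to \<open>q\<close> further
  Gaussian steps. With \<open>k\<close> Gaussian steps in place the ratio of step to smoothing scale
  is thus \<open>1 / sqrt (k + q)\<close>, and summing its first, second and third powers over
  \<open>k\<close> yields the factors \<open>sqrt n\<close>, \<open>1 + ln n\<close> and
  \<open>1 / sqrt q\<close>.\<close>

lemma lindeberg:
  "\<exists>C\<ge>0. \<forall>\<nu> m1 m2 m3 n q f x. approx_isotropic (\<nu> :: 'a::euclidean_space measure) m1 m2 m3 \<longrightarrow> 0 < n \<longrightarrow> 0 < q \<longrightarrow>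
     f \<in> borel_measurable borel \<longrightarrow> (\<forall>y. \<bar>f y\<bar> \<le> 1) \<longrightarrow>
     \<bar>(avg_op \<nu> (1 / sqrt (real n)) ^^ n) (avg_op std_gauss (sqrt (real q / real n)) f) x
        - avg_op std_gauss 1 (avg_op std_gauss (sqrt (real q / real n)) f) x\<bar>
       \<le> C * (m1 * sqrt (real n) + m2 * (1 + ln (real n)) + (m3 + 1) / sqrt (real q))"
proof -
  obtain C where C: "C \<ge> 0" and step: "\<And>\<nu> m1 m2 m3 a s f x. approx_isotropic (\<nu> :: 'a measure) m1 m2 m3 \<Longrightarrow> 0 < s \<Longrightarrow> 0 \<le> a \<Longrightarrow>
     f \<in> borel_measurable borel \<Longrightarrow> (\<forall>y. \<bar>f y\<bar> \<le> 1) \<Longrightarrow>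
     \<bar>avg_op \<nu> a (avg_op std_gauss s f) x - avg_op std_gauss a (avg_op std_gauss s f) x\<bar>
       \<le> C * (m1 * (a / s) + m2 * (a / s)\<^sup>2 + (m3 + 1) * (a / s) ^ 3)"
    using lindeberg_step by meson
  have "\<bar>(avg_op \<nu> (1 / sqrt (real n)) ^^ n) (avg_op std_gauss (sqrt (real q / real n)) f) x
        - avg_op std_gauss 1 (avg_op std_gauss (sqrt (real q / real n)) f) x\<bar>
       \<le> (4 * C) * (m1 * sqrt (real n) + m2 * (1 + ln (real n)) + (m3 + 1) / sqrt (real q))"
    if iso: "approx_isotropic \<nu> m1 m2 m3" and n: "0 < n" and q: "0 < q"
      and f[measurable]: "f \<in> borel_measurable borel" and f1: "\<forall>y. \<bar>f y\<bar> \<le> 1"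
    for \<nu> :: "'a measure" and m1 m2 m3 n q f x
  proof -
    have bp: "borel_prob \<nu>" using iso by (simp add: approx_isotropic_def)
    have bf: "bdd_borel f" using f f1 by (auto simp: bdd_borel_def)
    note m12 = approx_isotropic_nonneg(1,2)[OF iso] and m3 = approx_isotropic_nonneg(3)[OF iso]
    define r where "r = 1 / sqrt (real n)"
    define g where "g = avg_op std_gauss (sqrt (real q / real n)) f"
    have g: "g = (avg_op std_gauss r ^^ q) f" unfolding g_def r_def by (rule avg_op_std_gauss_pow[OF bf n, symmetric])
    have bg: "bdd_borel g" unfolding g_def by (rule std_gauss.bdd_borel_avg_op[OF bf])
    have gk: "(avg_op std_gauss r ^^ k) g = avg_op std_gauss (sqrt (real (k + q) / real n)) f" for k
      unfolding g r_def avg_op_std_gauss_pow[OF bf n, symmetric] by (simp add: funpow_add)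
    let ?e = "\<lambda>k. C * (m1 * (1 / sqrt (real (k + q))) + m2 * (1 / sqrt (real (k + q)))\<^sup>2 + (m3 + 1) * (1 / sqrt (real (k + q))) ^ 3)"
    have "\<bar>(avg_op \<nu> r ^^ n) g x - (avg_op std_gauss r ^^ n) g x\<bar> \<le> (\<Sum>k<n. ?e k)"
    proof (rule avg_op_telescope[OF bp std_gauss.borel_prob_axioms bg])
      fix k x assume "k < n"
      have rs: "r / sqrt (real (k + q) / real n) = 1 / sqrt (real (k + q))"
        using n q by (simp add: r_def real_sqrt_divide)
      have pos: "0 < sqrt (real (k + q) / real n)" using n q by simp
      have "0 \<le> r" by (simp add: r_def)
      from step[OF iso pos this f f1, of x]
      show "\<bar>avg_op \<nu> r ((avg_op std_gauss r ^^ k) g) x - avg_op std_gauss r ((avg_op std_gauss r ^^ k) g) x\<bar> \<le> ?e k"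
        unfolding rs gk .
    qed
    \<comment> \<open>The first two sums are estimated with \<open>k + 1\<close> in place of
      \<open>k + q\<close>; only the third has to profit from a large \<open>q\<close>.\<close>
    also have "\<dots> \<le> C * (\<Sum>k<n. m1 * (1 / sqrt (real (k + 1))) + m2 * (1 / real (k + 1)) + (m3 + 1) * (1 / sqrt (real (k + q)) ^ 3))"
      unfolding sum_distrib_left
    proof (intro sum_mono mult_left_mono add_mono)
      fix k assume "k \<in> {..<n}"
      show "1 / sqrt (real (k + q)) \<le> 1 / sqrt (real (k + 1))" using q by (intro divide_left_mono mult_pos_pos) auto
      have "(1 / sqrt (real (k + q)))\<^sup>2 = 1 / real (k + q)" by (simp add: power_divide)
      also have "\<dots> \<le> 1 / real (k + 1)" using q by (intro divide_left_mono) auto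
      finally show "(1 / sqrt (real (k + q)))\<^sup>2 \<le> 1 / real (k + 1)" .
      show "(1 / sqrt (real (k + q))) ^ 3 \<le> 1 / sqrt (real (k + q)) ^ 3" by (simp add: power_divide)
    qed (use m12 m3 C in auto)
    also have "\<dots> = C * (m1 * (\<Sum>k<n. 1 / sqrt (real (k + 1))) + m2 * (\<Sum>k<n. 1 / real (k + 1)) + (m3 + 1) * (\<Sum>k<n. 1 / sqrt (real (k + q)) ^ 3))"
      by (simp only: sum.distrib sum_distrib_left)
    also have "\<dots> \<le> C * (m1 * (4 * sqrt (real n)) + m2 * (4 * (1 + ln (real n))) + (m3 + 1) * (4 / sqrt (real q)))"
    proof (intro mult_left_mono add_mono)
      show "(\<Sum>k<n. 1 / sqrt (real (k + 1))) \<le> 4 * sqrt (real n)"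
        using sum_inverse_sqrt_le[of n] real_sqrt_ge_zero[of "real n"] by linarith
      have "0 \<le> ln (real n)" using n by simp
      then show "(\<Sum>k<n. 1 / real (k + 1)) \<le> 4 * (1 + ln (real n))" by (intro order_trans[OF sum_inverse_le_ln[OF n]]) simp
      show "(\<Sum>k<n. 1 / sqrt (real (k + q)) ^ 3) \<le> 4 / sqrt (real q)" by (rule sum_inverse_three_halves_le[OF q])
    qed (use m12 m3 C in auto)
    also have "\<dots> = (4 * C) * (m1 * sqrt (real n) + m2 * (1 + ln (real n)) + (m3 + 1) / sqrt (real q))"
      by (simp add: algebra_simps)
    finally have "\<bar>(avg_op \<nu> r ^^ n) g x - (avg_op std_gauss r ^^ n) g x\<bar>
        \<le> (4 * C) * (m1 * sqrt (real n) + m2 * (1 + ln (real n)) + (m3 + 1) / sqrt (real q))" .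
    moreover have "(avg_op std_gauss r ^^ n) g = avg_op std_gauss 1 g"
      unfolding r_def using avg_op_std_gauss_pow[OF bg n, of n] n by simp
    ultimately show ?thesis unfolding r_def g_def by simp
  qed
  then show ?thesis using C by (intro exI[of _ "4 * C"]) auto
qed

section \<open>Gaussian measure of shells of convex sets\<close>

lemma measure_std_gauss_shift:
  fixes A :: "'a::euclidean_space set"
  assumes [measurable]: "A \<in> sets borel"
  shows "measure std_gauss {z. z + w \<in> A} = (\<integral>z. exp (w \<bullet> z - (norm w)\<^sup>2 / 2) * indicator A z \<partial>std_gauss)"
proof -
  have "measure std_gauss {z. z + w \<in> A} = (\<integral>z. indicator {z. z + w \<in> A} z \<partial>std_gauss)" by simp
  also have "\<dots> = (\<integral>z. indicator A (z + w) \<partial>std_gauss)"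
    by (intro Bochner_Integration.integral_cong) (auto simp: indicator_def)
  also have "\<dots> = (\<integral>z. exp (w \<bullet> z - (norm w)\<^sup>2 / 2) * indicator A z \<partial>std_gauss)"
    by (subst std_gauss_shift_integral) auto
  finally show ?thesis .
qed

lemma integrable_exp_tilt_indicator:
  fixes A :: "'a::euclidean_space set"
  assumes "A \<in> sets borel"
  shows "integrable std_gauss (\<lambda>z. exp (w \<bullet> z - (norm w)\<^sup>2 / 2) * indicator A z)"
  using integrable_mult_indicator[OF _ exp_tilt_integrable[of w], of A] assms by (simp add: mult.commute)

text \<open>The translates of the exit set by multiples of \<open>h\<close> are disjoint, and opposite
  translates by a vector \<open>w\<close> of length at most 1 together have at least the measure of the set,
  up to a constant, since \<open>exp a + exp (- a) \<ge> 2\<close>.\<close>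

lemma measure_std_gauss_exit_le:
  fixes A :: "'a::euclidean_space set"
  assumes A: "convex A" and [measurable]: "A \<in> sets borel"
  shows "measure std_gauss {z \<in> A. z + h \<notin> A} \<le> 2 * norm h"
proof (cases "h = 0 \<or> 1 < norm h")
  case True
  then show ?thesis
  proof
    assume "1 < norm h"
    then show ?thesis using std_gauss.prob_le_1[of "{z \<in> A. z + h \<notin> A}"] by linarith
  qed auto
next
  case False
  then have h: "0 < norm h" "norm h \<le> 1" by auto
  define E0 where "E0 = {z \<in> A. z + h \<notin> A}"
  have E0[measurable]: "E0 \<in> sets borel" unfolding E0_def by measurable
  define E where "E k = {z. z + of_int k *\<^sub>R h \<in> E0}" for k :: int
  have E[measurable]: "E k \<in> sets borel" for k unfolding E_def by measurable
  \<comment> \<open>If \<open>z + k h\<close> is in \<open>A\<close> and exits with the next step,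
    no later \<open>z + l h\<close> is in \<open>A\<close>: by convexity the point
    \<open>z + (k + 1) h\<close> on the segment between them would be in \<open>A\<close> as
    well.\<close>
  have lt: False if "k < l" "z \<in> E k" "z \<in> E l" for k l z
  proof -
    define t where "t = 1 / real_of_int (l - k)"
    have t: "0 \<le> t" "t \<le> 1" "t * real_of_int (l - k) = 1" using that(1) by (auto simp: t_def)
    have "(1 - t) *\<^sub>R (z + of_int k *\<^sub>R h) + t *\<^sub>R (z + of_int l *\<^sub>R h) \<in> A"
      using that t A unfolding E_def E0_def by (intro convexD) auto
    also have "(1 - t) *\<^sub>R (z + of_int k *\<^sub>R h) + t *\<^sub>R (z + of_int l *\<^sub>R h) = z + of_int k *\<^sub>R h + (t * real_of_int (l - k)) *\<^sub>R h"
      by (simp add: algebra_simps)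
    finally show False using that(2) t(3) unfolding E_def E0_def by simp
  qed
  have disj: "E k \<inter> E l = {}" if "k \<noteq> l" for k l
    using lt[of k l] lt[of l k] that by (cases "k < l") auto
  \<comment> \<open>The largest number for which all translations \<open>k h\<close> have length at
    most 1. Because \<open>norm h \<le> 1\<close>, it is still at least half of
    \<open>1 / norm h\<close>.\<close>
  define m where "m = nat \<lfloor>1 / norm h\<rfloor>"
  have mh: "real m \<le> 1 / norm h" "1 / (2 * norm h) \<le> real m"
  proof -
    have 1: "1 \<le> 1 / norm h" using h by simp
    then show "real m \<le> 1 / norm h" unfolding m_def by (simp add: of_nat_nat)
    have "1 / norm h < real m + 1" using 1 unfolding m_def by linarith
    moreover have "1 \<le> \<lfloor>1 / norm h\<rfloor>" using 1 by (simp only: one_le_floor)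
    then have "1 \<le> real m" unfolding m_def by linarith
    ultimately have "1 / norm h \<le> 2 * real m" by linarith
    then show "1 / (2 * norm h) \<le> real m" by (simp add: field_simps)
  qed
  have two: "2 * exp (- 1 / 2) * measure std_gauss E0 \<le> measure std_gauss (E (int k) \<union> E (- int k))" if "k \<in> {1..m}" for k
  proof -
    define w where "w = real k *\<^sub>R h"
    have "norm w \<le> 1"
    proof -
      have "real k * norm h \<le> real m * norm h" using that by (intro mult_right_mono) auto
      also have "\<dots> \<le> 1" using mh(1) h by (simp add: field_simps)
      finally show ?thesis by (simp add: w_def)
    qed
    then have nw: "(norm w)\<^sup>2 \<le> 1" by (simp add: power_le_one)
    have "measure std_gauss (E (int k) \<union> E (- int k)) = measure std_gauss (E (int k)) + measure std_gauss (E (- int k))"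
      using that disj[of "int k" "- int k"] by (intro std_gauss.finite_measure_Union) auto
    also have "\<dots> = measure std_gauss {z. z + w \<in> E0} + measure std_gauss {z. z + (- w) \<in> E0}"
      unfolding E_def w_def by simp
    also have "\<dots>
        = (\<integral>z. exp (w \<bullet> z - (norm w)\<^sup>2 / 2) * indicator E0 z + exp ((- w) \<bullet> z - (norm (- w))\<^sup>2 / 2) * indicator E0 z \<partial>std_gauss)"
      unfolding measure_std_gauss_shift[OF E0]
      by (intro Bochner_Integration.integral_add[symmetric] integrable_exp_tilt_indicator E0)
    also have "\<dots> \<ge> (\<integral>z. 2 * exp (- 1 / 2) * indicator E0 z \<partial>std_gauss)"
    proof (intro integral_mono Bochner_Integration.integrable_add integrable_exp_tilt_indicator E0)
      fix z
      have "2 \<le> exp (w \<bullet> z) + exp (- (w \<bullet> z))"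
        using exp_ge_add_one_self[of "w \<bullet> z"] exp_ge_add_one_self[of "- (w \<bullet> z)"] by linarith
      then have "2 * exp (- 1 / 2) \<le> (exp (w \<bullet> z) + exp (- (w \<bullet> z))) * exp (- (norm w)\<^sup>2 / 2)"
        using nw by (intro mult_mono) auto
      then show "2 * exp (- 1 / 2) * indicator E0 z \<le> exp (w \<bullet> z - (norm w)\<^sup>2 / 2) * indicator E0 z + exp ((- w) \<bullet> z - (norm (- w))\<^sup>2 / 2) * indicator E0 z"
        by (auto simp: indicator_def distrib_right exp_add[symmetric])
      show "integrable std_gauss (\<lambda>z. 2 * exp (- 1 / 2) * indicator E0 z :: real)"
        by (intro integrable_mult_right integrable_real_indicator) (auto simp: less_top[symmetric])
    qed
    also have "(\<integral>z. 2 * exp (- 1 / 2) * indicator E0 z \<partial>std_gauss) = 2 * exp (- 1 / 2) * measure std_gauss E0" by simp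
    finally show ?thesis .
  qed
  have "real m * (2 * exp (- 1 / 2) * measure std_gauss E0) \<le> (\<Sum>k\<in>{1..m}. measure std_gauss (E (int k) \<union> E (- int k)))"
    using sum_mono[of "{1..m}" "\<lambda>_. 2 * exp (- 1 / 2) * measure std_gauss E0", OF two] by simp
  also have "\<dots> = measure std_gauss (\<Union>k\<in>{1..m}. E (int k) \<union> E (- int k))"
  proof (intro std_gauss.finite_measure_finite_Union[symmetric])
    show "disjoint_family_on (\<lambda>k. E (int k) \<union> E (- int k)) {1..m}"
      unfolding disjoint_family_on_def
    proof (intro ballI impI)
      fix k l assume "k \<in> {1..m}" "l \<in> {1..m}" "k \<noteq> l"
      then show "(E (int k) \<union> E (- int k)) \<inter> (E (int l) \<union> E (- int l)) = {}"
        using disj[of "int k" "int l"] disj[of "int k" "- int l"] disj[of "- int k" "int l"] disj[of "- int k" "- int l"] by auto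
    qed
  qed auto
  also have "\<dots> \<le> 1" by (rule std_gauss.prob_le_1)
  finally have "real m * (2 * exp (- 1 / 2) * measure std_gauss E0) \<le> 1" .
  moreover have "1 / (2 * norm h) * (2 * exp (- 1 / 2) * measure std_gauss E0) \<le> real m * (2 * exp (- 1 / 2) * measure std_gauss E0)"
    using mh(2) by (intro mult_right_mono) auto
  ultimately have "1 / (2 * norm h) * (2 * exp (- 1 / 2) * measure std_gauss E0) \<le> 1" by (rule order_trans[rotated])
  then have "exp (- 1 / 2) * measure std_gauss E0 \<le> norm h" using h by (simp add: field_simps)
  moreover have "1 / 2 \<le> exp (- 1 / 2 :: real)" using exp_ge_add_one_self[of "- 1 / 2 :: real"] by simp
  then have "1 / 2 * measure std_gauss E0 \<le> exp (- 1 / 2) * measure std_gauss E0" by (intro mult_right_mono) auto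
  ultimately show ?thesis unfolding E0_def by linarith
qed

section \<open>Inner and outer parallel sets\<close>

text \<open>With open balls the core is closed and the enlargement is open for every set
  \<open>A\<close>, so both are Borel.\<close>

definition core :: "real \<Rightarrow> 'a::euclidean_space set \<Rightarrow> 'a set" where
  "core \<eta> A = {z. ball z \<eta> \<subseteq> A}"

definition enlarge :: "real \<Rightarrow> 'a::euclidean_space set \<Rightarrow> 'a set" where
  "enlarge \<eta> A = (\<Union>a\<in>A. ball a \<eta>)"

lemma closed_core: "closed (core \<eta> A)"
  unfolding closed_sequential_limits
proof (intro allI impI, elim conjE)
  fix x l assume x: "\<forall>n. x n \<in> core \<eta> A" "x \<longlonglongrightarrow> l"
  show "l \<in> core \<eta> A" unfolding core_def
  proof (intro CollectI subsetI)
    fix w assume "w \<in> ball l \<eta>"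
    then have "dist l w < \<eta>" by simp
    moreover have "(\<lambda>n. dist (x n) w) \<longlonglongrightarrow> dist l w" by (intro tendsto_intros x)
    ultimately have "eventually (\<lambda>n. dist (x n) w < \<eta>) sequentially" by (simp add: order_tendstoD(2))
    then obtain n where "dist (x n) w < \<eta>" by (auto simp: eventually_sequentially)
    then show "w \<in> A" using x(1)[rule_format, of n] unfolding core_def by auto
  qed
qed

lemma open_enlarge: "open (enlarge \<eta> A)"
  unfolding enlarge_def by auto

lemma core_borel [measurable]: "core \<eta> A \<in> sets borel"
  and enlarge_borel [measurable]: "enlarge \<eta> A \<in> sets borel"
  by (auto intro: borel_closed borel_open closed_core open_enlarge)

lemma convex_enlarge:
  assumes "convex A" shows "convex (enlarge \<eta> A)"
proof -
  have "enlarge \<eta> A = (\<Union>x\<in>A. \<Union>y\<in>ball 0 \<eta>. {x + y})"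
  proof (intro set_eqI iffI)
    fix z assume "z \<in> enlarge \<eta> A"
    then obtain a where "a \<in> A" "dist a z < \<eta>" unfolding enlarge_def by auto
    then have "a \<in> A" "z - a \<in> ball 0 \<eta>" "z \<in> {a + (z - a)}" by (auto simp: dist_norm norm_minus_commute)
    then show "z \<in> (\<Union>x\<in>A. \<Union>y\<in>ball 0 \<eta>. {x + y})" by blast
  next
    fix z assume "z \<in> (\<Union>x\<in>A. \<Union>y\<in>ball 0 \<eta>. {x + y})"
    then obtain x y where "x \<in> A" "norm y < \<eta>" "z = x + y" by auto
    then show "z \<in> enlarge \<eta> A" unfolding enlarge_def by (intro UN_I[of x]) (auto simp: dist_norm)
  qed
  then show ?thesis using convex_sums[OF assms convex_ball[of "0::'a" \<eta>]] by simp
qed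

text \<open>The point may lie on the boundary, so the separation is weak. The normal has length 1 in
  order that its values can be compared with distances.\<close>

lemma separating_functional:
  fixes A :: "'a::euclidean_space set"
  assumes "convex A" "w \<notin> A"
  shows "\<exists>u. norm u = 1 \<and> (\<forall>x\<in>A. u \<bullet> x \<le> u \<bullet> w)"
proof -
  have "convex ((\<lambda>x. w - x) ` A)" using convex_translation[OF convex_negations[OF assms(1)], of w] by (simp add: image_image)
  moreover have "0 \<notin> (\<lambda>x. w - x) ` A" using assms(2) by auto
  ultimately obtain a where "a \<noteq> 0" "\<forall>x\<in>(\<lambda>x. w - x) ` A. 0 \<le> a \<bullet> x"
    using separating_hyperplane_set_0 by blast
  then have "\<forall>x\<in>A. a \<bullet> x \<le> a \<bullet> w" "0 < norm a" by (auto simp: inner_diff_right)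
  then show ?thesis
    by (intro exI[of _ "(1 / norm a) *\<^sub>R a"]) (auto simp: divide_right_mono)
qed

text \<open>Near a point of \<open>A\<close> with a non-member \<open>w\<close> closer than
  \<open>\<eta>\<close>, take a unit normal \<open>u\<close> separating \<open>A\<close> from
  \<open>w\<close>. Some coordinate of \<open>u\<close> has absolute value at least
  \<open>1 / d\<close>, so a move by \<open>2 * d * \<eta>\<close> along that axis, in the right
  direction, passes beyond \<open>w\<close> and leaves \<open>A\<close>. Hence \<open>2 * d\<close>
  exit sets, each of measure at most \<open>4 * d * \<eta>\<close>, cover the shell.\<close>

lemma measure_shell_le:
  fixes A :: "'a::euclidean_space set"
  assumes A: "convex A" and [measurable]: "A \<in> sets borel" and \<eta>: "0 \<le> \<eta>"
  shows "measure std_gauss (A - core \<eta> A) \<le> 8 * (real DIM('a))\<^sup>2 * \<eta>"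
proof -
  define d where "d = real DIM('a)"
  have d: "1 \<le> d" using DIM_positive[where 'a='a] unfolding d_def by linarith
  define Ex where "Ex h = {z \<in> A. z + h \<notin> A}" for h
  have Ex[measurable]: "Ex h \<in> sets borel" for h unfolding Ex_def by measurable
  have sub: "A - core \<eta> A \<subseteq> (\<Union>b\<in>Basis. Ex ((2 * d * \<eta>) *\<^sub>R b) \<union> Ex (- (2 * d * \<eta>) *\<^sub>R b))"
  proof
    fix z assume "z \<in> A - core \<eta> A"
    then have z: "z \<in> A" and "\<not> ball z \<eta> \<subseteq> A" by (auto simp: core_def)
    then obtain w where w: "dist z w < \<eta>" "w \<notin> A" by (auto simp: subset_iff)
    obtain u where u: "norm u = 1" "\<And>x. x \<in> A \<Longrightarrow> u \<bullet> x \<le> u \<bullet> w" using separating_functional[OF A w(2)] by blast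
    have "\<exists>b\<in>Basis. 1 \<le> d * \<bar>u \<bullet> b\<bar>"
    proof (rule ccontr)
      assume "\<not> ?thesis"
      then have "\<bar>u \<bullet> b\<bar> < 1 / d" if "b \<in> Basis" for b using that d by (auto simp: field_simps)
      then have "(\<Sum>b\<in>Basis. \<bar>u \<bullet> b\<bar>) < (\<Sum>b\<in>(Basis::'a set). 1 / d)" by (intro sum_strict_mono) auto
      also have "\<dots> = 1" using d by (simp add: d_def)
      finally show False using norm_le_l1[of u] u(1) by linarith
    qed
    then obtain b where b: "b \<in> Basis" "1 \<le> d * \<bar>u \<bullet> b\<bar>" by blast
    have "u \<bullet> (w - z) \<le> norm u * norm (w - z)" by (rule norm_cauchy_schwarz)
    then have wz: "u \<bullet> w < u \<bullet> z + \<eta>" using w(1) u(1) by (simp add: inner_diff_right dist_norm norm_minus_commute)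
    have \<eta>b: "\<eta> \<le> 2 * d * \<eta> * \<bar>u \<bullet> b\<bar>" using mult_left_mono[OF b(2) \<eta>] \<eta> by (simp add: mult_ac)
    have "z + (sgn (u \<bullet> b) * (2 * d * \<eta>)) *\<^sub>R b \<notin> A"
    proof
      assume "z + (sgn (u \<bullet> b) * (2 * d * \<eta>)) *\<^sub>R b \<in> A"
      from u(2)[OF this] have "u \<bullet> z + 2 * d * \<eta> * \<bar>u \<bullet> b\<bar> \<le> u \<bullet> w"
        by (simp add: inner_add_right abs_sgn mult_ac)
      then show False using wz \<eta>b by linarith
    qed
    moreover have "u \<bullet> b \<noteq> 0" using b(2) by auto
    ultimately have "z \<in> Ex ((2 * d * \<eta>) *\<^sub>R b) \<union> Ex (- (2 * d * \<eta>) *\<^sub>R b)"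
      using z unfolding Ex_def by (cases "0 < u \<bullet> b") (auto simp: sgn_if)
    then show "z \<in> (\<Union>b\<in>Basis. Ex ((2 * d * \<eta>) *\<^sub>R b) \<union> Ex (- (2 * d * \<eta>) *\<^sub>R b))" using b(1) by blast
  qed
  have "measure std_gauss (A - core \<eta> A) \<le> measure std_gauss (\<Union>b\<in>Basis. Ex ((2 * d * \<eta>) *\<^sub>R b) \<union> Ex (- (2 * d * \<eta>) *\<^sub>R b))"
    using sub by (intro std_gauss.finite_measure_mono) (auto intro!: sets.finite_UN)
  also have "\<dots> \<le> (\<Sum>b\<in>Basis. measure std_gauss (Ex ((2 * d * \<eta>) *\<^sub>R b) \<union> Ex (- (2 * d * \<eta>) *\<^sub>R b)))"
    by (intro std_gauss.finite_measure_subadditive_finite) auto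
  also have "\<dots> \<le> (\<Sum>b\<in>(Basis::'a set). 8 * d * \<eta>)"
  proof (rule sum_mono)
    fix b :: 'a assume b: "b \<in> Basis"
    have "measure std_gauss (Ex ((2 * d * \<eta>) *\<^sub>R b) \<union> Ex (- (2 * d * \<eta>) *\<^sub>R b))
        \<le> measure std_gauss (Ex ((2 * d * \<eta>) *\<^sub>R b)) + measure std_gauss (Ex (- (2 * d * \<eta>) *\<^sub>R b))"
      by (rule measure_Un_le) auto
    also have "\<dots> \<le> 2 * norm ((2 * d * \<eta>) *\<^sub>R b) + 2 * norm (- (2 * d * \<eta>) *\<^sub>R b)"
      unfolding Ex_def by (intro add_mono measure_std_gauss_exit_le A) auto
    also have "\<dots> = 8 * d * \<eta>" using b \<eta> d by simp
    finally show "measure std_gauss (Ex ((2 * d * \<eta>) *\<^sub>R b) \<union> Ex (- (2 * d * \<eta>) *\<^sub>R b)) \<le> 8 * d * \<eta>" .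
  qed
  also have "\<dots> = 8 * d\<^sup>2 * \<eta>" by (simp add: d_def power2_eq_square)
  finally show ?thesis by (simp add: d_def)
qed

text \<open>From a point outside \<open>A\<close>, a move by \<open>5 / 2 * \<eta>\<close> along the
  separating normal stays within the ball of radius \<open>3 * \<eta>\<close> but goes farther than
  \<open>2 * \<eta>\<close> from \<open>A\<close>. It follows that the outer shell of
  \<open>A\<close> is part of an inner shell of the enlarged set, which is convex again.\<close>

lemma core_enlarge_subset:
  fixes A :: "'a::euclidean_space set"
  assumes A: "convex A" and \<eta>: "0 < \<eta>"
  shows "core (3 * \<eta>) (enlarge (2 * \<eta>) A) \<subseteq> A"
proof (rule subsetI, rule ccontr)
  fix z assume z: "z \<in> core (3 * \<eta>) (enlarge (2 * \<eta>) A)" and "z \<notin> A"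
  then obtain u where u: "norm u = 1" "\<And>x. x \<in> A \<Longrightarrow> u \<bullet> x \<le> u \<bullet> z" using separating_functional[OF A] by blast
  have "z + (5 / 2 * \<eta>) *\<^sub>R u \<in> ball z (3 * \<eta>)" using u(1) \<eta> by (simp add: dist_norm)
  then have "z + (5 / 2 * \<eta>) *\<^sub>R u \<in> enlarge (2 * \<eta>) A" using z unfolding core_def by auto
  then obtain c where c: "c \<in> A" "norm (z + (5 / 2 * \<eta>) *\<^sub>R u - c) < 2 * \<eta>"
    unfolding enlarge_def by (auto simp: dist_norm norm_minus_commute)
  have "u \<bullet> (z + (5 / 2 * \<eta>) *\<^sub>R u - c) \<le> norm u * norm (z + (5 / 2 * \<eta>) *\<^sub>R u - c)" by (rule norm_cauchy_schwarz)
  moreover have "u \<bullet> u = 1" using u(1) by (simp add: norm_eq_1)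
  ultimately have "5 / 2 * \<eta> < 2 * \<eta>" using c(2) u(1) u(2)[OF c(1)] by (simp add: inner_diff_right inner_add_right)
  then show False using \<eta> by simp
qed

lemma measure_enlarge_le:
  fixes A :: "'a::euclidean_space set"
  assumes A: "convex A" and [measurable]: "A \<in> sets borel" and \<eta>: "0 < \<eta>"
  shows "measure std_gauss (enlarge (2 * \<eta>) A) \<le> measure std_gauss A + 24 * (real DIM('a))\<^sup>2 * \<eta>"
proof -
  let ?B = "enlarge (2 * \<eta>) A"
  have "measure std_gauss ?B \<le> measure std_gauss (A \<union> (?B - core (3 * \<eta>) ?B))"
    using core_enlarge_subset[OF A \<eta>] by (intro std_gauss.finite_measure_mono) auto
  also have "\<dots> \<le> measure std_gauss A + measure std_gauss (?B - core (3 * \<eta>) ?B)" by (rule measure_Un_le) auto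
  also have "measure std_gauss (?B - core (3 * \<eta>) ?B) \<le> 8 * (real DIM('a))\<^sup>2 * (3 * \<eta>)"
    using \<eta> by (intro measure_shell_le convex_enlarge A) auto
  finally show ?thesis by simp
qed

lemma measure_core_ge:
  fixes A :: "'a::euclidean_space set"
  assumes A: "convex A" and [measurable]: "A \<in> sets borel" and \<eta>: "0 \<le> \<eta>"
  shows "measure std_gauss A \<le> measure std_gauss (core \<eta> A) + 8 * (real DIM('a))\<^sup>2 * \<eta>"
proof -
  have "measure std_gauss A \<le> measure std_gauss (core \<eta> A \<union> (A - core \<eta> A))"
    by (intro std_gauss.finite_measure_mono) auto
  also have "\<dots> \<le> measure std_gauss (core \<eta> A) + measure std_gauss (A - core \<eta> A)" by (rule measure_Un_le) auto
  finally show ?thesis using measure_shell_le[OF A assms(2) \<eta>] by linarith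
qed

lemma open_std_gauss_pos:
  fixes U :: "'a::euclidean_space set"
  assumes "open U" "U \<noteq> {}"
  shows "0 < measure std_gauss U"
proof -
  have [measurable]: "U \<in> sets borel" using assms(1) by auto
  have "emeasure std_gauss U \<noteq> 0"
  proof
    assume "emeasure std_gauss U = 0"
    then have "(\<integral>\<^sup>+x. ennreal (gauss_density x) * indicator U x \<partial>lborel) = 0"
      unfolding std_gauss_def by (subst (asm) emeasure_density) auto
    then have "AE x in lborel. ennreal (gauss_density x) * indicator U x = 0"
      by (subst (asm) nn_integral_0_iff_AE) auto
    moreover have "0 < gauss_density x" for x :: 'a unfolding gauss_density_eq by simp
    ultimately have "AE x in lborel. x \<notin> U"
      by (auto elim!: eventually_mono simp: indicator_def split: if_splits) (metis less_irrefl ennreal_eq_0_iff not_le)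
    then have "emeasure lborel U = 0" by (subst (asm) AE_iff_measurable[of U]) auto
    moreover obtain c r where "0 < r" "ball c r \<subseteq> U" using assms open_contains_ball by blast
    then have "0 < emeasure lborel (ball c r)" by (simp add: emeasure_ball)
    moreover have "emeasure lborel (ball c r) \<le> emeasure lborel U"
      using \<open>ball c r \<subseteq> U\<close> by (intro emeasure_mono) auto
    ultimately show False by simp
  qed
  then show ?thesis by (simp add: std_gauss.emeasure_eq_measure measure_nonneg less_le)
qed

section \<open>A Berry--Esseen bound on convex sets\<close>

text \<open>The law of a scaled sum of \<open>n\<close> steps, built by adding one independent step
  at a time. It is needed to speak of the probability of sets, where the operator only acts on
  functions.\<close>

lemma avg_op_pow_measure:
  fixes \<nu> :: "'a::euclidean_space measure"
  assumes "borel_prob \<nu>"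
  shows "\<exists>\<rho>. borel_prob \<rho> \<and> (\<forall>f x. bdd_borel f \<longrightarrow> (avg_op \<nu> s ^^ n) f x = (\<integral>w. f (x + w) \<partial>\<rho>))"
proof (induction n)
  case 0
  interpret r: prob_space "return borel 0 :: 'a measure" by (rule prob_space_return) simp
  have "borel_prob (return borel (0::'a))" by unfold_locales simp
  moreover have "(\<integral>w. f (x + w) \<partial>return borel 0) = f x" if "bdd_borel f" for f and x :: 'a
    using that by (subst integral_return) (auto simp: bdd_borel_def)
  ultimately show ?case by (intro exI[of _ "return borel 0"]) auto
next
  case (Suc n)
  interpret \<nu>: borel_prob \<nu> by fact
  obtain \<rho> where "borel_prob \<rho>" and \<rho>: "\<And>f x. bdd_borel f \<Longrightarrow> (avg_op \<nu> s ^^ n) f x = (\<integral>w. f (x + w) \<partial>\<rho>)"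
    using Suc by blast
  interpret \<rho>: borel_prob \<rho> by fact
  interpret P: pair_prob_space \<nu> \<rho> ..
  let ?g = "\<lambda>(z, y). s *\<^sub>R z + y"
  define \<rho>' where "\<rho>' = distr (\<nu> \<Otimes>\<^sub>M \<rho>) borel ?g"
  have g[measurable]: "?g \<in> measurable (\<nu> \<Otimes>\<^sub>M \<rho>) borel" by measurable
  interpret \<rho>': prob_space \<rho>' unfolding \<rho>'_def by (rule P.prob_space_distr) measurable
  have "borel_prob \<rho>'" by unfold_locales (simp add: \<rho>'_def)
  moreover have "(avg_op \<nu> s ^^ Suc n) f x = (\<integral>w. f (x + w) \<partial>\<rho>')" if f: "bdd_borel f" for f x
  proof -
    have [measurable]: "f \<in> borel_measurable borel" using f by (simp add: bdd_borel_def)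
    obtain B where B: "\<And>x. \<bar>f x\<bar> \<le> B" using f by (auto simp: bdd_borel_def)
    have int: "integrable (\<nu> \<Otimes>\<^sub>M \<rho>) (\<lambda>(z, y). f (x + s *\<^sub>R z + y))"
      by (rule P.integrable_const_bound[where B=B]) (auto simp: B)
    have "(avg_op \<nu> s ^^ Suc n) f x = (\<integral>z. (\<integral>y. f (x + s *\<^sub>R z + y) \<partial>\<rho>) \<partial>\<nu>)"
      by (simp add: avg_op_def[of \<nu> s "(avg_op \<nu> s ^^ n) f"] \<rho>[OF f])
    also have "\<dots> = (\<integral>p. (\<lambda>(z, y). f (x + s *\<^sub>R z + y)) p \<partial>(\<nu> \<Otimes>\<^sub>M \<rho>))"
      using P.integral_fst'[OF int] by simp
    also have "\<dots> = (\<integral>w. f (x + w) \<partial>\<rho>')"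
      unfolding \<rho>'_def by (subst integral_distr) (auto simp: add.assoc split_beta')
    finally show ?thesis .
  qed
  ultimately show ?case by blast
qed

text \<open>Markov's inequality for \<open>exp (norm z)\<close>. This rate is ample, as
  \<open>K\<close> will grow like a power of \<open>n\<close>.\<close>

lemma std_gauss_tail:
  "\<exists>C\<ge>0. \<forall>K. measure std_gauss {z::'a::euclidean_space. K \<le> norm z} \<le> C * exp (- K)"
proof -
  let ?C = "\<integral>z. exp (norm (z::'a)) \<partial>std_gauss"
  have int: "integrable std_gauss (\<lambda>z::'a. exp (norm z))" using integrable_exp_norm_std_gauss[of 1] by simp
  have "measure std_gauss {z::'a. K \<le> norm z} \<le> ?C * exp (- K)" for K
  proof -
    have "measure std_gauss {z::'a. K \<le> norm z} = (\<integral>z. indicator {z::'a. K \<le> norm z} z \<partial>std_gauss)" by simp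
    also have "\<dots> \<le> (\<integral>z. exp (norm (z::'a)) * exp (- K) \<partial>std_gauss)"
    proof (rule integral_mono)
      show "integrable std_gauss (\<lambda>z. indicator {z::'a. K \<le> norm z} z :: real)"
        by (intro integrable_real_indicator) (auto simp: less_top[symmetric])
      show "integrable std_gauss (\<lambda>z::'a. exp (norm z) * exp (- K))" using int by (rule integrable_mult_left)
      show "indicator {z::'a. K \<le> norm z} z \<le> exp (norm z) * exp (- K)" for z :: 'a
        by (auto simp: indicator_def exp_add[symmetric])
    qed
    also have "\<dots> = ?C * exp (- K)" by simp
    finally show ?thesis .
  qed
  moreover have "0 \<le> ?C" by (intro integral_nonneg_AE) auto
  ultimately show ?thesis by blast
qed

lemma bdd_borel_indicator: "A \<in> sets borel \<Longrightarrow> bdd_borel (indicator A)"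
  unfolding bdd_borel_def by (auto intro!: exI[of _ 1] simp: indicator_def)

text \<open>Smoothing displaces a point by \<open>K * \<epsilon>\<close> or more only with the
  probability of the tail; otherwise a point of \<open>B\<close> stays in \<open>A\<close>, and a
  point reaching \<open>B\<close> started in \<open>A\<close>.\<close>

lemma
  fixes A B :: "'a::euclidean_space set"
  assumes [measurable]: "A \<in> sets borel" "B \<in> sets borel" and \<epsilon>: "0 < \<epsilon>"
    and AB: "\<And>y. y \<in> B \<Longrightarrow> ball y (K * \<epsilon>) \<subseteq> A"
  shows indicator_le_smooth: "indicator B y \<le> avg_op std_gauss \<epsilon> (indicator A) y + measure std_gauss {z::'a. K \<le> norm z}"
    and smooth_le_indicator: "avg_op std_gauss \<epsilon> (indicator B) y \<le> indicator A y + measure std_gauss {z::'a. K \<le> norm z}"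
proof -
  have bA: "bdd_borel (indicator A)" and bB: "bdd_borel (indicator B)" by (auto intro: bdd_borel_indicator)
  have iA: "integrable std_gauss (\<lambda>z. indicator A (y + \<epsilon> *\<^sub>R z) :: real)" and iB: "integrable std_gauss (\<lambda>z. indicator B (y + \<epsilon> *\<^sub>R z) :: real)"
    by (intro std_gauss.integrable_bdd_borel std_gauss.bdd_borel_affine bA bB)+
  have it: "integrable std_gauss (\<lambda>z. indicator {z::'a. K \<le> norm z} z :: real)"
    by (intro std_gauss.integrable_bdd_borel bdd_borel_indicator) measurable
  have inb: "dist y (y + \<epsilon> *\<^sub>R z) < K * \<epsilon>" "dist (y + \<epsilon> *\<^sub>R z) y < K * \<epsilon>" if "\<not> K \<le> norm z" for z
    using that \<epsilon> by (auto simp: dist_norm mult.commute)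
  have inA: "y + \<epsilon> *\<^sub>R z \<in> A" if "y \<in> B" "\<not> K \<le> norm z" for z
    using AB[OF that(1)] inb(1)[OF that(2)] unfolding subset_iff mem_ball by blast
  have yA: "y \<in> A" if "y + \<epsilon> *\<^sub>R z \<in> B" "\<not> K \<le> norm z" for z
    using AB[OF that(1)] inb(2)[OF that(2)] unfolding subset_iff mem_ball by blast
  have "(\<integral>z. (indicator B y :: real) \<partial>(std_gauss :: 'a measure)) \<le> (\<integral>z. indicator A (y + \<epsilon> *\<^sub>R z) + indicator {z::'a. K \<le> norm z} z \<partial>std_gauss)"
  proof (rule integral_mono)
    show "indicator B y \<le> indicator A (y + \<epsilon> *\<^sub>R z) + (indicator {z::'a. K \<le> norm z} z :: real)" for z
      using inA[of z] by (auto simp: indicator_def)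
  qed (use iA it in auto)
  also have "\<dots> = avg_op std_gauss \<epsilon> (indicator A) y + measure std_gauss {z::'a. K \<le> norm z}"
    unfolding avg_op_def using iA it by simp
  finally show "indicator B y \<le> avg_op std_gauss \<epsilon> (indicator A) y + measure std_gauss {z::'a. K \<le> norm z}"
    by (simp add: std_gauss.prob_space[simplified])
  have "avg_op std_gauss \<epsilon> (indicator B) y \<le> (\<integral>z. indicator A y + indicator {z::'a. K \<le> norm z} z \<partial>std_gauss)"
    unfolding avg_op_def
  proof (rule integral_mono)
    show "indicator B (y + \<epsilon> *\<^sub>R z) \<le> indicator A y + (indicator {z::'a. K \<le> norm z} z :: real)" for z
      using yA[of z] by (auto simp: indicator_def)
  qed (use iB it in auto)
  also have "\<dots> = indicator A y + measure std_gauss {z::'a. K \<le> norm z}"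
    using it by (simp add: std_gauss.prob_space[simplified])
  finally show "avg_op std_gauss \<epsilon> (indicator B) y \<le> indicator A y + measure std_gauss {z::'a. K \<le> norm z}" .
qed

lemma (in borel_prob) measure_le_integral_add:
  assumes [measurable]: "A \<in> sets borel" and f: "bdd_borel f" and le: "\<And>y. indicator A y \<le> f y + c"
  shows "measure \<rho> A \<le> (\<integral>y. f y \<partial>\<rho>) + c"
proof -
  have "measure \<rho> A = (\<integral>y. indicator A y \<partial>\<rho>)" by simp
  also have "\<dots> \<le> (\<integral>y. f y + c \<partial>\<rho>)"
    using integrable_bdd_borel[OF f] le by (intro integral_mono integrable_bdd_borel[OF bdd_borel_indicator]) auto
  also have "\<dots> = (\<integral>y. f y \<partial>\<rho>) + c" using integrable_bdd_borel[OF f] by (simp add: prob_space[simplified])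
  finally show ?thesis .
qed

lemma (in borel_prob) integral_le_measure_add:
  assumes [measurable]: "A \<in> sets borel" and f: "bdd_borel f" and le: "\<And>y. f y \<le> indicator A y + c"
  shows "(\<integral>y. f y \<partial>\<rho>) \<le> measure \<rho> A + c"
proof -
  have "(\<integral>y. f y \<partial>\<rho>) \<le> (\<integral>y. indicator A y + c \<partial>\<rho>)"
    using integrable_bdd_borel[OF f] integrable_bdd_borel[OF bdd_borel_indicator[of A]] le by (intro integral_mono) auto
  also have "\<dots> = measure \<rho> A + c"
    using integrable_bdd_borel[OF bdd_borel_indicator[of A]] by (simp add: prob_space[simplified])
  finally show ?thesis .
qed

lemma core_add_subset: "y \<in> core (2 * \<eta>) A \<Longrightarrow> ball y \<eta> \<subseteq> core \<eta> A"
  unfolding core_def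
proof (intro subsetI CollectI)
  fix x w assume "y \<in> {z. ball z (2 * \<eta>) \<subseteq> A}" and x: "x \<in> ball y \<eta>" and w: "w \<in> ball x \<eta>"
  then have "dist y w < 2 * \<eta>" using dist_triangle[of y w x] by auto
  then show "w \<in> A" using \<open>y \<in> {z. ball z (2 * \<eta>) \<subseteq> A}\<close> by auto
qed

lemma enlarge_add_subset: "y \<in> enlarge \<eta> A \<Longrightarrow> ball y \<eta> \<subseteq> enlarge (2 * \<eta>) A"
  unfolding enlarge_def
proof (intro subsetI)
  fix w assume "y \<in> (\<Union>a\<in>A. ball a \<eta>)" and w: "w \<in> ball y \<eta>"
  then obtain a where "a \<in> A" "dist a y < \<eta>" by auto
  then show "w \<in> (\<Union>a\<in>A. ball a (2 * \<eta>))" using w dist_triangle[of a w y] by (intro UN_I[of a]) auto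
qed

text \<open>Up to tails, the indicator of \<open>A\<close> lies below the smoothed indicator of an
  enlargement and above that of a core. The smoothed indicators are compared by Lindeberg
  replacement, and undoing the smoothing under the Gaussian measure costs a shell of width
  proportional to \<open>K * sqrt (q / n)\<close>. The parameters \<open>q\<close> and
  \<open>K\<close> remain free and are balanced later.\<close>

lemma berry_esseen_convex:
  "\<exists>C\<ge>0. \<forall>\<nu> m1 m2 m3 n q K \<rho> A. approx_isotropic (\<nu> :: 'a::euclidean_space measure) m1 m2 m3 \<longrightarrow> 0 < n \<longrightarrow> 0 < q \<longrightarrow> 0 < K \<longrightarrow>
     borel_prob \<rho> \<longrightarrow> (\<forall>f. bdd_borel f \<longrightarrow> (avg_op \<nu> (1 / sqrt (real n)) ^^ n) f 0 = (\<integral>w. f w \<partial>\<rho>)) \<longrightarrow>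
     convex A \<longrightarrow> A \<in> sets borel \<longrightarrow>
     \<bar>measure \<rho> A - measure std_gauss A\<bar>
       \<le> C * (m1 * sqrt (real n) + m2 * (1 + ln (real n)) + (m3 + 1) / sqrt (real q) + K * sqrt (real q / real n) + exp (- K))"
proof -
  obtain C where C: "C \<ge> 0" and lind: "\<And>\<nu> m1 m2 m3 n q f x. approx_isotropic (\<nu> :: 'a measure) m1 m2 m3 \<Longrightarrow> 0 < n \<Longrightarrow> 0 < q \<Longrightarrow>
     f \<in> borel_measurable borel \<Longrightarrow> (\<forall>y. \<bar>f y\<bar> \<le> 1) \<Longrightarrow>
     \<bar>(avg_op \<nu> (1 / sqrt (real n)) ^^ n) (avg_op std_gauss (sqrt (real q / real n)) f) x
        - avg_op std_gauss 1 (avg_op std_gauss (sqrt (real q / real n)) f) x\<bar>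
       \<le> C * (m1 * sqrt (real n) + m2 * (1 + ln (real n)) + (m3 + 1) / sqrt (real q))"
    using lindeberg by meson
  obtain T where T: "T \<ge> 0" and tail: "\<And>K. measure std_gauss {z::'a. K \<le> norm z} \<le> T * exp (- K)"
    using std_gauss_tail by blast
  define S where "S = 24 * (real DIM('a))\<^sup>2"
  have S: "0 \<le> S" by (simp add: S_def)
  define C' where "C' = C + 2 * T + S"
  have C': "C \<le> C'" "2 * T \<le> C'" "S \<le> C'" "0 \<le> C'" using C T S by (auto simp: C'_def)
  have "\<bar>measure \<rho> A - measure std_gauss A\<bar>
       \<le> C' * (m1 * sqrt (real n) + m2 * (1 + ln (real n)) + (m3 + 1) / sqrt (real q) + K * sqrt (real q / real n) + exp (- K))"
    if iso: "approx_isotropic \<nu> m1 m2 m3" and n: "0 < n" and q: "0 < q" and K: "0 < K" and "borel_prob \<rho>"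
      and \<rho>: "\<And>f. bdd_borel f \<Longrightarrow> (avg_op \<nu> (1 / sqrt (real n)) ^^ n) f 0 = (\<integral>w. f w \<partial>\<rho>)"
      and A: "convex A" and Ab[measurable]: "A \<in> sets borel"
    for \<nu> :: "'a measure" and m1 m2 m3 n q K \<rho> A
  proof -
    interpret \<rho>: borel_prob \<rho> by fact
    define \<epsilon> where "\<epsilon> = sqrt (real q / real n)"
    have \<epsilon>: "0 < \<epsilon>" using n q by (simp add: \<epsilon>_def)
    define \<eta> where "\<eta> = K * \<epsilon>"
    have \<eta>: "0 < \<eta>" using K \<epsilon> by (simp add: \<eta>_def)
    define L where "L = m1 * sqrt (real n) + m2 * (1 + ln (real n)) + (m3 + 1) / sqrt (real q)"
    have L: "0 \<le> L" unfolding L_def using approx_isotropic_nonneg[OF iso] n by (intro add_nonneg_nonneg mult_nonneg_nonneg divide_nonneg_nonneg) auto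
    define \<tau> where "\<tau> = measure std_gauss {z::'a. K \<le> norm z}"
    have comp: "\<bar>(\<integral>w. avg_op std_gauss \<epsilon> (indicator B) w \<partial>\<rho>) - (\<integral>w. avg_op std_gauss \<epsilon> (indicator B) w \<partial>std_gauss)\<bar> \<le> C * L"
      if [measurable]: "B \<in> sets borel" for B
    proof -
      have "bdd_borel (avg_op std_gauss \<epsilon> (indicator B))" by (intro std_gauss.bdd_borel_avg_op bdd_borel_indicator) measurable
      from \<rho>[OF this] lind[OF iso n q, of "indicator B" 0]
      show ?thesis unfolding \<epsilon>_def[symmetric] L_def[symmetric] by (simp add: avg_op_def[of std_gauss 1] indicator_def)
    qed
    have bs: "bdd_borel (avg_op std_gauss \<epsilon> (indicator B))" if "B \<in> sets borel" for B :: "'a set"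
      using that by (intro std_gauss.bdd_borel_avg_op bdd_borel_indicator)
    have enl: "ball y (K * \<epsilon>) \<subseteq> enlarge \<eta> A" if "y \<in> A" for y
      using that by (auto simp: enlarge_def \<eta>_def)
    have cor: "ball y (K * \<epsilon>) \<subseteq> A" if "y \<in> core \<eta> A" for y
      using that by (auto simp: core_def \<eta>_def)
    have up: "measure \<rho> A \<le> measure std_gauss A + (C * L + 2 * \<tau> + S * \<eta>)"
    proof -
      have "measure \<rho> A \<le> (\<integral>y. avg_op std_gauss \<epsilon> (indicator (enlarge \<eta> A)) y \<partial>\<rho>) + \<tau>"
        unfolding \<tau>_def using \<epsilon> enl
        by (intro \<rho>.measure_le_integral_add bs indicator_le_smooth) auto
      also have "\<dots> \<le> (\<integral>y. avg_op std_gauss \<epsilon> (indicator (enlarge \<eta> A)) y \<partial>std_gauss) + C * L + \<tau>"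
        using comp[of "enlarge \<eta> A"] by simp
      also have "(\<integral>y. avg_op std_gauss \<epsilon> (indicator (enlarge \<eta> A)) y \<partial>std_gauss) \<le> measure std_gauss (enlarge (2 * \<eta>) A) + \<tau>"
        unfolding \<tau>_def using \<epsilon> enlarge_add_subset[of _ \<eta> A]
        by (intro std_gauss.integral_le_measure_add bs smooth_le_indicator) (auto simp: \<eta>_def)
      also have "measure std_gauss (enlarge (2 * \<eta>) A) \<le> measure std_gauss A + S * \<eta>"
        unfolding S_def by (rule measure_enlarge_le[OF A Ab \<eta>])
      finally show ?thesis by simp
    qed
    have lo: "measure std_gauss A \<le> measure \<rho> A + (C * L + 2 * \<tau> + S * \<eta>)"
    proof -
      have "measure std_gauss A \<le> measure std_gauss (core (2 * \<eta>) A) + 8 * (real DIM('a))\<^sup>2 * (2 * \<eta>)"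
        using \<eta> by (intro measure_core_ge A Ab) simp
      also have "measure std_gauss (core (2 * \<eta>) A) \<le> (\<integral>y. avg_op std_gauss \<epsilon> (indicator (core \<eta> A)) y \<partial>std_gauss) + \<tau>"
        unfolding \<tau>_def using \<epsilon> core_add_subset[of _ \<eta> A]
        by (intro std_gauss.measure_le_integral_add bs indicator_le_smooth) (auto simp: \<eta>_def)
      also have "(\<integral>y. avg_op std_gauss \<epsilon> (indicator (core \<eta> A)) y \<partial>std_gauss) \<le> (\<integral>y. avg_op std_gauss \<epsilon> (indicator (core \<eta> A)) y \<partial>\<rho>) + C * L"
        using comp[of "core \<eta> A"] by simp
      also have "(\<integral>y. avg_op std_gauss \<epsilon> (indicator (core \<eta> A)) y \<partial>\<rho>) \<le> measure \<rho> A + \<tau>"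
        unfolding \<tau>_def using \<epsilon> cor
        by (intro \<rho>.integral_le_measure_add bs smooth_le_indicator) auto
      also have "8 * (real DIM('a))\<^sup>2 * (2 * \<eta>) \<le> S * \<eta>" using \<eta> by (simp add: S_def)
      finally show ?thesis by simp
    qed
    have "C * L + 2 * \<tau> + S * \<eta> \<le> C' * L + C' * exp (- K) + C' * \<eta>"
    proof (intro add_mono)
      have "2 * \<tau> \<le> 2 * T * exp (- K)" using tail[of K] by (simp add: \<tau>_def)
      also have "\<dots> \<le> C' * exp (- K)" using C' by (intro mult_right_mono) auto
      finally show "2 * \<tau> \<le> C' * exp (- K)" .
    qed (use C' L \<eta> in \<open>auto intro: mult_right_mono\<close>)
    also have "\<dots> = C' * (L + \<eta> + exp (- K))" by (simp add: algebra_simps)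
    finally have "\<bar>measure \<rho> A - measure std_gauss A\<bar> \<le> C' * (L + \<eta> + exp (- K))" using up lo by linarith
    then show ?thesis unfolding L_def \<eta>_def \<epsilon>_def .
  qed
  then show ?thesis using C'(4) by (intro exI[of _ C']) auto
qed

text \<open>A discrete layer-cake formula: \<open>J\<close> is within \<open>1 / N\<close> of the
  average of the indicators of \<open>{z. k / N \<le> J z}\<close> over
  \<open>k = 1, ..., N\<close>. An average of differences bounded by \<open>\<Delta>\<close> is
  again bounded by \<open>\<Delta>\<close>.\<close>

lemma integral_diff_le_level_sets:
  fixes J :: "'a::euclidean_space \<Rightarrow> real"
  assumes "borel_prob \<rho>" "borel_prob \<rho>'" and J[measurable]: "J \<in> borel_measurable borel"
    and J01: "\<And>z. 0 \<le> J z" "\<And>z. J z \<le> 1"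
    and lev: "\<And>r. 0 < r \<Longrightarrow> \<bar>measure \<rho> {z. r \<le> J z} - measure \<rho>' {z. r \<le> J z}\<bar> \<le> \<Delta>"
  shows "\<bar>(\<integral>z. J z \<partial>\<rho>) - (\<integral>z. J z \<partial>\<rho>')\<bar> \<le> \<Delta>"
proof (rule field_le_epsilon)
  fix e :: real assume "0 < e"
  then obtain N :: nat where N: "2 / e < real N" using reals_Archimedean2 by blast
  moreover have "0 < 2 / e" using \<open>0 < e\<close> by simp
  ultimately have N0: "0 < real N" by linarith
  have Ne: "2 / real N \<le> e" using N N0 \<open>0 < e\<close> by (simp add: field_simps)
  \<comment> \<open>Equal to \<open>\<lfloor>N * J z\<rfloor> / N\<close>. Starting at
    \<open>k = 1\<close> leaves out the level 0, which would add a spurious unit to the sum.\<close>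
  define JN where "JN z = (\<Sum>k\<in>{1..N}. indicator {z. real k / real N \<le> J z} z) / real N" for z
  have JN: "JN z \<le> J z" "J z \<le> JN z + 1 / real N" for z
  proof -
    define m where "m = nat \<lfloor>real N * J z\<rfloor>"
    have nj: "0 \<le> real N * J z" "real N * J z \<le> real N" using J01 N0 by (auto simp: mult_left_le)
    have m: "real m \<le> real N * J z" "real N * J z < real m + 1" "m \<le> N"
      using nj unfolding m_def by linarith+
    have "real k / real N \<le> J z \<longleftrightarrow> k \<le> m" for k
    proof -
      have "real k / real N \<le> J z \<longleftrightarrow> real k \<le> real N * J z" using N0 by (simp add: field_simps)
      also have "\<dots> \<longleftrightarrow> k \<le> m" using m by linarith
      finally show ?thesis .
    qed
    then have "(\<Sum>k\<in>{1..N}. indicator {z. real k / real N \<le> J z} z :: real) = (\<Sum>k\<in>{1..N}. if k \<le> m then 1 else 0)"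
      by (intro sum.cong) (auto simp: indicator_def)
    also have "\<dots> = real (card ({1..N} \<inter> {k. k \<le> m}))" by (simp add: sum.If_cases)
    also have "{1..N} \<inter> {k. k \<le> m} = {1..m}" using m(3) by auto
    finally have JNm: "JN z = real m / real N" unfolding JN_def by simp
    show "JN z \<le> J z" unfolding JNm using m(1) N0 by (simp add: divide_le_eq mult.commute)
    have "J z \<le> (real m + 1) / real N" using m(2) N0 by (simp add: le_divide_eq mult.commute)
    then show "J z \<le> JN z + 1 / real N" unfolding JNm by (simp add: add_divide_distrib)
  qed
  have bJ: "bdd_borel J" using J J01 unfolding bdd_borel_def by (auto intro!: exI[of _ 1] simp: abs_le_iff order_trans[of _ 0 1])
  have int: "(\<integral>z. J z \<partial>\<mu>) \<le> (\<Sum>k\<in>{1..N}. measure \<mu> {z. real k / real N \<le> J z}) / real N + 1 / real N"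
      "(\<Sum>k\<in>{1..N}. measure \<mu> {z. real k / real N \<le> J z}) / real N \<le> (\<integral>z. J z \<partial>\<mu>)" if "borel_prob \<mu>" for \<mu>
  proof -
    interpret borel_prob \<mu> by fact
    have iI: "integrable \<mu> (\<lambda>z. indicator {z. real k / real N \<le> J z} z :: real)" for k
      by (intro integrable_bdd_borel bdd_borel_indicator) measurable
    have iJN: "integrable \<mu> JN" unfolding JN_def by (intro integrable_divide Bochner_Integration.integrable_sum iI)
    have iJ: "integrable \<mu> J" by (rule integrable_bdd_borel[OF bJ])
    have e: "(\<integral>z. JN z \<partial>\<mu>) = (\<Sum>k\<in>{1..N}. measure \<mu> {z. real k / real N \<le> J z}) / real N"
      unfolding JN_def using iI by (simp add: Bochner_Integration.integral_sum)
    have "(\<integral>z. J z \<partial>\<mu>) \<le> (\<integral>z. JN z + 1 / real N \<partial>\<mu>)" using iJN iJ JN by (intro integral_mono) auto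
    also have "\<dots> = (\<integral>z. JN z \<partial>\<mu>) + 1 / real N" using iJN by (simp add: prob_space[simplified])
    finally show "(\<integral>z. J z \<partial>\<mu>) \<le> (\<Sum>k\<in>{1..N}. measure \<mu> {z. real k / real N \<le> J z}) / real N + 1 / real N" unfolding e .
    show "(\<Sum>k\<in>{1..N}. measure \<mu> {z. real k / real N \<le> J z}) / real N \<le> (\<integral>z. J z \<partial>\<mu>)"
      unfolding e[symmetric] using iJN iJ JN by (intro integral_mono) auto
  qed
  have "\<bar>(\<Sum>k\<in>{1..N}. measure \<rho> {z. real k / real N \<le> J z}) - (\<Sum>k\<in>{1..N}. measure \<rho>' {z. real k / real N \<le> J z})\<bar> \<le> (\<Sum>k\<in>{1..N}. \<Delta>)"
    unfolding sum_subtractf[symmetric] using N0 by (intro order_trans[OF sum_abs] sum_mono lev) auto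
  then have "\<bar>(\<Sum>k\<in>{1..N}. measure \<rho> {z. real k / real N \<le> J z}) / real N - (\<Sum>k\<in>{1..N}. measure \<rho>' {z. real k / real N \<le> J z}) / real N\<bar> \<le> \<Delta>"
    unfolding diff_divide_distrib[symmetric] abs_divide using N0 by (simp add: field_simps)
  moreover have "1 / real N \<le> e" using Ne N0 by (simp add: field_simps)
  ultimately show "\<bar>(\<integral>z. J z \<partial>\<rho>) - (\<integral>z. J z \<partial>\<rho>')\<bar> \<le> \<Delta> + e"
    using int[OF assms(1)] int[OF assms(2)] by linarith
qed

text \<open>About \<open>x\<close> translates of the slab along \<open>x0\<close> cover a fixed open
  set \<open>F\<close>. The slab is bounded uniformly in \<open>x \<ge> 1\<close>, so by the
  Cameron--Martin formula each translate has at most a constant times the measure of the slab.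
  Starting the slab at height \<open>1 / x\<close> keeps it where the slices have a definite
  width.\<close>

lemma measure_slice_ge:
  fixes v x0 :: "'a::euclidean_space"
  assumes vx: "0 < v \<bullet> x0" and \<beta>: "0 < \<beta>"
  shows "\<exists>c>0. \<forall>x\<ge>1. c / x \<le> measure std_gauss {z. 1 / x \<le> (v \<bullet> z) / (v \<bullet> x0) \<and> (v \<bullet> z) / (v \<bullet> x0) \<le> 2 / x
      \<and> norm (z - ((v \<bullet> z) / (v \<bullet> x0)) *\<^sub>R x0) \<le> \<beta>}"
proof -
  define \<sigma> where "\<sigma> z = (v \<bullet> z) / (v \<bullet> x0)" for z
  define E where "E x = {z. 1 / x \<le> \<sigma> z \<and> \<sigma> z \<le> 2 / x \<and> norm (z - \<sigma> z *\<^sub>R x0) \<le> \<beta>}" for x :: real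
  define F where "F = {z. 0 < \<sigma> z \<and> \<sigma> z < 1 \<and> norm (z - \<sigma> z *\<^sub>R x0) < \<beta>}"
  have \<sigma>add: "\<sigma> (z + t *\<^sub>R x0) = \<sigma> z + t" for z t using vx by (simp add: \<sigma>_def inner_add_right add_divide_distrib)
  have [measurable]: "\<sigma> \<in> borel_measurable borel" unfolding \<sigma>_def by measurable
  have E[measurable]: "E x \<in> sets borel" for x unfolding E_def by measurable
  have cs: "continuous_on UNIV \<sigma>" unfolding \<sigma>_def by (intro continuous_intros) (use vx in auto)
  have "open F" unfolding F_def by (intro open_Collect_conj open_Collect_less continuous_intros cs)
  moreover have half: "\<sigma> ((1 / 2) *\<^sub>R x0) = 1 / 2" using vx by (simp add: \<sigma>_def)
  have "(1 / 2) *\<^sub>R x0 \<in> F" unfolding F_def mem_Collect_eq half using \<beta> by simp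
  ultimately have F0: "0 < measure std_gauss F" by (intro open_std_gauss_pos) auto
  define C1 where "C1 = exp (norm x0 * (\<beta> + 2 * norm x0))"
  have "measure std_gauss F / (2 * C1) / x \<le> measure std_gauss (E x)" if x: "1 \<le> x" for x
  proof -
    \<comment> \<open>Translation by \<open>w k\<close> carries the layer of heights between
      \<open>k / x\<close> and \<open>(k + 1) / x\<close> into the slab.\<close>
    define w where "w k = ((1 - real k) / x) *\<^sub>R x0" for k
    have nw: "norm (w k) \<le> norm x0" if "real k \<le> x" for k
    proof -
      have "\<bar>(1 - real k) / x\<bar> \<le> 1" using that x by (simp add: field_simps abs_le_iff)
      from mult_right_mono[OF this norm_ge_zero[of x0]] show ?thesis by (simp add: w_def)
    qed
    have meas: "measure std_gauss {z. z + w k \<in> E x} \<le> C1 * measure std_gauss (E x)" if k: "real k \<le> x" for k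
    proof -
      have "measure std_gauss {z. z + w k \<in> E x} = (\<integral>z. exp (w k \<bullet> z - (norm (w k))\<^sup>2 / 2) * indicator (E x) z \<partial>std_gauss)"
        by (rule measure_std_gauss_shift[OF E])
      also have "\<dots> \<le> (\<integral>z. C1 * indicator (E x) z \<partial>std_gauss)"
      proof (intro integral_mono integrable_exp_tilt_indicator E)
        show "integrable std_gauss (\<lambda>z. C1 * indicator (E x) z)"
          by (intro integrable_mult_right std_gauss.integrable_bdd_borel bdd_borel_indicator E)
        fix z
        show "exp (w k \<bullet> z - (norm (w k))\<^sup>2 / 2) * indicator (E x) z \<le> C1 * indicator (E x) z"
        proof (cases "z \<in> E x")
          case True
          have "\<sigma> z \<le> 2" "0 \<le> \<sigma> z" using True x unfolding E_def by (auto intro: order_trans[of _ "2 / x"] order_trans[of _ "1 / x"] simp: field_simps)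
          then have "norm (\<sigma> z *\<^sub>R x0) \<le> 2 * norm x0" by (simp add: mult_right_mono)
          moreover have "norm (z - \<sigma> z *\<^sub>R x0) \<le> \<beta>" using True by (simp add: E_def)
          ultimately have nz: "norm z \<le> \<beta> + 2 * norm x0" using norm_triangle_ineq[of "z - \<sigma> z *\<^sub>R x0" "\<sigma> z *\<^sub>R x0"] by simp
          have "w k \<bullet> z \<le> norm (w k) * norm z" by (rule norm_cauchy_schwarz)
          also have "\<dots> \<le> norm x0 * (\<beta> + 2 * norm x0)" using nw[OF k] nz by (intro mult_mono) auto
          finally have "w k \<bullet> z - (norm (w k))\<^sup>2 / 2 \<le> norm x0 * (\<beta> + 2 * norm x0)"
            using zero_le_power2[of "norm (w k)"] by linarith
          then show ?thesis using True by (simp add: C1_def)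
        qed simp
      qed
      also have "\<dots> = C1 * measure std_gauss (E x)" by simp
      finally show ?thesis .
    qed
    define m where "m = nat \<lfloor>x\<rfloor>"
    have m: "real m \<le> x" "x < real m + 1" using x unfolding m_def by linarith+
    have "F \<subseteq> (\<Union>k\<in>{..m}. {z. z + w k \<in> E x})"
    proof
      fix z assume z: "z \<in> F"
      define k where "k = nat \<lfloor>x * \<sigma> z\<rfloor>"
      have s: "0 < \<sigma> z" "\<sigma> z < 1" using z by (auto simp: F_def)
      have xs: "0 \<le> x * \<sigma> z" "x * \<sigma> z < x" using s x by auto
      have k: "real k \<le> x * \<sigma> z" "x * \<sigma> z < real k + 1" using xs(1) unfolding k_def by linarith+
      have "k \<le> m" using k(1) xs(2) m(2) by linarith
      have \<sigma>w: "\<sigma> (z + w k) = \<sigma> z + (1 - real k) / x" unfolding w_def by (rule \<sigma>add)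
      have \<sigma>w': "\<sigma> (z + w k) = (x * \<sigma> z + 1 - real k) / x" unfolding \<sigma>w using x by (simp add: field_simps)
      have "1 / x \<le> \<sigma> (z + w k)" "\<sigma> (z + w k) \<le> 2 / x" unfolding \<sigma>w' using k x by (intro divide_right_mono; simp)+
      moreover have eq: "z + w k - \<sigma> (z + w k) *\<^sub>R x0 = z - \<sigma> z *\<^sub>R x0" unfolding \<sigma>w by (simp add: w_def algebra_simps)
      have "norm (z + w k - \<sigma> (z + w k) *\<^sub>R x0) \<le> \<beta>" unfolding eq using z by (simp add: F_def)
      ultimately have "z + w k \<in> E x" unfolding E_def by blast
      then show "z \<in> (\<Union>k\<in>{..m}. {z. z + w k \<in> E x})" using \<open>k \<le> m\<close> by blast
    qed
    then have "measure std_gauss F \<le> measure std_gauss (\<Union>k\<in>{..m}. {z. z + w k \<in> E x})"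
      by (intro std_gauss.finite_measure_mono) (auto intro!: sets.finite_UN)
    also have "\<dots> \<le> (\<Sum>k\<in>{..m}. measure std_gauss {z. z + w k \<in> E x})"
      by (intro std_gauss.finite_measure_subadditive_finite) auto
    also have "\<dots> \<le> (\<Sum>k\<in>{..m}. C1 * measure std_gauss (E x))" using m by (intro sum_mono meas) auto
    also have "\<dots> = (real m + 1) * (C1 * measure std_gauss (E x))" by simp
    also have "\<dots> \<le> (2 * x) * (C1 * measure std_gauss (E x))" using m x by (intro mult_right_mono) (auto simp: C1_def)
    finally show ?thesis using x by (simp add: C1_def field_simps)
  qed
  moreover have "0 < measure std_gauss F / (2 * C1)" using F0 by (simp add: C1_def)
  ultimately show ?thesis unfolding E_def \<sigma>_def by blast
qed

section \<open>Exponential tilting\<close>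

locale standardized = borel_prob \<mu> for \<mu> :: "'a::euclidean_space measure" +
  fixes \<kappa> :: real
  assumes \<kappa>: "0 < \<kappa>" and exp_integrable: "integrable \<mu> (\<lambda>y. exp (\<kappa> * norm y))"
    and mean: "\<And>i. i \<in> Basis \<Longrightarrow> (\<integral>y. y \<bullet> i \<partial>\<mu>) = 0"
    and cov: "\<And>i j. i \<in> Basis \<Longrightarrow> j \<in> Basis \<Longrightarrow> (\<integral>y. (y \<bullet> i) * (y \<bullet> j) \<partial>\<mu>) = (if i = j then 1 else 0)"
begin

text \<open>Half of the available exponent. The other half absorbs polynomial factors, and tilts are
  restricted to \<open>norm \<theta> \<le> \<kappa> / 2\<close> so that \<open>E\<close> dominates
  \<open>exp (\<theta> \<bullet> y)\<close>.\<close>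

definition E :: "'a \<Rightarrow> real" where "E y = exp (\<kappa> / 2 * norm y)"
definition W :: "nat \<Rightarrow> real" where "W k = (\<integral>y. norm y ^ k * E y \<partial>\<mu>)"

lemma E_ge_1: "1 \<le> E y" unfolding E_def using \<kappa> by simp

lemma E_measurable [measurable]: "E \<in> borel_measurable borel" unfolding E_def by measurable

lemma integrable_power_E: "integrable \<mu> (\<lambda>y. norm y ^ k * E y)"
proof -
  \<comment> \<open>Chosen so that bounding the \<open>k\<close>-th power by an exponential costs an
    exponent of at most \<open>\<kappa> / 2\<close>.\<close>
  define c where "c = \<kappa> / (2 * (real k + 1))"
  have c: "0 < c" using \<kappa> by (simp add: c_def)
  have kc: "real k * c \<le> \<kappa> / 2" using \<kappa> by (simp add: c_def field_simps)
  have "\<bar>norm y ^ k * E y\<bar> \<le> (1 / c) ^ k * exp (\<kappa> * norm y)" for y :: 'a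
  proof -
    have "(c * norm y) ^ k \<le> exp (real k * (c * norm y))" using c by (intro power_le_exp) simp
    also have "\<dots> \<le> exp (\<kappa> / 2 * norm y)" using mult_right_mono[OF kc norm_ge_zero[of y]] by (simp add: mult.assoc)
    finally have "norm y ^ k \<le> (1 / c) ^ k * exp (\<kappa> / 2 * norm y)"
      using c by (simp add: power_mult_distrib power_divide field_simps)
    then have "norm y ^ k * E y \<le> (1 / c) ^ k * exp (\<kappa> / 2 * norm y) * exp (\<kappa> / 2 * norm y)"
      unfolding E_def by (rule mult_right_mono) simp
    also have "\<dots> = (1 / c) ^ k * exp (\<kappa> * norm y)" by (simp add: mult.assoc exp_add[symmetric])
    finally show ?thesis using E_ge_1[of y] by simp
  qed
  then show ?thesis
    by (intro integrable_real_bound[OF integrable_mult_right[OF exp_integrable]]) auto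
qed

lemma W_nonneg: "0 \<le> W k"
  unfolding W_def E_def by (intro integral_nonneg_AE) auto

lemma
  assumes [measurable]: "f \<in> borel_measurable borel" and le: "\<And>y. \<bar>f y\<bar> \<le> c * (norm y ^ k * E y)"
  shows dominated_integrable: "integrable \<mu> f" and dominated_integral: "\<bar>\<integral>y. f y \<partial>\<mu>\<bar> \<le> c * W k"
proof -
  have i: "integrable \<mu> (\<lambda>y. c * (norm y ^ k * E y))" by (intro integrable_mult_right integrable_power_E)
  show f: "integrable \<mu> f" by (rule integrable_real_bound[OF i _ le]) simp
  have "\<bar>\<integral>y. f y \<partial>\<mu>\<bar> \<le> (\<integral>y. \<bar>f y\<bar> \<partial>\<mu>)" by (rule integral_abs_bound)
  also have "\<dots> \<le> (\<integral>y. c * (norm y ^ k * E y) \<partial>\<mu>)" by (intro integral_mono integrable_abs f i le)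
  finally show "\<bar>\<integral>y. f y \<partial>\<mu>\<bar> \<le> c * W k" by (simp add: W_def)
qed

lemma integrable_inner: "integrable \<mu> (\<lambda>y. u \<bullet> y)"
proof (rule dominated_integrable)
  fix y show "\<bar>u \<bullet> y\<bar> \<le> norm u * (norm y ^ 1 * E y)"
    using Cauchy_Schwarz_ineq2[of u y] mult_left_mono[OF E_ge_1[of y], of "norm u * norm y"] by simp
qed simp

lemma integrable_inner_mult: "integrable \<mu> (\<lambda>y. (u \<bullet> y) * (w \<bullet> y))"
proof (rule dominated_integrable)
  fix y
  have "\<bar>(u \<bullet> y) * (w \<bullet> y)\<bar> \<le> (norm u * norm y) * (norm w * norm y)"
    unfolding abs_mult by (intro mult_mono Cauchy_Schwarz_ineq2) auto
  also have "\<dots> = (norm u * norm w) * (norm y ^ 2 * 1)" by (simp add: power2_eq_square)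
  also have "\<dots> \<le> (norm u * norm w) * (norm y ^ 2 * E y)" by (intro mult_left_mono E_ge_1) auto
  finally show "\<bar>(u \<bullet> y) * (w \<bullet> y)\<bar> \<le> (norm u * norm w) * (norm y ^ 2 * E y)" .
qed simp

lemma mean_inner: "(\<integral>y. u \<bullet> y \<partial>\<mu>) = 0"
proof -
  have "(\<integral>y. u \<bullet> y \<partial>\<mu>) = (\<integral>y. (\<Sum>i\<in>Basis. (u \<bullet> i) * (i \<bullet> y)) \<partial>\<mu>)"
    by (subst euclidean_inner) (simp add: inner_commute)
  also have "\<dots> = (\<Sum>i\<in>Basis. (u \<bullet> i) * (\<integral>y. i \<bullet> y \<partial>\<mu>))"
    by (simp add: integrable_inner)
  also have "\<dots> = 0" using mean by (simp add: inner_commute)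
  finally show ?thesis .
qed

lemma cov_inner: "(\<integral>y. (u \<bullet> y) * (w \<bullet> y) \<partial>\<mu>) = u \<bullet> w"
proof -
  have "(\<integral>y. (u \<bullet> y) * (w \<bullet> y) \<partial>\<mu>) = (\<integral>y. (\<Sum>i\<in>Basis. \<Sum>j\<in>Basis. ((u \<bullet> i) * (w \<bullet> j)) * ((i \<bullet> y) * (j \<bullet> y))) \<partial>\<mu>)"
    by (subst (1 2) euclidean_inner) (simp add: inner_commute sum_product mult_ac)
  also have "\<dots> = (\<Sum>i\<in>Basis. \<Sum>j\<in>Basis. ((u \<bullet> i) * (w \<bullet> j)) * (\<integral>y. (i \<bullet> y) * (j \<bullet> y) \<partial>\<mu>))"
    by (simp add: integrable_inner_mult)
  also have "\<dots> = (\<Sum>i\<in>Basis. \<Sum>j\<in>Basis. ((u \<bullet> i) * (w \<bullet> j)) * (if i = j then 1 else 0))"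
    using cov by (intro sum.cong refl) (simp add: inner_commute)
  also have "\<dots> = (\<Sum>i\<in>Basis. (u \<bullet> i) * (w \<bullet> i))" by (intro sum.cong refl) (simp add: if_distrib cong: if_cong)
  also have "\<dots> = u \<bullet> w" by (rule euclidean_inner[symmetric])
  finally show ?thesis .
qed

definition mgf :: "'a \<Rightarrow> real" where "mgf \<theta> = (\<integral>y. exp (\<theta> \<bullet> y) \<partial>\<mu>)"

text \<open>The law of \<open>Y - \<theta>\<close> under the exponentially tilted law of \<open>Y\<close>; to first order \<open>\<theta>\<close> is
  the mean of the tilted law because the covariance of \<open>\<mu>\<close> is the identity.\<close>

definition tilted :: "'a \<Rightarrow> 'a measure" where
  "tilted \<theta> = distr (density \<mu> (\<lambda>y. ennreal (exp (\<theta> \<bullet> y) / mgf \<theta>))) borel (\<lambda>y. y - \<theta>)"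

lemma exp_inner_le:
  assumes "norm \<theta> \<le> \<kappa> / 2"
  shows "exp \<bar>\<theta> \<bullet> y\<bar> \<le> E y"
proof -
  have "\<bar>\<theta> \<bullet> y\<bar> \<le> norm \<theta> * norm y" by (rule Cauchy_Schwarz_ineq2)
  also have "\<dots> \<le> \<kappa> / 2 * norm y" using assms by (rule mult_right_mono) simp
  finally show ?thesis unfolding E_def by simp
qed

lemma exp_remainders:
  assumes "norm \<theta> \<le> \<kappa> / 2"
  shows "\<bar>exp (\<theta> \<bullet> y) - 1\<bar> \<le> norm \<theta> * (norm y * E y)"
    and "\<bar>exp (\<theta> \<bullet> y) - 1 - \<theta> \<bullet> y\<bar> \<le> norm \<theta> ^ 2 * (norm y ^ 2 * E y)"
    and "\<bar>exp (\<theta> \<bullet> y) - 1 - \<theta> \<bullet> y - (\<theta> \<bullet> y)\<^sup>2 / 2\<bar> \<le> norm \<theta> ^ 3 * (norm y ^ 3 * E y)"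
proof -
  have *: "\<bar>\<theta> \<bullet> y\<bar> ^ k * exp \<bar>\<theta> \<bullet> y\<bar> \<le> norm \<theta> ^ k * (norm y ^ k * E y)" for k
    unfolding mult.assoc[symmetric] power_mult_distrib[symmetric]
    by (intro mult_mono power_mono Cauchy_Schwarz_ineq2 exp_inner_le assms) auto
  show "\<bar>exp (\<theta> \<bullet> y) - 1\<bar> \<le> norm \<theta> * (norm y * E y)"
    using order_trans[OF exp_taylor_bounds(1) *[of 1, simplified]] .
  show "\<bar>exp (\<theta> \<bullet> y) - 1 - \<theta> \<bullet> y\<bar> \<le> norm \<theta> ^ 2 * (norm y ^ 2 * E y)"
    using order_trans[OF exp_taylor_bounds(2) *[of 2, unfolded power2_abs]] .
  show "\<bar>exp (\<theta> \<bullet> y) - 1 - \<theta> \<bullet> y - (\<theta> \<bullet> y)\<^sup>2 / 2\<bar> \<le> norm \<theta> ^ 3 * (norm y ^ 3 * E y)"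
    using order_trans[OF exp_taylor_bounds(3) *[of 3]] .
qed

lemma integrable_exp_inner:
  assumes "norm \<theta> \<le> \<kappa> / 2"
  shows "integrable \<mu> (\<lambda>y. exp (\<theta> \<bullet> y))"
proof (rule dominated_integrable)
  show "\<bar>exp (\<theta> \<bullet> y)\<bar> \<le> 1 * (norm y ^ 0 * E y)" for y
    using order_trans[OF _ exp_inner_le[OF assms, of y], of "exp (\<theta> \<bullet> y)"] by simp
qed simp

text \<open>The lower bound comes from \<open>exp t \<ge> 1 + t\<close> and the zero mean; it
  ensures that dividing by \<open>mgf \<theta>\<close> never enlarges an absolute value. For the
  expansion, zero mean and identity covariance evaluate the terms up to second order
  exactly.\<close>

lemma
  assumes \<theta>: "norm \<theta> \<le> \<kappa> / 2"
  shows mgf_ge_1: "1 \<le> mgf \<theta>"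
    and mgf_approx: "\<bar>mgf \<theta> - 1 - (norm \<theta>)\<^sup>2 / 2\<bar> \<le> norm \<theta> ^ 3 * W 3"
proof -
  have "(\<integral>y. 1 + \<theta> \<bullet> y \<partial>\<mu>) \<le> mgf \<theta>"
    unfolding mgf_def by (intro integral_mono integrable_exp_inner \<theta>) (auto simp: integrable_inner)
  then show "1 \<le> mgf \<theta>" by (simp add: integrable_inner mean_inner prob_space[simplified])
  have "mgf \<theta> - 1 - (norm \<theta>)\<^sup>2 / 2 = mgf \<theta> - (\<integral>y. 1 + \<theta> \<bullet> y + ((\<theta> \<bullet> y) * (\<theta> \<bullet> y)) / 2 \<partial>\<mu>)"
    by (simp add: integrable_inner mean_inner integrable_inner_mult cov_inner prob_space[simplified] power2_norm_eq_inner)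
  also have "\<dots> = (\<integral>y. exp (\<theta> \<bullet> y) - (1 + \<theta> \<bullet> y + ((\<theta> \<bullet> y) * (\<theta> \<bullet> y)) / 2) \<partial>\<mu>)"
    unfolding mgf_def by (intro Bochner_Integration.integral_diff[symmetric] integrable_exp_inner \<theta>)
      (auto simp: integrable_inner integrable_inner_mult)
  also have "\<bar>\<dots>\<bar> \<le> norm \<theta> ^ 3 * W 3"
    using exp_remainders(3)[OF \<theta>] by (intro dominated_integral) (auto simp: power2_eq_square diff_diff_eq)
  finally show "\<bar>mgf \<theta> - 1 - (norm \<theta>)\<^sup>2 / 2\<bar> \<le> norm \<theta> ^ 3 * W 3" .
qed

lemma borel_prob_tilted:
  assumes \<theta>: "norm \<theta> \<le> \<kappa> / 2"
  shows "borel_prob (tilted \<theta>)"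
proof -
  have M: "0 < mgf \<theta>" using mgf_ge_1[OF \<theta>] by linarith
  have "prob_space (density \<mu> (\<lambda>y. ennreal (exp (\<theta> \<bullet> y) / mgf \<theta>)))"
  proof
    have "(\<integral>\<^sup>+y. ennreal (exp (\<theta> \<bullet> y) / mgf \<theta>) \<partial>\<mu>) = ennreal (\<integral>y. exp (\<theta> \<bullet> y) / mgf \<theta> \<partial>\<mu>)"
      using integrable_exp_inner[OF \<theta>] M by (intro nn_integral_eq_integral) auto
    also have "\<dots> = 1" using M by (simp add: mgf_def)
    finally show "emeasure (density \<mu> (\<lambda>y. ennreal (exp (\<theta> \<bullet> y) / mgf \<theta>))) (space (density \<mu> (\<lambda>y. ennreal (exp (\<theta> \<bullet> y) / mgf \<theta>)))) = 1"
      by (simp add: emeasure_density)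
  qed
  then have "prob_space (tilted \<theta>)" unfolding tilted_def by (intro prob_space.prob_space_distr) auto
  then interpret t: prob_space "tilted \<theta>" .
  show ?thesis by unfold_locales (simp add: tilted_def)
qed

lemma
  assumes \<theta>: "norm \<theta> \<le> \<kappa> / 2" and [measurable]: "f \<in> borel_measurable borel"
  shows integral_tilted: "(\<integral>y. f y \<partial>tilted \<theta>) = (\<integral>y. exp (\<theta> \<bullet> y) * f (y - \<theta>) \<partial>\<mu>) / mgf \<theta>"
    and integrable_tilted: "integrable \<mu> (\<lambda>y. exp (\<theta> \<bullet> y) * f (y - \<theta>)) \<Longrightarrow> integrable (tilted \<theta>) f"
proof -
  have M: "0 < mgf \<theta>" using mgf_ge_1[OF \<theta>] by linarith
  have "(\<integral>y. f y \<partial>tilted \<theta>) = (\<integral>y. (exp (\<theta> \<bullet> y) / mgf \<theta>) *\<^sub>R f (y - \<theta>) \<partial>\<mu>)"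
    unfolding tilted_def using M by (subst integral_distr) (auto simp: integral_density)
  then show "(\<integral>y. f y \<partial>tilted \<theta>) = (\<integral>y. exp (\<theta> \<bullet> y) * f (y - \<theta>) \<partial>\<mu>) / mgf \<theta>" by simp
  assume "integrable \<mu> (\<lambda>y. exp (\<theta> \<bullet> y) * f (y - \<theta>))"
  then have "integrable \<mu> (\<lambda>y. (exp (\<theta> \<bullet> y) / mgf \<theta>) *\<^sub>R f (y - \<theta>))" by simp
  then show "integrable (tilted \<theta>) f"
    unfolding tilted_def using M by (subst integrable_distr_eq) (auto simp: integrable_density)
qed

text \<open>The 8 stems from \<open>(1 + a) ^ 3 \<le> 8 + 8 * a ^ 3\<close>: recentring by a
  \<open>\<theta>\<close> of norm at most 1 replaces \<open>norm y\<close> by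
  \<open>1 + norm y\<close> in the moment bounds.\<close>

definition W' :: real where "W' = 8 * (W 0 + W 3)"

lemma dominated_cubic:
  assumes [measurable]: "f \<in> borel_measurable borel" and c: "0 \<le> c" and le: "\<And>y. \<bar>f y\<bar> \<le> c * ((1 + norm y) ^ 3 * E y)"
  shows "integrable \<mu> f \<and> \<bar>\<integral>y. f y \<partial>\<mu>\<bar> \<le> c * W'"
proof -
  have i: "integrable \<mu> (\<lambda>y. (c * 8) * (norm y ^ 0 * E y) + (c * 8) * (norm y ^ 3 * E y))"
    by (intro Bochner_Integration.integrable_add integrable_mult_right integrable_power_E)
  have cube: "(1 + a) ^ 3 \<le> 8 + 8 * a ^ 3" if "0 \<le> a" for a :: real
  proof (cases "a \<le> 1")
    case True
    then have "(1 + a) ^ 3 \<le> 2 ^ 3" using that by (intro power_mono) auto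
    then have "(1 + a) ^ 3 \<le> 8" by simp
    then show ?thesis using zero_le_power[OF that, of 3] by linarith
  next
    case False
    then have "(1 + a) ^ 3 \<le> (2 * a) ^ 3" using that by (intro power_mono) auto
    then show ?thesis by (simp add: power_mult_distrib)
  qed
  have le': "\<bar>f y\<bar> \<le> (c * 8) * (norm y ^ 0 * E y) + (c * 8) * (norm y ^ 3 * E y)" for y
  proof -
    have "c * ((1 + norm y) ^ 3 * E y) \<le> c * ((8 + 8 * norm y ^ 3) * E y)"
      using c E_ge_1[of y] by (intro mult_left_mono mult_right_mono cube) auto
    also have "\<dots> = (c * 8) * (norm y ^ 0 * E y) + (c * 8) * (norm y ^ 3 * E y)" by (simp add: algebra_simps)
    finally show ?thesis using le[of y] by linarith
  qed
  have f: "integrable \<mu> f" by (rule integrable_real_bound[OF i _ le']) simp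
  have "\<bar>\<integral>y. f y \<partial>\<mu>\<bar> \<le> (\<integral>y. \<bar>f y\<bar> \<partial>\<mu>)" by (rule integral_abs_bound)
  also have "\<dots> \<le> (\<integral>y. (c * 8) * (norm y ^ 0 * E y) + (c * 8) * (norm y ^ 3 * E y) \<partial>\<mu>)" by (intro integral_mono integrable_abs f i le')
  also have "\<dots> = (\<integral>y. (c * 8) * (norm y ^ 0 * E y) \<partial>\<mu>) + (\<integral>y. (c * 8) * (norm y ^ 3 * E y) \<partial>\<mu>)"
    by (intro Bochner_Integration.integral_add integrable_mult_right integrable_power_E)
  also have "\<dots> = c * W'" by (simp only: integral_mult_right_zero W_def[symmetric] W'_def) (simp add: algebra_simps)
  finally show ?thesis using f by simp
qed

text \<open>In the mean, the linear term of the tilt contributes the covariance applied to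
  \<open>\<theta>\<close>, which cancels the recentring by \<open>\<theta>\<close>; the error is
  therefore quadratic in \<open>norm \<theta>\<close>. The bound for the covariance is only linear
  in \<open>norm \<theta>\<close>.\<close>

lemma approx_isotropic_tilted:
  assumes \<theta>: "norm \<theta> \<le> \<kappa> / 2" and \<theta>1: "norm \<theta> \<le> 1"
  shows "approx_isotropic (tilted \<theta>) ((norm \<theta>)\<^sup>2 * W') (norm \<theta> * (2 + 2 * W')) W'"
proof -
  define \<tau> where "\<tau> = norm \<theta>"
  have \<tau>: "0 \<le> \<tau>" "\<tau> \<le> 1" using \<theta>1 by (auto simp: \<tau>_def)
  have M1: "1 \<le> mgf \<theta>" by (rule mgf_ge_1[OF \<theta>])
  have nE: "0 \<le> E y" for y using E_ge_1[of y] by linarith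
  have ny: "norm (y - \<theta>) \<le> 1 + norm y" for y using norm_triangle_ineq4[of y \<theta>] \<theta>1 by linarith
  have coord: "\<bar>(y - \<theta>) \<bullet> i\<bar> \<le> 1 + norm y" if "i \<in> Basis" for i y
    using Basis_le_norm[OF that, of "y - \<theta>"] ny[of y] by linarith
  have ny1: "norm y \<le> 1 + norm y" for y :: 'a by simp
  have int1: "(\<integral>y. exp (\<theta> \<bullet> y) * ((y - \<theta>) \<bullet> i) \<partial>\<mu>) = (\<integral>y. (exp (\<theta> \<bullet> y) - 1 - \<theta> \<bullet> y) * ((y - \<theta>) \<bullet> i) \<partial>\<mu>) \<and>
      \<bar>\<integral>y. (exp (\<theta> \<bullet> y) - 1 - \<theta> \<bullet> y) * ((y - \<theta>) \<bullet> i) \<partial>\<mu>\<bar> \<le> \<tau>\<^sup>2 * W'" if i: "i \<in> Basis" for i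
  proof -
    have "\<bar>(exp (\<theta> \<bullet> y) - 1 - \<theta> \<bullet> y) * ((y - \<theta>) \<bullet> i)\<bar> \<le> \<tau>\<^sup>2 * ((1 + norm y) ^ 3 * E y)" for y
    proof -
      have "\<bar>(exp (\<theta> \<bullet> y) - 1 - \<theta> \<bullet> y) * ((y - \<theta>) \<bullet> i)\<bar> \<le> (\<tau> ^ 2 * (norm y ^ 2 * E y)) * (1 + norm y)"
        unfolding abs_mult \<tau>_def using nE[of y] by (intro mult_mono exp_remainders(2)[OF \<theta>] coord[OF i]) auto
      also have "\<dots> \<le> (\<tau> ^ 2 * ((1 + norm y) ^ 2 * E y)) * (1 + norm y)"
        using nE[of y] by (intro mult_right_mono mult_left_mono power_mono ny1) auto
      also have "\<dots> = \<tau>\<^sup>2 * ((1 + norm y) ^ 3 * E y)" by (simp add: power2_eq_square power3_eq_cube mult_ac)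
      finally show ?thesis .
    qed
    then have *: "integrable \<mu> (\<lambda>y. (exp (\<theta> \<bullet> y) - 1 - \<theta> \<bullet> y) * ((y - \<theta>) \<bullet> i)) \<and>
        \<bar>\<integral>y. (exp (\<theta> \<bullet> y) - 1 - \<theta> \<bullet> y) * ((y - \<theta>) \<bullet> i) \<partial>\<mu>\<bar> \<le> \<tau>\<^sup>2 * W'"
      by (intro dominated_cubic) auto
    \<comment> \<open>The inner product \<open>\<theta> \<bullet> i\<close> arises twice after
      integration, from the recentring and from the covariance, with opposite signs.\<close>
    have lin: "(\<lambda>y. (1 + \<theta> \<bullet> y) * ((y - \<theta>) \<bullet> i)) = (\<lambda>y. i \<bullet> y - \<theta> \<bullet> i + ((\<theta> \<bullet> y) * (i \<bullet> y) - (\<theta> \<bullet> i) * (\<theta> \<bullet> y)))"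
      by (intro ext) (simp add: inner_diff_left inner_commute algebra_simps)
    have ilin: "integrable \<mu> (\<lambda>y. (1 + \<theta> \<bullet> y) * ((y - \<theta>) \<bullet> i))"
      unfolding lin by (intro Bochner_Integration.integrable_add Bochner_Integration.integrable_diff integrable_const integrable_mult_right integrable_inner integrable_inner_mult)
    have "(\<integral>y. (1 + \<theta> \<bullet> y) * ((y - \<theta>) \<bullet> i) \<partial>\<mu>) = 0"
      unfolding lin by (simp add: integrable_inner integrable_inner_mult mean_inner cov_inner prob_space[simplified])
    moreover have "(\<lambda>y. exp (\<theta> \<bullet> y) * ((y - \<theta>) \<bullet> i)) = (\<lambda>y. (exp (\<theta> \<bullet> y) - 1 - \<theta> \<bullet> y) * ((y - \<theta>) \<bullet> i) + (1 + \<theta> \<bullet> y) * ((y - \<theta>) \<bullet> i))"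
      by (intro ext) (simp add: algebra_simps)
    ultimately show ?thesis using * ilin by simp
  qed
  have int2: "\<bar>(\<integral>y. exp (\<theta> \<bullet> y) * (((y - \<theta>) \<bullet> i) * ((y - \<theta>) \<bullet> j)) \<partial>\<mu>) - (if i = j then 1 else 0)\<bar> \<le> \<tau> * W' + \<tau>\<^sup>2" if ij: "i \<in> Basis" "j \<in> Basis" for i j
  proof -
    have "\<bar>(exp (\<theta> \<bullet> y) - 1) * (((y - \<theta>) \<bullet> i) * ((y - \<theta>) \<bullet> j))\<bar> \<le> \<tau> * ((1 + norm y) ^ 3 * E y)" for y
    proof -
      have "\<bar>(exp (\<theta> \<bullet> y) - 1) * (((y - \<theta>) \<bullet> i) * ((y - \<theta>) \<bullet> j))\<bar> \<le> (\<tau> * (norm y * E y)) * ((1 + norm y) * (1 + norm y))"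
        unfolding abs_mult \<tau>_def using nE[of y] by (intro mult_mono exp_remainders(1)[OF \<theta>] coord ij) auto
      also have "\<dots> \<le> (\<tau> * ((1 + norm y) * E y)) * ((1 + norm y) * (1 + norm y))"
        using nE[of y] \<tau> by (intro mult_right_mono mult_left_mono ny1) auto
      also have "\<dots> = \<tau> * ((1 + norm y) ^ 3 * E y)" by (simp add: power3_eq_cube mult_ac)
      finally show ?thesis .
    qed
    then have *: "integrable \<mu> (\<lambda>y. (exp (\<theta> \<bullet> y) - 1) * (((y - \<theta>) \<bullet> i) * ((y - \<theta>) \<bullet> j))) \<and>
        \<bar>\<integral>y. (exp (\<theta> \<bullet> y) - 1) * (((y - \<theta>) \<bullet> i) * ((y - \<theta>) \<bullet> j)) \<partial>\<mu>\<bar> \<le> \<tau> * W'"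
      using \<tau> by (intro dominated_cubic) auto
    have lin: "(\<lambda>y. ((y - \<theta>) \<bullet> i) * ((y - \<theta>) \<bullet> j)) = (\<lambda>y. (i \<bullet> y) * (j \<bullet> y) - ((\<theta> \<bullet> j) * (i \<bullet> y) + (\<theta> \<bullet> i) * (j \<bullet> y)) + (\<theta> \<bullet> i) * (\<theta> \<bullet> j))"
      by (intro ext) (simp add: inner_diff_left inner_commute algebra_simps)
    have ilin: "integrable \<mu> (\<lambda>y. ((y - \<theta>) \<bullet> i) * ((y - \<theta>) \<bullet> j))"
      unfolding lin by (intro Bochner_Integration.integrable_add Bochner_Integration.integrable_diff integrable_const integrable_mult_right integrable_inner integrable_inner_mult)
    have ilin2: "(\<integral>y. ((y - \<theta>) \<bullet> i) * ((y - \<theta>) \<bullet> j) \<partial>\<mu>) = (if i = j then 1 else 0) + (\<theta> \<bullet> i) * (\<theta> \<bullet> j)"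
      unfolding lin using ij by (simp add: integrable_inner integrable_inner_mult mean_inner cov_inner prob_space[simplified] inner_Basis)
    have e: "(\<lambda>y. exp (\<theta> \<bullet> y) * (((y - \<theta>) \<bullet> i) * ((y - \<theta>) \<bullet> j))) = (\<lambda>y. (exp (\<theta> \<bullet> y) - 1) * (((y - \<theta>) \<bullet> i) * ((y - \<theta>) \<bullet> j)) + ((y - \<theta>) \<bullet> i) * ((y - \<theta>) \<bullet> j))"
      by (intro ext) (simp add: algebra_simps)
    have "(\<integral>y. exp (\<theta> \<bullet> y) * (((y - \<theta>) \<bullet> i) * ((y - \<theta>) \<bullet> j)) \<partial>\<mu>) - (if i = j then 1 else 0)
        = (\<integral>y. (exp (\<theta> \<bullet> y) - 1) * (((y - \<theta>) \<bullet> i) * ((y - \<theta>) \<bullet> j)) \<partial>\<mu>) + (\<theta> \<bullet> i) * (\<theta> \<bullet> j)"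
      unfolding e using * ilin ilin2 by simp
    moreover have "\<bar>(\<theta> \<bullet> i) * (\<theta> \<bullet> j)\<bar> \<le> \<tau>\<^sup>2"
      unfolding abs_mult power2_eq_square \<tau>_def using ij by (intro mult_mono Basis_le_norm) auto
    ultimately show ?thesis using * by linarith
  qed
  have int3: "integrable \<mu> (\<lambda>y. exp (\<theta> \<bullet> y) * norm (y - \<theta>) ^ 3) \<and> \<bar>\<integral>y. exp (\<theta> \<bullet> y) * norm (y - \<theta>) ^ 3 \<partial>\<mu>\<bar> \<le> 1 * W'"
  proof (intro dominated_cubic)
    fix y
    have "exp (\<theta> \<bullet> y) \<le> E y" using exp_inner_le[OF \<theta>, of y] by (meson abs_ge_self exp_le_cancel_iff order_trans)
    then have "exp (\<theta> \<bullet> y) * norm (y - \<theta>) ^ 3 \<le> E y * (1 + norm y) ^ 3"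
      using nE[of y] by (intro mult_mono power_mono ny) auto
    then show "\<bar>exp (\<theta> \<bullet> y) * norm (y - \<theta>) ^ 3\<bar> \<le> 1 * ((1 + norm y) ^ 3 * E y)" by (simp add: abs_mult mult.commute)
  qed auto
  have div: "\<bar>a / mgf \<theta>\<bar> \<le> b" if "\<bar>a\<bar> \<le> b" for a b
  proof -
    have "\<bar>a\<bar> / mgf \<theta> \<le> \<bar>a\<bar> / 1" using M1 by (intro divide_left_mono) auto
    then show ?thesis using that M1 by (simp add: abs_divide)
  qed
  have W'0: "0 \<le> W'" "W 3 \<le> W'" using W_nonneg[of 0] W_nonneg[of 3] by (auto simp: W'_def)
  have \<tau>2: "\<tau>\<^sup>2 \<le> \<tau>" "\<tau> ^ 3 \<le> \<tau>" using \<tau> power_decreasing[of 1 2 \<tau>] power_decreasing[of 1 3 \<tau>] by auto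
  have Mm1: "mgf \<theta> - 1 \<le> \<tau> + \<tau> * W'"
  proof -
    have "mgf \<theta> - 1 \<le> \<tau>\<^sup>2 / 2 + \<tau> ^ 3 * W 3" using mgf_approx[OF \<theta>] unfolding \<tau>_def by linarith
    also have "\<dots> \<le> \<tau> + \<tau> * W'"
    proof (intro add_mono mult_mono)
      show "\<tau>\<^sup>2 / 2 \<le> \<tau>" using \<tau>2(1) \<tau>(1) by simp
    qed (use \<tau>2 W'0 W_nonneg \<tau> in auto)
    finally show ?thesis .
  qed
  show ?thesis unfolding approx_isotropic_def \<tau>_def[symmetric]
  proof (intro conjI ballI)
    show "borel_prob (tilted \<theta>)" by (rule borel_prob_tilted[OF \<theta>])
    show "integrable (tilted \<theta>) (\<lambda>w. norm w ^ 3)" using int3 by (intro integrable_tilted \<theta>) auto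
    show "(\<integral>w. norm w ^ 3 \<partial>tilted \<theta>) \<le> W'"
    proof -
      have "(\<integral>y. exp (\<theta> \<bullet> y) * norm (y - \<theta>) ^ 3 \<partial>\<mu>) / mgf \<theta> \<le> W'"
        using int3 by (intro order_trans[OF abs_ge_self div]) simp
      then show ?thesis by (simp add: integral_tilted[OF \<theta>])
    qed
  next
    fix i :: 'a assume i: "i \<in> Basis"
    show "\<bar>\<integral>w. w \<bullet> i \<partial>tilted \<theta>\<bar> \<le> \<tau>\<^sup>2 * W'"
    proof -
      have "\<bar>(\<integral>y. exp (\<theta> \<bullet> y) * ((y - \<theta>) \<bullet> i) \<partial>\<mu>) / mgf \<theta>\<bar> \<le> \<tau>\<^sup>2 * W'"
        by (rule div) (use int1[OF i] in simp)
      then show ?thesis by (simp add: integral_tilted[OF \<theta>])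
    qed
  next
    fix i j :: 'a assume ij: "i \<in> Basis" "j \<in> Basis"
    let ?d = "if i = j then 1 else 0 :: real"
    let ?I = "\<integral>y. exp (\<theta> \<bullet> y) * (((y - \<theta>) \<bullet> i) * ((y - \<theta>) \<bullet> j)) \<partial>\<mu>"
    \<comment> \<open>Separates the error of the unnormalized integral from that of the
      normalization, which matters only on the diagonal.\<close>
    have "?I / mgf \<theta> - ?d = (?I - ?d) / mgf \<theta> - ?d * (mgf \<theta> - 1) / mgf \<theta>"
      using M1 by (simp add: field_simps)
    also have "\<bar>\<dots>\<bar> \<le> \<bar>(?I - ?d) / mgf \<theta>\<bar> + \<bar>?d * (mgf \<theta> - 1) / mgf \<theta>\<bar>" by (rule abs_triangle_ineq4)
    also have "\<dots> \<le> (\<tau> * W' + \<tau>\<^sup>2) + (\<tau> + \<tau> * W')"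
      using M1 Mm1 W'0 \<tau> by (intro add_mono div int2 ij) auto
    also have "\<dots> \<le> \<tau> * (2 + 2 * W')" using \<tau>2 by (simp add: algebra_simps)
    finally show "\<bar>(\<integral>w. (w \<bullet> i) * (w \<bullet> j) \<partial>tilted \<theta>) - ?d\<bar> \<le> \<tau> * (2 + 2 * W')"
      by (subst integral_tilted[OF \<theta>]) auto
  qed
qed

lemma approx_isotropic_self: "approx_isotropic \<mu> 0 0 W'"
proof -
  have "integrable \<mu> (\<lambda>y. norm y ^ 3) \<and> \<bar>\<integral>y. norm y ^ 3 \<partial>\<mu>\<bar> \<le> 1 * W'"
  proof (intro dominated_cubic)
    fix y :: 'a
    have "norm y ^ 3 * 1 \<le> (1 + norm y) ^ 3 * E y" using E_ge_1[of y] by (intro mult_mono power_mono) auto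
    then show "\<bar>norm y ^ 3\<bar> \<le> 1 * ((1 + norm y) ^ 3 * E y)" by simp
  qed auto
  then show ?thesis unfolding approx_isotropic_def using mean cov borel_prob_axioms by auto
qed

text \<open>Each step releases one factor \<open>mgf \<theta>\<close>. As the tilted step is
  recentred, it also uses up one of the \<open>c\<close> drifts \<open>\<theta>\<close> subtracted
  inside \<open>J\<close>; starting with \<open>c = n\<close>, none is left after \<open>n\<close>
  steps.\<close>

lemma avg_op_tilt:
  assumes \<theta>: "norm \<theta> \<le> \<kappa> / 2" and J[measurable]: "J \<in> borel_measurable borel"
  shows "avg_op \<mu> 1 (\<lambda>x. exp (\<theta> \<bullet> x) * J (s *\<^sub>R (x - c *\<^sub>R \<theta>))) x
    = mgf \<theta> * (exp (\<theta> \<bullet> x) * avg_op (tilted \<theta>) s J (s *\<^sub>R (x - (c - 1) *\<^sub>R \<theta>)))"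
proof -
  have M: "mgf \<theta> \<noteq> 0" using mgf_ge_1[OF \<theta>] by linarith
  have "avg_op (tilted \<theta>) s J (s *\<^sub>R (x - (c - 1) *\<^sub>R \<theta>))
      = (\<integral>y. exp (\<theta> \<bullet> y) * J (s *\<^sub>R (x + y - c *\<^sub>R \<theta>)) \<partial>\<mu>) / mgf \<theta>"
    unfolding avg_op_def by (subst integral_tilted[OF \<theta>]) (auto simp: algebra_simps)
  then have "mgf \<theta> * (exp (\<theta> \<bullet> x) * avg_op (tilted \<theta>) s J (s *\<^sub>R (x - (c - 1) *\<^sub>R \<theta>)))
      = exp (\<theta> \<bullet> x) * (\<integral>y. exp (\<theta> \<bullet> y) * J (s *\<^sub>R (x + y - c *\<^sub>R \<theta>)) \<partial>\<mu>)"
    using M by simp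
  also have "\<dots> = avg_op \<mu> 1 (\<lambda>x. exp (\<theta> \<bullet> x) * J (s *\<^sub>R (x - c *\<^sub>R \<theta>))) x"
    unfolding avg_op_def by (simp add: inner_add_right exp_add mult.assoc)
  finally show ?thesis by simp
qed

lemma avg_op_pow_tilt:
  assumes \<theta>: "norm \<theta> \<le> \<kappa> / 2" and J: "bdd_borel J"
  shows "(avg_op \<mu> 1 ^^ m) (\<lambda>x. exp (\<theta> \<bullet> x) * J (s *\<^sub>R (x - c *\<^sub>R \<theta>))) x
    = mgf \<theta> ^ m * (exp (\<theta> \<bullet> x) * (avg_op (tilted \<theta>) s ^^ m) J (s *\<^sub>R (x - (c - real m) *\<^sub>R \<theta>)))"
proof (induction m arbitrary: x)
  case (Suc m)
  interpret t: borel_prob "tilted \<theta>" by (rule borel_prob_tilted[OF \<theta>])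
  have Jm: "(avg_op (tilted \<theta>) s ^^ m) J \<in> borel_measurable borel"
    using t.bdd_borel_avg_op_pow[OF J] by (simp add: bdd_borel_def)
  have "(avg_op \<mu> 1 ^^ Suc m) (\<lambda>x. exp (\<theta> \<bullet> x) * J (s *\<^sub>R (x - c *\<^sub>R \<theta>))) x
      = avg_op \<mu> 1 (\<lambda>x. mgf \<theta> ^ m * (exp (\<theta> \<bullet> x) * (avg_op (tilted \<theta>) s ^^ m) J (s *\<^sub>R (x - (c - real m) *\<^sub>R \<theta>)))) x"
  proof -
    have "(avg_op \<mu> 1 ^^ m) (\<lambda>x. exp (\<theta> \<bullet> x) * J (s *\<^sub>R (x - c *\<^sub>R \<theta>)))
      = (\<lambda>x. mgf \<theta> ^ m * (exp (\<theta> \<bullet> x) * (avg_op (tilted \<theta>) s ^^ m) J (s *\<^sub>R (x - (c - real m) *\<^sub>R \<theta>))))"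
      by (intro ext) (rule Suc)
    then show ?thesis by simp
  qed
  also have "\<dots> = mgf \<theta> ^ m * avg_op \<mu> 1 (\<lambda>x. exp (\<theta> \<bullet> x) * (avg_op (tilted \<theta>) s ^^ m) J (s *\<^sub>R (x - (c - real m) *\<^sub>R \<theta>))) x"
    unfolding avg_op_def[of \<mu>] by simp
  also have "\<dots> = mgf \<theta> ^ Suc m * (exp (\<theta> \<bullet> x) * (avg_op (tilted \<theta>) s ^^ Suc m) J (s *\<^sub>R (x - (c - real (Suc m)) *\<^sub>R \<theta>)))"
    unfolding avg_op_tilt[OF \<theta> Jm] by (simp add: diff_diff_eq add.commute mult_ac)
  finally show ?case .
qed simp

end

section \<open>Probabilities of dilated sets as integrals of the decay function\<close>

context standardized
begin

text \<open>With \<open>u = mgf \<theta> - 1\<close> one has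
  \<open>u - u\<^sup>2 \<le> ln (1 + u) \<le> u\<close>, and \<open>u\<close> is quadratic in
  \<open>norm \<theta>\<close>, so \<open>u\<^sup>2\<close> is of fourth order. The assumption
  \<open>small\<close> keeps \<open>u\<close> at most 1, where the lower bound is available.\<close>

lemma ln_mgf_approx:
  assumes \<theta>: "norm \<theta> \<le> \<kappa> / 2" and \<theta>1: "norm \<theta> \<le> 1" and small: "norm \<theta> * (1 + W 3) \<le> 1"
  shows "\<bar>ln (mgf \<theta>) - (norm \<theta>)\<^sup>2 / 2\<bar> \<le> norm \<theta> ^ 3 * ((1 + W 3)\<^sup>2 + W 3)"
proof -
  define \<tau> u where "\<tau> = norm \<theta>" and "u = mgf \<theta> - 1"
  have \<tau>: "0 \<le> \<tau>" "\<tau> \<le> 1" using \<theta>1 by (auto simp: \<tau>_def)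
  have u0: "0 \<le> u" using mgf_ge_1[OF \<theta>] by (simp add: u_def)
  have ua: "\<bar>u - \<tau>\<^sup>2 / 2\<bar> \<le> \<tau> ^ 3 * W 3" using mgf_approx[OF \<theta>] by (simp add: u_def \<tau>_def)
  have "\<tau> ^ 3 * W 3 \<le> \<tau>\<^sup>2 * W 3" using \<tau> W_nonneg by (intro mult_right_mono power_decreasing) auto
  then have "u \<le> \<tau>\<^sup>2 / 2 + \<tau>\<^sup>2 * W 3" using ua by linarith
  also have "\<dots> \<le> \<tau>\<^sup>2 * (1 + W 3)" by (simp add: distrib_left)
  finally have u1: "u \<le> \<tau>\<^sup>2 * (1 + W 3)" .
  also have "\<dots> = \<tau> * (\<tau> * (1 + W 3))" by (simp add: power2_eq_square)
  also have "\<dots> \<le> 1"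
  proof (rule mult_le_one)
    show "\<tau> * (1 + W 3) \<le> 1" using small by (simp add: \<tau>_def)
    show "0 \<le> \<tau> * (1 + W 3)" using \<tau> W_nonneg[of 3] by simp
  qed (rule \<tau>)
  finally have "u \<le> 1" .
  have l1: "ln (1 + u) \<le> u" using u0 by (rule ln_add_one_self_le_self)
  have l2: "u - u\<^sup>2 \<le> ln (1 + u)" using u0 \<open>u \<le> 1\<close> by (rule ln_one_plus_pos_lower_bound)
  have "u\<^sup>2 \<le> (\<tau>\<^sup>2 * (1 + W 3))\<^sup>2" using u0 u1 by (intro power_mono)
  also have "\<dots> = \<tau> ^ 4 * (1 + W 3)\<^sup>2" by (simp add: power_mult_distrib power2_eq_square power4_eq_xxxx mult_ac)
  also have "\<dots> \<le> \<tau> ^ 3 * (1 + W 3)\<^sup>2" using \<tau> by (intro mult_right_mono power_decreasing) auto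
  finally have u2: "u\<^sup>2 \<le> \<tau> ^ 3 * (1 + W 3)\<^sup>2" .
  have "\<bar>ln (1 + u) - \<tau>\<^sup>2 / 2\<bar> \<le> \<tau> ^ 3 * (1 + W 3)\<^sup>2 + \<tau> ^ 3 * W 3"
    using l1 l2 u2 ua by linarith
  then show ?thesis by (simp add: u_def \<tau>_def distrib_left)
qed

text \<open>\<open>decay D v x\<close> is what remains of the probability of the dilated set after the tilt that moves
  the mean to the dominating point, in coordinates centred there.\<close>

definition decay :: "'a set \<Rightarrow> 'a \<Rightarrow> real \<Rightarrow> 'a \<Rightarrow> real" where
  "decay D v x z = exp (- (x * (v \<bullet> z))) * indicator {z. v + (1 / x) *\<^sub>R z \<in> D} z"

lemma decay_measurable [measurable]:
  assumes [measurable]: "D \<in> sets borel"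
  shows "decay D v x \<in> borel_measurable borel"
  unfolding decay_def by measurable

lemma
  assumes v: "\<And>y. y \<in> D \<Longrightarrow> v \<bullet> v \<le> v \<bullet> y" and x: "0 < x"
  shows decay_nonneg: "0 \<le> decay D v x z" and decay_le_1: "decay D v x z \<le> 1"
proof -
  show "0 \<le> decay D v x z" unfolding decay_def by simp
  show "decay D v x z \<le> 1"
  proof (cases "v + (1 / x) *\<^sub>R z \<in> D")
    case True
    \<comment> \<open>The supporting half space of \<open>D\<close> makes the exponent of
      \<open>decay\<close> nonpositive.\<close>
    then have "0 \<le> (v \<bullet> z) / x" using v[OF True] by (simp add: inner_add_right)
    then have "0 \<le> x * (v \<bullet> z)" using x by (simp add: zero_le_divide_iff)
    then show ?thesis by (simp add: decay_def indicator_def)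
  qed (simp add: decay_def)
qed

text \<open>Taking logarithms, a positive level set is the dilated set cut by a half space. This
  makes the integral of \<open>decay\<close> accessible to bounds for convex sets.\<close>

lemma convex_decay_level:
  assumes D: "convex D" and x: "0 < x" and r: "0 < r"
  shows "convex {z. r \<le> decay D v x z}"
proof -
  have "{z. r \<le> decay D v x z} = {z. v + (1 / x) *\<^sub>R z \<in> D} \<inter> {z. (x *\<^sub>R v) \<bullet> z \<le> - ln r}"
  proof -
    have "r \<le> exp a \<longleftrightarrow> ln r \<le> a" for a
      using exp_le_cancel_iff[of "ln r" a] r by simp
    have "r \<le> decay D v x z \<longleftrightarrow> v + (1 / x) *\<^sub>R z \<in> D \<and> (x *\<^sub>R v) \<bullet> z \<le> - ln r" for z
    proof (cases "v + (1 / x) *\<^sub>R z \<in> D")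
      case True
      then have "decay D v x z = exp (- ((x *\<^sub>R v) \<bullet> z))" by (simp add: decay_def)
      then show ?thesis using True \<open>\<And>a. r \<le> exp a \<longleftrightarrow> ln r \<le> a\<close>[of "- ((x *\<^sub>R v) \<bullet> z)"] by linarith
    qed (use r in \<open>simp add: decay_def\<close>)
    then show ?thesis by blast
  qed
  moreover have "convex {z. v + (1 / x) *\<^sub>R z \<in> D}"
  proof (rule convexI)
    fix y z and a b :: real
    assume yz: "y \<in> {z. v + (1 / x) *\<^sub>R z \<in> D}" "z \<in> {z. v + (1 / x) *\<^sub>R z \<in> D}" and ab: "0 \<le> a" "0 \<le> b" "a + b = 1"
    have "a *\<^sub>R (v + (1 / x) *\<^sub>R y) + b *\<^sub>R (v + (1 / x) *\<^sub>R z) \<in> D"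
      using yz ab D by (intro convexD) auto
    also have "a *\<^sub>R (v + (1 / x) *\<^sub>R y) + b *\<^sub>R (v + (1 / x) *\<^sub>R z) = (a + b) *\<^sub>R v + (1 / x) *\<^sub>R (a *\<^sub>R y + b *\<^sub>R z)"
      by (simp add: algebra_simps)
    finally show "a *\<^sub>R y + b *\<^sub>R z \<in> {z. v + (1 / x) *\<^sub>R z \<in> D}" using ab(3) by simp
  qed
  ultimately show ?thesis by (simp only: convex_Int convex_halfspace_le)
qed

lemma mem_scaled_iff: "0 < c \<Longrightarrow> y \<in> (*\<^sub>R) c ` D \<longleftrightarrow> (1 / c) *\<^sub>R y \<in> D" for y :: 'a
  by (force simp: image_iff intro!: bexI[of _ "(1 / c) *\<^sub>R y"])

lemma borel_scaled: "0 < c \<Longrightarrow> D \<in> sets borel \<Longrightarrow> (*\<^sub>R) c ` D \<in> sets borel" for D :: "'a set"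
proof -
  assume "0 < c" and [measurable]: "D \<in> sets borel"
  then have "(*\<^sub>R) c ` D = {y. (1 / c) *\<^sub>R y \<in> D}" using mem_scaled_iff by blast
  also have "\<dots> \<in> sets borel" by measurable
  finally show ?thesis .
qed

text \<open>A Cameron--Martin shift by \<open>x *\<^sub>R v\<close>. The auxiliary \<open>f\<close>
  is the indicator divided by the tilting density, so that the shift formula can be read from right
  to left.\<close>

lemma measure_std_gauss_scaled:
  assumes [measurable]: "D \<in> sets borel" and x: "0 < x"
  shows "measure std_gauss ((*\<^sub>R) x ` D) = exp (- (x\<^sup>2 * (v \<bullet> v) / 2)) * (\<integral>z. decay D v x z \<partial>std_gauss)"
proof -
  let ?A = "{z. (1 / x) *\<^sub>R z \<in> D}"
  define f where "f z = exp (- (x * (v \<bullet> z)) + x\<^sup>2 * (v \<bullet> v) / 2) * indicator ?A z" for z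
  have nx: "(norm (x *\<^sub>R v))\<^sup>2 = x\<^sup>2 * (v \<bullet> v)" by (simp add: power_mult_distrib power2_norm_eq_inner)
  have [measurable]: "f \<in> borel_measurable borel" unfolding f_def by measurable
  have "(*\<^sub>R) x ` D = ?A" using mem_scaled_iff[OF x] by blast
  then have "measure std_gauss ((*\<^sub>R) x ` D) = (\<integral>z. indicator ?A z \<partial>std_gauss)" by simp
  also have "\<dots> = (\<integral>z. exp ((x *\<^sub>R v) \<bullet> z - (norm (x *\<^sub>R v))\<^sup>2 / 2) *\<^sub>R f z \<partial>std_gauss)"
    unfolding nx f_def by (intro Bochner_Integration.integral_cong) (auto simp: exp_add[symmetric] mult.assoc[symmetric])
  also have "\<dots> = (\<integral>z. f (z + x *\<^sub>R v) \<partial>std_gauss)" by (rule std_gauss_shift_integral[symmetric]) measurable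
  also have "\<dots> = (\<integral>z. exp (- (x\<^sup>2 * (v \<bullet> v) / 2)) * decay D v x z \<partial>std_gauss)"
  proof (intro Bochner_Integration.integral_cong refl)
    fix z
    have "(1 / x) *\<^sub>R (z + x *\<^sub>R v) = v + (1 / x) *\<^sub>R z" using x by (simp add: algebra_simps)
    moreover have "- (x * (v \<bullet> (z + x *\<^sub>R v))) + x\<^sup>2 * (v \<bullet> v) / 2 = - (x\<^sup>2 * (v \<bullet> v) / 2) + - (x * (v \<bullet> z))"
      by (simp add: inner_add_right power2_eq_square field_simps)
    ultimately show "f (z + x *\<^sub>R v) = exp (- (x\<^sup>2 * (v \<bullet> v) / 2)) * decay D v x z"
      unfolding f_def decay_def by (simp add: exp_add[symmetric] mult.assoc[symmetric] indicator_def)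
  qed
  also have "\<dots> = exp (- (x\<^sup>2 * (v \<bullet> v) / 2)) * (\<integral>z. decay D v x z \<partial>std_gauss)" by simp
  finally show ?thesis .
qed

text \<open>The tilt \<open>(c / n) v\<close> gives \<open>n\<close> steps the drift
  \<open>c v\<close>. At \<open>z = (y - c v) / sqrt n\<close> the exponent
  \<open>\<theta> \<bullet> y\<close> splits into \<open>x\<^sup>2 * (v \<bullet> v)\<close>, the
  constant factor, and \<open>x * (v \<bullet> z)\<close>, the exponent in
  \<open>decay\<close>.\<close>

lemma avg_op_pow_scaled:
  assumes D[measurable]: "D \<in> sets borel" and v: "\<And>y. y \<in> D \<Longrightarrow> v \<bullet> v \<le> v \<bullet> y"
    and c: "0 < c" and n: "0 < n" and small: "norm ((c / real n) *\<^sub>R v) \<le> \<kappa> / 2"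
  defines "x \<equiv> c / sqrt (real n)"
  shows "(avg_op \<mu> 1 ^^ n) (indicator ((*\<^sub>R) c ` D)) 0 =
    exp (- (x\<^sup>2 * (v \<bullet> v))) * (mgf ((c / real n) *\<^sub>R v) ^ n * (avg_op (tilted ((c / real n) *\<^sub>R v)) (1 / sqrt (real n)) ^^ n) (decay D v x) 0)"
proof -
  define \<theta> s where "\<theta> = (c / real n) *\<^sub>R v" and "s = 1 / sqrt (real n)"
  have x: "0 < x" using c n by (simp add: x_def)
  define J where "J z = exp (- (x\<^sup>2 * (v \<bullet> v))) * decay D v x z" for z
  have bJ': "bdd_borel J"
    using decay_nonneg[OF v x] decay_le_1[OF v x] unfolding bdd_borel_def J_def
    by (auto intro!: exI[of _ "exp (- (x\<^sup>2 * (v \<bullet> v)))"] simp: abs_mult mult_left_le)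
  have sn: "sqrt (real n) * sqrt (real n) = real n" by simp
  have "indicator ((*\<^sub>R) c ` D) = (\<lambda>y. exp (\<theta> \<bullet> y) * J (s *\<^sub>R (y - real n *\<^sub>R \<theta>)))"
  proof
    fix y
    have y: "s *\<^sub>R (y - real n *\<^sub>R \<theta>) = s *\<^sub>R y - x *\<^sub>R v"
      unfolding \<theta>_def s_def x_def using n by (simp add: scaleR_diff_right)
    have "s / x = 1 / c" using n c by (simp add: s_def x_def)
    then have "v + (1 / x) *\<^sub>R (s *\<^sub>R y - x *\<^sub>R v) = (1 / c) *\<^sub>R y" using x by (simp add: scaleR_diff_right)
    then have i: "indicator {z. v + (1 / x) *\<^sub>R z \<in> D} (s *\<^sub>R y - x *\<^sub>R v) = (indicator ((*\<^sub>R) c ` D) y :: real)"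
      using mem_scaled_iff[OF c, of y D] by (simp add: indicator_def)
    have "x * s = c / real n" using n sn by (simp add: x_def s_def)
    then have "\<theta> \<bullet> y + (- (x\<^sup>2 * (v \<bullet> v)) + - (x * (v \<bullet> (s *\<^sub>R y - x *\<^sub>R v)))) = 0"
      by (simp add: \<theta>_def inner_diff_right power2_eq_square algebra_simps) (simp add: mult.assoc[symmetric])
    then have "exp (\<theta> \<bullet> y) * (exp (- (x\<^sup>2 * (v \<bullet> v))) * exp (- (x * (v \<bullet> (s *\<^sub>R y - x *\<^sub>R v))))) = 1"
      unfolding exp_add[symmetric] by simp
    then show "indicator ((*\<^sub>R) c ` D) y = exp (\<theta> \<bullet> y) * J (s *\<^sub>R (y - real n *\<^sub>R \<theta>))"
      unfolding y J_def decay_def i by (simp add: mult.assoc[symmetric])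
  qed
  then have "(avg_op \<mu> 1 ^^ n) (indicator ((*\<^sub>R) c ` D)) 0 = mgf \<theta> ^ n * (avg_op (tilted \<theta>) s ^^ n) J 0"
    using avg_op_pow_tilt[OF small[folded \<theta>_def] bJ', of n s "real n" 0] by simp
  also have "(avg_op (tilted \<theta>) s ^^ n) J 0 = exp (- (x\<^sup>2 * (v \<bullet> v))) * (avg_op (tilted \<theta>) s ^^ n) (decay D v x) 0"
  proof -
    have "(avg_op (tilted \<theta>) s ^^ m) J = (\<lambda>z. exp (- (x\<^sup>2 * (v \<bullet> v))) * (avg_op (tilted \<theta>) s ^^ m) (decay D v x) z)" for m
      by (induction m) (simp_all add: J_def avg_op_def fun_eq_iff)
    then show ?thesis by simp
  qed
  finally show ?thesis by (simp add: \<theta>_def s_def mult_ac)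
qed

text \<open>For \<open>z\<close> in the slab, \<open>v + z / x\<close> has height
  \<open>s = \<sigma> z / x \<ge> 1 / x ^ 2\<close> above \<open>v\<close>. A slice there has radius
  at least \<open>\<beta> * sqrt s \<ge> \<beta> / x\<close>, that is \<open>\<beta>\<close> in the
  coordinate \<open>z\<close>, so the whole slab lies in the dilated set. On it
  \<open>x * (v \<bullet> z) \<le> 2 * (v \<bullet> x0)\<close>, and \<open>decay\<close> stays
  above a constant.\<close>

lemma integral_decay_ge:
  assumes D[measurable]: "D \<in> sets borel" and v: "\<And>y. y \<in> D \<Longrightarrow> v \<bullet> v \<le> v \<bullet> y"
    and vx: "0 < v \<bullet> x0" and \<beta>: "0 < \<beta>" and \<delta>: "0 < \<delta>"
    and slices: "\<And>y s. v \<bullet> y = 0 \<Longrightarrow> norm y \<le> \<beta> * sqrt s \<Longrightarrow> 0 < s \<Longrightarrow> s \<le> \<delta> \<Longrightarrow> v + (y + s *\<^sub>R x0) \<in> D"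
  shows "\<exists>c>0. \<exists>x1\<ge>1. \<forall>x\<ge>x1. c / x \<le> (\<integral>z. decay D v x z \<partial>std_gauss)"
proof -
  define \<sigma> where "\<sigma> z = (v \<bullet> z) / (v \<bullet> x0)" for z
  define S where "S x = {z. 1 / x \<le> \<sigma> z \<and> \<sigma> z \<le> 2 / x \<and> norm (z - \<sigma> z *\<^sub>R x0) \<le> \<beta>}" for x :: real
  obtain c where c: "0 < c" "\<And>x. 1 \<le> x \<Longrightarrow> c / x \<le> measure std_gauss (S x)"
    using measure_slice_ge[OF vx \<beta>] unfolding S_def \<sigma>_def by blast
  have [measurable]: "\<sigma> \<in> borel_measurable borel" unfolding \<sigma>_def by measurable
  have S[measurable]: "S x \<in> sets borel" for x unfolding S_def by measurable
  \<comment> \<open>Large enough that the heights occurring in the slab, at most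
    \<open>2 / x\<close>, do not exceed \<open>\<delta>\<close>.\<close>
  define x1 where "x1 = max 1 (2 / \<delta>)"
  have "exp (- (2 * (v \<bullet> x0))) * c / x \<le> (\<integral>z. decay D v x z \<partial>std_gauss)" if x1: "x1 \<le> x" for x
  proof -
    have x: "1 \<le> x" "2 / \<delta> \<le> x" "0 < x" using x1 by (auto simp: x1_def)
    have "exp (- (2 * (v \<bullet> x0))) * (c / x) \<le> exp (- (2 * (v \<bullet> x0))) * measure std_gauss (S x)"
      using c(2)[OF x(1)] by (intro mult_left_mono) auto
    also have "\<dots> = (\<integral>z. exp (- (2 * (v \<bullet> x0))) * indicator (S x) z \<partial>std_gauss)" by simp
    also have "\<dots> \<le> (\<integral>z. decay D v x z \<partial>std_gauss)"
    proof (rule integral_mono)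
      show "integrable std_gauss (\<lambda>z. exp (- (2 * (v \<bullet> x0))) * indicator (S x) z)"
        by (intro integrable_mult_right std_gauss.integrable_bdd_borel bdd_borel_indicator S)
      show "integrable std_gauss (decay D v x)"
        using decay_nonneg[OF v x(3)] decay_le_1[OF v x(3)]
        by (intro std_gauss.integrable_const_bound[where B=1]) auto
      fix z
      show "exp (- (2 * (v \<bullet> x0))) * indicator (S x) z \<le> decay D v x z"
      proof (cases "z \<in> S x")
        case True
        then have z: "1 / x \<le> \<sigma> z" "\<sigma> z \<le> 2 / x" "norm (z - \<sigma> z *\<^sub>R x0) \<le> \<beta>" by (auto simp: S_def)
        define y s where "y = (1 / x) *\<^sub>R (z - \<sigma> z *\<^sub>R x0)" and "s = \<sigma> z / x"
        have vy: "v \<bullet> y = 0" using vx by (simp add: y_def \<sigma>_def inner_diff_right)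
        have "(1 / x)\<^sup>2 \<le> s" using divide_right_mono[OF z(1), of x] x(3) by (simp add: s_def power2_eq_square)
        then have sq: "1 / x \<le> sqrt s" using x(3) by (simp add: real_le_rsqrt)
        have "norm y = norm (z - \<sigma> z *\<^sub>R x0) / x" using x(3) by (simp add: y_def)
        also have "\<dots> \<le> \<beta> * (1 / x)" using z(3) x(3) by (simp add: divide_right_mono)
        also have "\<dots> \<le> \<beta> * sqrt s" using sq \<beta> by (intro mult_left_mono) auto
        finally have ny: "norm y \<le> \<beta> * sqrt s" .
        have \<sigma>0: "0 < \<sigma> z" using z(1) x(3) by (meson divide_pos_pos less_le_trans zero_less_one)
        then have s0: "0 < s" using x(3) by (simp add: s_def)
        have "s \<le> \<sigma> z / 1" unfolding s_def using x \<sigma>0 by (intro divide_left_mono) auto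
        also have "\<dots> \<le> 2 / x" using z(2) by simp
        also have "\<dots> \<le> \<delta>" using x \<delta> by (simp add: field_simps)
        finally have s1: "s \<le> \<delta>" .
        have "v + (y + s *\<^sub>R x0) \<in> D" by (rule slices[OF vy ny s0 s1])
        also have "v + (y + s *\<^sub>R x0) = v + (1 / x) *\<^sub>R z" by (simp add: y_def s_def scaleR_diff_right)
        finally have mem: "v + (1 / x) *\<^sub>R z \<in> D" .
        have "x * (v \<bullet> z) = (x * \<sigma> z) * (v \<bullet> x0)" using vx by (simp add: \<sigma>_def)
        also have "\<dots> \<le> 2 * (v \<bullet> x0)" using z(2) x(3) vx by (intro mult_right_mono) (auto simp: field_simps)
        finally show ?thesis using True mem by (simp add: decay_def)
      qed (simp add: decay_def)
    qed
    finally show ?thesis by simp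
  qed
  moreover have "0 < exp (- (2 * (v \<bullet> x0))) * c" "1 \<le> x1" using c(1) by (auto simp: x1_def)
  ultimately show ?thesis by blast
qed

text \<open>The moment defects of the tilted law are fixed multiples of powers of
  \<open>norm \<theta>\<close>, so one constant serves all tilts, as it must when the tilt varies
  with \<open>n\<close>.\<close>

lemma decay_comparison:
  assumes D[measurable]: "D \<in> sets borel" and Dc: "convex D" and v: "\<And>y. y \<in> D \<Longrightarrow> v \<bullet> v \<le> v \<bullet> y"
  shows "\<exists>C\<ge>0. \<forall>\<theta> n q K x. norm \<theta> \<le> \<kappa> / 2 \<longrightarrow> norm \<theta> \<le> 1 \<longrightarrow> 0 < n \<longrightarrow> 0 < q \<longrightarrow> 0 < K \<longrightarrow> 0 < x \<longrightarrow>
    \<bar>(avg_op (tilted \<theta>) (1 / sqrt (real n)) ^^ n) (decay D v x) 0 - (\<integral>z. decay D v x z \<partial>std_gauss)\<bar>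
      \<le> C * ((norm \<theta>)\<^sup>2 * sqrt (real n) + norm \<theta> * (1 + ln (real n)) + 1 / sqrt (real q) + K * sqrt (real q / real n) + exp (- K))"
proof -
  obtain C where C: "C \<ge> 0" and be: "\<forall>\<nu> m1 m2 m3 n q K \<rho> A. approx_isotropic (\<nu> :: 'a measure) m1 m2 m3 \<longrightarrow> 0 < n \<longrightarrow> 0 < q \<longrightarrow> 0 < K \<longrightarrow>
     borel_prob \<rho> \<longrightarrow> (\<forall>f. bdd_borel f \<longrightarrow> (avg_op \<nu> (1 / sqrt (real n)) ^^ n) f 0 = (\<integral>w. f w \<partial>\<rho>)) \<longrightarrow>
     convex A \<longrightarrow> A \<in> sets borel \<longrightarrow>
     \<bar>measure \<rho> A - measure std_gauss A\<bar>
       \<le> C * (m1 * sqrt (real n) + m2 * (1 + ln (real n)) + (m3 + 1) / sqrt (real q) + K * sqrt (real q / real n) + exp (- K))"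
    using berry_esseen_convex by blast
  have W'0: "0 \<le> W'" using W_nonneg[of 0] W_nonneg[of 3] by (auto simp: W'_def)
  define C' where "C' = C * (2 + 2 * W')"
  have "\<bar>(avg_op (tilted \<theta>) (1 / sqrt (real n)) ^^ n) (decay D v x) 0 - (\<integral>z. decay D v x z \<partial>std_gauss)\<bar>
      \<le> C' * ((norm \<theta>)\<^sup>2 * sqrt (real n) + norm \<theta> * (1 + ln (real n)) + 1 / sqrt (real q) + K * sqrt (real q / real n) + exp (- K))"
    if \<theta>: "norm \<theta> \<le> \<kappa> / 2" "norm \<theta> \<le> 1" and n: "0 < n" and q: "0 < q" and K: "0 < K" and x: "0 < x" for \<theta> n q K x
  proof -
    note iso = approx_isotropic_tilted[OF \<theta>]
    obtain \<rho> where "borel_prob \<rho>" and \<rho>: "\<And>f x. bdd_borel f \<Longrightarrow> (avg_op (tilted \<theta>) (1 / sqrt (real n)) ^^ n) f x = (\<integral>w. f (x + w) \<partial>\<rho>)"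
      using avg_op_pow_measure[OF borel_prob_tilted[OF \<theta>(1)]] by blast
    have \<rho>0: "\<forall>f. bdd_borel f \<longrightarrow> (avg_op (tilted \<theta>) (1 / sqrt (real n)) ^^ n) f 0 = (\<integral>w. f w \<partial>\<rho>)"
      using \<rho>[of _ 0] by simp
    have bJ: "bdd_borel (decay D v x)"
      unfolding bdd_borel_def using decay_nonneg[OF v x] decay_le_1[OF v x] by (auto intro!: exI[of _ 1] simp: abs_le_iff order_trans[of _ 0 1])
    define \<Delta> where "\<Delta> = C * ((norm \<theta>)\<^sup>2 * W' * sqrt (real n) + norm \<theta> * (2 + 2 * W') * (1 + ln (real n)) + (W' + 1) / sqrt (real q) + K * sqrt (real q / real n) + exp (- K))"
    have "\<bar>(\<integral>z. decay D v x z \<partial>\<rho>) - (\<integral>z. decay D v x z \<partial>std_gauss)\<bar> \<le> \<Delta>"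
    proof (rule integral_diff_le_level_sets)
      fix r :: real assume r: "0 < r"
      have "{z. r \<le> decay D v x z} \<in> sets borel" by measurable
      then show "\<bar>measure \<rho> {z. r \<le> decay D v x z} - measure std_gauss {z. r \<le> decay D v x z}\<bar> \<le> \<Delta>"
        using be[rule_format, OF iso n q K \<open>borel_prob \<rho>\<close> \<rho>0[rule_format] convex_decay_level[OF Dc x r]] unfolding \<Delta>_def by blast
    qed (use \<open>borel_prob \<rho>\<close> decay_nonneg[OF v x] decay_le_1[OF v x] std_gauss.borel_prob_axioms in auto)
    also have "\<Delta> \<le> C * ((2 + 2 * W') * ((norm \<theta>)\<^sup>2 * sqrt (real n)) + (2 + 2 * W') * (norm \<theta> * (1 + ln (real n))) + (2 + 2 * W') * (1 / sqrt (real q))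
        + (2 + 2 * W') * (K * sqrt (real q / real n)) + (2 + 2 * W') * exp (- K))"
      unfolding \<Delta>_def
    proof (intro mult_left_mono add_mono)
      have le: "a \<le> (2 + 2 * W') * a" "W' * a \<le> (2 + 2 * W') * a" "(W' + 1) * a \<le> (2 + 2 * W') * a" if "0 \<le> a" for a
        using that W'0 mult_nonneg_nonneg[OF W'0 that] by (auto simp: distrib_right)
      show "(norm \<theta>)\<^sup>2 * W' * sqrt (real n) \<le> (2 + 2 * W') * ((norm \<theta>)\<^sup>2 * sqrt (real n))"
        using le(2)[of "(norm \<theta>)\<^sup>2 * sqrt (real n)"] by (simp add: mult_ac)
      show "(W' + 1) / sqrt (real q) \<le> (2 + 2 * W') * (1 / sqrt (real q))" using le(3)[of "1 / sqrt (real q)"] by simp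
      show "K * sqrt (real q / real n) \<le> (2 + 2 * W') * (K * sqrt (real q / real n))" using K by (intro le) auto
      show "exp (- K) \<le> (2 + 2 * W') * exp (- K)" by (intro le) auto
    qed (use C in auto)
    also have "\<dots> = C' * ((norm \<theta>)\<^sup>2 * sqrt (real n) + norm \<theta> * (1 + ln (real n)) + 1 / sqrt (real q) + K * sqrt (real q / real n) + exp (- K))"
    proof -
      have "C * (k * a1 + k * a2 + k * a3 + k * a4 + k * a5) = C * k * (a1 + a2 + a3 + a4 + a5)" for k a1 a2 a3 a4 a5
        by (simp add: algebra_simps)
      then show ?thesis unfolding C'_def by blast
    qed
    finally show ?thesis using \<rho>0 bJ by simp
  qed
  moreover have "0 \<le> C'" using C W'0 by (simp add: C'_def)
  ultimately show ?thesis by blast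
qed

end

text \<open>All rates are expressed through \<open>y = b / n powr (2/3)\<close>, the quantity known
  to vanish: the scale \<open>x\<close> is \<open>y\<close> times \<open>n powr (1/6)\<close>, the
  size of the tilt is \<open>y\<close> times \<open>n powr (-1/3)\<close>.\<close>

lemma powr_split:
  fixes b :: real
  assumes n: "0 < n"
  shows "b / sqrt (real n) = (b / real n powr (2/3)) * real n powr (1/6)"
    and "b / real n = (b / real n powr (2/3)) * real n powr (-1/3)"
proof -
  have n0: "0 < real n" using n by simp
  have "sqrt (real n) * real n powr (1/6) = real n powr (2/3)"
    unfolding powr_half_sqrt[OF order_less_imp_le[OF n0], symmetric] powr_add[symmetric] by simp
  then show "b / sqrt (real n) = (b / real n powr (2/3)) * real n powr (1/6)"
    using n0 by (simp add: field_simps)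
  have "real n * real n powr (-1/3) = real n powr 1 * real n powr (-1/3)" using n0 by simp
  also have "\<dots> = real n powr (2/3)" unfolding powr_add[symmetric] by simp
  finally show "b / real n = (b / real n powr (2/3)) * real n powr (-1/3)"
    using n0 by (simp add: field_simps)
qed

section \<open>Asymptotics of the ratio in standardized coordinates\<close>

context standardized
begin

lemma tilted_ratio_limit:
  assumes D: "open D" "convex D" and v: "\<And>y. y \<in> D \<Longrightarrow> v \<bullet> v \<le> v \<bullet> y"
    and vx: "0 < v \<bullet> x0" and \<beta>: "0 < \<beta>" and \<delta>: "0 < \<delta>"
    and slices: "\<And>y s. v \<bullet> y = 0 \<Longrightarrow> norm y \<le> \<beta> * sqrt s \<Longrightarrow> 0 < s \<Longrightarrow> s \<le> \<delta> \<Longrightarrow> v + (y + s *\<^sub>R x0) \<in> D"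
    and b: "\<And>n. n \<ge> 1 \<Longrightarrow> 0 < b n" and b1: "filterlim (\<lambda>n. b n / sqrt (real n)) at_top sequentially"
    and b2: "(\<lambda>n. b n / real n powr (2/3)) \<longlonglongrightarrow> 0"
  shows "(\<lambda>n. (avg_op \<mu> 1 ^^ n) (indicator ((*\<^sub>R) (b n) ` D)) 0
           / measure std_gauss ((*\<^sub>R) (real n powr (-1/2) * b n) ` D)) \<longlonglongrightarrow> 1"
proof -
  have Db: "D \<in> sets borel" using D(1) by auto
  define x where "x n = b n / sqrt (real n)" for n
  define t where "t n = b n / real n" for n
  define y where "y n = b n / real n powr (2/3)" for n
  define \<theta> where "\<theta> n = t n *\<^sub>R v" for n
  \<comment> \<open>Balances \<open>1 / sqrt q\<close> against \<open>sqrt (q / n)\<close>; both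
    become of order \<open>n powr (-1/4)\<close>.\<close>
  define q where "q n = nat \<lceil>sqrt (real n)\<rceil>" for n
  \<comment> \<open>Makes \<open>exp (- K)\<close> negligible, while \<open>K * sqrt (q / n)\<close>
    is of order \<open>n powr (-5/24)\<close> and so stays below
    \<open>n powr (-1/6)\<close>.\<close>
  define K where "K n = real n powr (1/24)" for n
  define I where "I n = (\<integral>z. decay D v (x n) z \<partial>std_gauss)" for n
  define A where "A n = (avg_op (tilted (\<theta> n)) (1 / sqrt (real n)) ^^ n) (decay D v (x n)) 0" for n
  define V where "V = norm v"
  have y0: "y \<longlonglongrightarrow> 0" using b2 by (simp add: y_def[abs_def])
  have xt: "x n = y n * real n powr (1/6)" "t n = y n * real n powr (-1/3)" if "0 < n" for n
    unfolding x_def t_def y_def using powr_split[OF that] by auto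
  have pos: "0 < x n" "0 < t n" "0 < y n" if "1 \<le> n" for n
    using b[OF that] that by (auto simp: x_def t_def y_def)
  have ev1: "eventually (\<lambda>n. 1 \<le> (n::nat)) sequentially" by (rule eventually_ge_at_top)
  have t0: "t \<longlonglongrightarrow> 0"
  proof -
    have "(\<lambda>n. real n powr (-1/3)) \<longlonglongrightarrow> 0" by real_asymp
    from tendsto_mult[OF y0 this] have "(\<lambda>n. y n * real n powr (-1/3)) \<longlonglongrightarrow> 0" by simp
    then show ?thesis
      by (rule Lim_transform_eventually) (use xt in \<open>auto intro!: eventually_mono[OF ev1]\<close>)
  qed
  have n\<theta>: "norm (\<theta> n) = t n * V" if "1 \<le> n" for n using pos[OF that] by (simp add: \<theta>_def V_def)
  have \<theta>0: "(\<lambda>n. norm (\<theta> n)) \<longlonglongrightarrow> 0"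
    unfolding \<theta>_def by (rule tendsto_norm_zero, rule tendsto_eq_rhs, rule tendsto_scaleR[OF t0 tendsto_const]) simp
  have small: "eventually (\<lambda>n. norm (\<theta> n) \<le> \<kappa> / 2 \<and> norm (\<theta> n) \<le> 1 \<and> norm (\<theta> n) * (1 + W 3) \<le> 1) sequentially"
  proof (intro eventually_conj)
    have "(\<lambda>n. norm (\<theta> n) * (1 + W 3)) \<longlonglongrightarrow> 0" using tendsto_mult_right[OF \<theta>0, of "1 + W 3"] by (simp add: mult.commute)
    from order_tendstoD(2)[OF this, of 1] show "eventually (\<lambda>n. norm (\<theta> n) * (1 + W 3) \<le> 1) sequentially"
      by (auto elim!: eventually_mono)
    show "eventually (\<lambda>n. norm (\<theta> n) \<le> \<kappa> / 2) sequentially"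
      using order_tendstoD(2)[OF \<theta>0, of "\<kappa> / 2"] \<kappa> by (auto elim!: eventually_mono)
    show "eventually (\<lambda>n. norm (\<theta> n) \<le> 1) sequentially"
      using order_tendstoD(2)[OF \<theta>0, of 1] by (auto elim!: eventually_mono)
  qed

  have mgf_lim: "(\<lambda>n. mgf (\<theta> n) ^ n * exp (- (x n)\<^sup>2 * (v \<bullet> v) / 2)) \<longlonglongrightarrow> 1"
  proof -
    define C where "C = V ^ 3 * ((1 + W 3)\<^sup>2 + W 3)"
    have bd: "eventually (\<lambda>n. \<bar>real n * (ln (mgf (\<theta> n)) - (norm (\<theta> n))\<^sup>2 / 2)\<bar> \<le> y n ^ 3 * C) sequentially"
      using small ev1
    proof eventually_elim
      case (elim n)
      \<comment> \<open>The \<open>n\<close> third-order errors of the cumulant generating function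
        add up to a multiple of \<open>y n ^ 3\<close>, with no power of \<open>n\<close> left
        over.\<close>
      have "(real n powr (-1/3)) ^ 3 = real n powr (-1)" unfolding power3_eq_cube powr_add[symmetric] by simp
      then have "real n * (real n powr (-1/3)) ^ 3 = 1" using elim(2) by (simp add: powr_minus)
      then have nt: "real n * t n ^ 3 = y n ^ 3" using xt(2)[of n] elim(2) by (simp add: power_mult_distrib mult_ac)
      have "\<bar>real n * (ln (mgf (\<theta> n)) - (norm (\<theta> n))\<^sup>2 / 2)\<bar> = real n * \<bar>ln (mgf (\<theta> n)) - (norm (\<theta> n))\<^sup>2 / 2\<bar>" by (simp add: abs_mult)
      also have "\<dots> \<le> real n * (norm (\<theta> n) ^ 3 * ((1 + W 3)\<^sup>2 + W 3))"
        using elim by (intro mult_left_mono ln_mgf_approx) auto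
      also have "\<dots> = (real n * t n ^ 3) * C" unfolding n\<theta>[OF elim(2)] C_def by (simp add: power_mult_distrib mult_ac)
      finally show ?case unfolding nt .
    qed
    have "(\<lambda>n. y n ^ 3 * C) \<longlonglongrightarrow> 0 ^ 3 * C" by (intro tendsto_intros y0)
    then have "(\<lambda>n. y n ^ 3 * C) \<longlonglongrightarrow> 0" by simp
    then have "(\<lambda>n. real n * (ln (mgf (\<theta> n)) - (norm (\<theta> n))\<^sup>2 / 2)) \<longlonglongrightarrow> 0"
      by (rule Lim_null_comparison[rotated]) (use bd in simp)
    then have "(\<lambda>n. exp (real n * (ln (mgf (\<theta> n)) - (norm (\<theta> n))\<^sup>2 / 2))) \<longlonglongrightarrow> exp 0" by (rule tendsto_exp)
    then have lim: "(\<lambda>n. exp (real n * (ln (mgf (\<theta> n)) - (norm (\<theta> n))\<^sup>2 / 2))) \<longlonglongrightarrow> 1" by simp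
    show ?thesis
    proof (rule Lim_transform_eventually[OF lim])
      show "eventually (\<lambda>n. exp (real n * (ln (mgf (\<theta> n)) - (norm (\<theta> n))\<^sup>2 / 2)) = mgf (\<theta> n) ^ n * exp (- (x n)\<^sup>2 * (v \<bullet> v) / 2)) sequentially"
        using small ev1
      proof eventually_elim
        case (elim n)
        have M: "0 < mgf (\<theta> n)" using mgf_ge_1[of "\<theta> n"] elim by linarith
        have "real n * (t n)\<^sup>2 = (x n)\<^sup>2" using elim(2) by (simp add: t_def x_def power_divide power2_eq_square)
        then have "real n * (norm (\<theta> n))\<^sup>2 = (x n)\<^sup>2 * (v \<bullet> v)"
          unfolding n\<theta>[OF elim(2)] V_def by (simp add: power_mult_distrib power2_norm_eq_inner mult.assoc[symmetric])
        then have "real n * (ln (mgf (\<theta> n)) - (norm (\<theta> n))\<^sup>2 / 2) = real n * ln (mgf (\<theta> n)) + (- (x n)\<^sup>2 * (v \<bullet> v) / 2)"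
          by (simp add: algebra_simps)
        then show ?case using M by (simp only: exp_add exp_of_nat_mult exp_ln)
      qed
    qed
  qed

  obtain c x1 where c: "0 < c" "1 \<le> x1" and Ige: "\<And>x. x1 \<le> x \<Longrightarrow> c / x \<le> (\<integral>z. decay D v x z \<partial>std_gauss)"
    using integral_decay_ge[OF Db v vx \<beta> \<delta> slices] by blast
  obtain C where C: "0 \<le> C" and comp: "\<And>\<theta> n q K x. norm \<theta> \<le> \<kappa> / 2 \<Longrightarrow> norm \<theta> \<le> 1 \<Longrightarrow> 0 < n \<Longrightarrow> 0 < q \<Longrightarrow> 0 < K \<Longrightarrow> 0 < x \<Longrightarrow>
    \<bar>(avg_op (tilted \<theta>) (1 / sqrt (real n)) ^^ n) (decay D v x) 0 - (\<integral>z. decay D v x z \<partial>std_gauss)\<bar>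
      \<le> C * ((norm \<theta>)\<^sup>2 * sqrt (real n) + norm \<theta> * (1 + ln (real n)) + 1 / sqrt (real q) + K * sqrt (real q / real n) + exp (- K))"
    using decay_comparison[OF Db D(2) v] by blast
  \<comment> \<open>The five error terms of the comparison, each multiplied by \<open>x n\<close>.
    The first, from the mean of the tilted law, carries no negative power of \<open>n\<close> and
    vanishes only because \<open>y n\<close> does.\<close>
  define e where "e n = y n ^ 3 * V\<^sup>2 + y n ^ 2 * V * (real n powr (-1/6) * (1 + ln (real n))) + y n * (real n powr (1/6) / real n powr (1/4))
    + y n * (real n powr (1/24) * real n powr (1/6) * sqrt ((sqrt (real n) + 1) / real n)) + y n * (real n powr (1/6) * exp (- (real n powr (1/24))))" for n
  have e0: "e \<longlonglongrightarrow> 0"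
  proof -
    have l: "(\<lambda>n. real n powr (-1/6) * (1 + ln (real n))) \<longlonglongrightarrow> 0" "(\<lambda>n. real n powr (1/6) / real n powr (1/4)) \<longlonglongrightarrow> 0"
      "(\<lambda>n. real n powr (1/24) * real n powr (1/6) * sqrt ((sqrt (real n) + 1) / real n)) \<longlonglongrightarrow> 0"
      "(\<lambda>n. real n powr (1/6) * exp (- (real n powr (1/24)))) \<longlonglongrightarrow> 0"
      by real_asymp+
    show ?thesis unfolding e_def[abs_def] by (rule tendsto_eq_intros y0 l refl | simp)+
  qed
  have est: "eventually (\<lambda>n. 0 < I n \<and> \<bar>A n / I n - 1\<bar> \<le> e n * (C / c)) sequentially"
  proof -
    have "eventually (\<lambda>n. x1 \<le> x n) sequentially" using b1 unfolding filterlim_at_top x_def by blast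
    with small ev1 show ?thesis
    proof eventually_elim
      case (elim n)
      have n: "0 < n" and n1: "1 \<le> n" using elim(2) by auto
      have rn: "0 < real n" "1 \<le> real n" using n1 by auto
      have xp: "0 < x n" "1 \<le> x n" using elim(3) c by auto
      have Ic: "c / x n \<le> I n" unfolding I_def by (rule Ige[OF elim(3)])
      then have I0: "0 < I n" using c xp by (meson divide_pos_pos less_le_trans)
      have qn: "sqrt (real n) \<le> real (q n)" "real (q n) \<le> sqrt (real n) + 1" "0 < q n"
      proof -
        have "0 < sqrt (real n)" using n by simp
        then have "0 < \<lceil>sqrt (real n)\<rceil>" by simp
        then show "sqrt (real n) \<le> real (q n)" "real (q n) \<le> sqrt (real n) + 1" "0 < q n"
          unfolding q_def by (auto simp: of_nat_nat)
      qed
      have Kp: "0 < K n" using n by (simp add: K_def)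
      define d where "d = (norm (\<theta> n))\<^sup>2 * sqrt (real n) + norm (\<theta> n) * (1 + ln (real n)) + 1 / sqrt (real (q n)) + K n * sqrt (real (q n) / real n) + exp (- K n)"
      have AI: "\<bar>A n - I n\<bar> \<le> C * d" unfolding A_def I_def d_def using elim n qn Kp xp by (intro comp) auto
      have y: "0 < y n" by (rule pos(3)[OF n1])
      have s6: "sqrt (real n) = real n powr (1/2)" using rn by (simp add: powr_half_sqrt)
      have "(real n powr (-1/3))\<^sup>2 * real n powr (1/2) * real n powr (1/6) = 1"
        unfolding power2_eq_square powr_add[symmetric] using rn by simp
      then have d1: "(norm (\<theta> n))\<^sup>2 * sqrt (real n) * x n = y n ^ 3 * V\<^sup>2"
        unfolding n\<theta>[OF n1] xt[OF n] s6 by (simp add: power_mult_distrib power2_eq_square power3_eq_cube mult_ac)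
      have "real n powr (-1/3) * real n powr (1/6) = real n powr (-1/6)"
        unfolding powr_add[symmetric] by simp
      then have d2: "norm (\<theta> n) * (1 + ln (real n)) * x n = y n ^ 2 * V * (real n powr (-1/6) * (1 + ln (real n)))"
        unfolding n\<theta>[OF n1] xt[OF n] by (simp add: power2_eq_square mult_ac)
      have "real n powr (1/4) = sqrt (sqrt (real n))" unfolding s6 using rn by (simp add: powr_half_sqrt[symmetric] powr_powr)
      also have "\<dots> \<le> sqrt (real (q n))" using qn(1) by simp
      finally have "real n powr (1/6) / sqrt (real (q n)) \<le> real n powr (1/6) / real n powr (1/4)"
        using rn by (intro divide_left_mono mult_pos_pos) (auto simp: qn)
      then have d3: "1 / sqrt (real (q n)) * x n \<le> y n * (real n powr (1/6) / real n powr (1/4))"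
        unfolding xt[OF n] using mult_left_mono[OF _ less_imp_le[OF y]] by fastforce
      have "sqrt (real (q n) / real n) \<le> sqrt ((sqrt (real n) + 1) / real n)"
        using qn(2) rn by (intro real_sqrt_le_mono divide_right_mono) auto
      then have "y n * (real n powr (1/24) * real n powr (1/6) * sqrt (real (q n) / real n)) \<le> y n * (real n powr (1/24) * real n powr (1/6) * sqrt ((sqrt (real n) + 1) / real n))"
        using y by (intro mult_left_mono) auto
      then have d4: "K n * sqrt (real (q n) / real n) * x n \<le> y n * (real n powr (1/24) * real n powr (1/6) * sqrt ((sqrt (real n) + 1) / real n))"
        unfolding xt[OF n] K_def by (simp add: mult_ac)
      have d5: "exp (- K n) * x n = y n * (real n powr (1/6) * exp (- (real n powr (1/24))))" unfolding xt[OF n] K_def by simp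
      have dx: "d * x n \<le> e n" unfolding d_def e_def distrib_right using d1 d2 d3 d4 d5 by linarith
      have d0: "0 \<le> d" unfolding d_def using rn Kp by (intro add_nonneg_nonneg) auto
      have "\<bar>A n / I n - 1\<bar> = \<bar>A n - I n\<bar> / I n" using I0 by (simp add: diff_divide_distrib[symmetric] abs_divide divide_diff_eq_iff)
      \<comment> \<open>The lower bound \<open>c / x n\<close> for \<open>I n\<close> turns the
        absolute error into a relative one at the price of a factor \<open>x n\<close>.\<close>
      also have "\<dots> \<le> (C * d) / (c / x n)" using AI Ic I0 c xp C d0 by (intro frac_le) auto
      also have "\<dots> = (d * x n) * (C / c)" using xp by simp
      also have "\<dots> \<le> e n * (C / c)" using dx C c by (intro mult_right_mono) auto
      finally show ?case using I0 by simp
    qed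
  qed
  have ratio: "(\<lambda>n. A n / I n) \<longlonglongrightarrow> 1"
  proof -
    have "(\<lambda>n. e n * (C / c)) \<longlonglongrightarrow> 0" using tendsto_mult_right[OF e0, of "C / c"] by (simp add: mult.commute)
    then have "(\<lambda>n. A n / I n - 1) \<longlonglongrightarrow> 0"
      by (rule Lim_null_comparison[rotated]) (use est in \<open>auto elim!: eventually_mono\<close>)
    then show ?thesis by (simp add: LIM_zero_iff)
  qed
  have "(\<lambda>n. mgf (\<theta> n) ^ n * exp (- (x n)\<^sup>2 * (v \<bullet> v) / 2) * (A n / I n)) \<longlonglongrightarrow> 1"
    using tendsto_mult[OF mgf_lim ratio] by simp
  then show ?thesis
  proof (rule Lim_transform_eventually)
    show "eventually (\<lambda>n. mgf (\<theta> n) ^ n * exp (- (x n)\<^sup>2 * (v \<bullet> v) / 2) * (A n / I n)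
        = (avg_op \<mu> 1 ^^ n) (indicator ((*\<^sub>R) (b n) ` D)) 0 / measure std_gauss ((*\<^sub>R) (real n powr (-1/2) * b n) ` D)) sequentially"
      using small ev1 est
    proof eventually_elim
      case (elim n)
      have n: "0 < n" using elim by simp
      have num: "(avg_op \<mu> 1 ^^ n) (indicator ((*\<^sub>R) (b n) ` D)) 0 = exp (- ((x n)\<^sup>2 * (v \<bullet> v))) * (mgf (\<theta> n) ^ n * A n)"
        unfolding x_def A_def \<theta>_def t_def using elim b n by (intro avg_op_pow_scaled Db v) (auto simp: \<theta>_def t_def)
      have "real n powr (-1/2) * b n = x n"
      proof -
        have "real n powr (-1/2) = real n powr (-(1/2))" by simp
        also have "\<dots> = 1 / real n powr (1/2)" by (rule powr_minus_divide)
        also have "\<dots> = 1 / sqrt (real n)" using n by (subst powr_half_sqrt) auto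
        finally show ?thesis by (simp add: x_def)
      qed
      then have den: "measure std_gauss ((*\<^sub>R) (real n powr (-1/2) * b n) ` D) = exp (- ((x n)\<^sup>2 * (v \<bullet> v) / 2)) * I n"
        unfolding I_def using pos[OF elim(2)] by (simp only: measure_std_gauss_scaled[OF Db])
      \<comment> \<open>One half of the exponent compensates the growth of
        \<open>mgf (\<theta> n) ^ n\<close>, the other half cancels against the Gaussian
        denominator.\<close>
      have "exp (- ((x n)\<^sup>2 * (v \<bullet> v))) = exp (- (x n)\<^sup>2 * (v \<bullet> v) / 2) * exp (- ((x n)\<^sup>2 * (v \<bullet> v) / 2))"
        unfolding exp_add[symmetric] by simp
      then show ?case unfolding num den by simp
    qed
  qed
qed

end

section \<open>Reduction to a standardized law\<close>

lemma (in prob_space) indep_var_vector_sum: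
  fixes Y :: "'i \<Rightarrow> 'a \<Rightarrow> 'b::euclidean_space"
  assumes I: "finite I" "i \<notin> I" and indep: "indep_vars (\<lambda>_. borel) Y (insert i I)"
  shows "indep_var borel (\<lambda>\<omega>. \<Sum>j\<in>I. Y j \<omega>) borel (Y i)"
proof -
  have "indep_var
    borel ((\<lambda>f. \<Sum>j\<in>I. f j) \<circ> (\<lambda>\<omega>. restrict (\<lambda>j. Y j \<omega>) I))
    borel ((\<lambda>f. f i) \<circ> (\<lambda>\<omega>. restrict (\<lambda>j. Y j \<omega>) {i}))"
    using I by (intro indep_var_compose[OF indep_var_restrict[OF indep]]) auto
  also have "((\<lambda>f. \<Sum>j\<in>I. f j) \<circ> (\<lambda>\<omega>. restrict (\<lambda>j. Y j \<omega>) I)) = (\<lambda>\<omega>. \<Sum>j\<in>I. Y j \<omega>)"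
    by (auto cong: rev_conj_cong)
  also have "((\<lambda>f. f i) \<circ> (\<lambda>\<omega>. restrict (\<lambda>j. Y j \<omega>) {i})) = Y i"
    by auto
  finally show ?thesis .
qed

text \<open>The induction absorbs the last step into the test function and therefore runs over all
  bounded Borel \<open>f\<close>. This is the bridge from random variables to averaging
  operators.\<close>

lemma (in prob_space) expectation_iid_sum:
  fixes Y :: "nat \<Rightarrow> 'a \<Rightarrow> 'b::euclidean_space"
  assumes indep: "indep_vars (\<lambda>_. borel) Y {1..}" and law: "\<And>j. 1 \<le> j \<Longrightarrow> distr M borel (Y j) = \<mu>"
    and f: "bdd_borel f"
  shows "expectation (\<lambda>\<omega>. f (x + (\<Sum>j=1..n. Y j \<omega>))) = (avg_op \<mu> 1 ^^ n) f x"
  using f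
proof (induction n arbitrary: f)
  case 0
  then show ?case by (simp add: prob_space)
next
  case (Suc n)
  have rv[measurable]: "random_variable borel (Y j)" if "1 \<le> j" for j
    using indep that by (auto simp: indep_vars_def)
  have [measurable]: "f \<in> borel_measurable borel" using Suc.prems by (simp add: bdd_borel_def)
  obtain B where B: "\<And>x. \<bar>f x\<bar> \<le> B" using Suc.prems by (auto simp: bdd_borel_def)
  let ?S = "\<lambda>\<omega>. \<Sum>j=1..n. Y j \<omega>"
  have S[measurable]: "random_variable borel ?S" by (intro borel_measurable_sum rv) auto
  have Y[measurable]: "random_variable borel (Y (Suc n))" by (rule rv) simp
  interpret S: prob_space "distr M borel ?S" by (rule prob_space_distr[OF S])
  have mu: "prob_space \<mu>" using prob_space_distr[OF Y] law[of "Suc n"] by simp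
  have smu[measurable_cong]: "sets \<mu> = sets borel" using law[of 1] by auto
  interpret \<mu>: borel_prob \<mu> using mu smu by (simp add: borel_prob_def borel_prob_axioms_def)
  interpret P: pair_prob_space "distr M borel ?S" \<mu> ..
  have "indep_var borel ?S borel (Y (Suc n))"
    by (intro indep_var_vector_sum indep_vars_subset[OF indep]) auto
  then have joint: "distr M borel ?S \<Otimes>\<^sub>M \<mu> = distr M (borel \<Otimes>\<^sub>M borel) (\<lambda>\<omega>. (?S \<omega>, Y (Suc n) \<omega>))"
    unfolding indep_var_distribution_eq using law[of "Suc n"] by simp
  have int: "integrable (distr M borel ?S \<Otimes>\<^sub>M \<mu>) (\<lambda>(s, y). f (x + s + y))"
    by (rule P.integrable_const_bound[where B=B]) (auto simp: B)
  have "expectation (\<lambda>\<omega>. f (x + (\<Sum>j=1..Suc n. Y j \<omega>))) = expectation (\<lambda>\<omega>. f (x + ?S \<omega> + Y (Suc n) \<omega>))"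
    by (simp add: add.assoc)
  also have "\<dots> = (\<integral>p. (\<lambda>(s, y). f (x + s + y)) p \<partial>(distr M borel ?S \<Otimes>\<^sub>M \<mu>))"
    unfolding joint by (subst integral_distr) auto
  also have "\<dots> = (\<integral>s. (\<integral>y. f (x + s + y) \<partial>\<mu>) \<partial>distr M borel ?S)"
    using P.integral_fst'[OF int] by simp
  also have "\<dots> = (\<integral>s. avg_op \<mu> 1 f (x + s) \<partial>distr M borel ?S)" by (simp add: avg_op_def)
  also have "\<dots> = expectation (\<lambda>\<omega>. avg_op \<mu> 1 f (x + ?S \<omega>))"
    using \<mu>.measurable_avg_op[of f 1] by (subst integral_distr) auto
  also have "\<dots> = (avg_op \<mu> 1 ^^ n) (avg_op \<mu> 1 f) x" by (rule Suc.IH[OF \<mu>.bdd_borel_avg_op[OF Suc.prems]])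
  also have "\<dots> = (avg_op \<mu> 1 ^^ Suc n) f x" by (simp add: funpow_swap1)
  finally show ?case .
qed

lemma avg_op_pow_Suc: "(avg_op \<rho> s ^^ Suc n) f x = (\<integral>w. (avg_op \<rho> s ^^ n) f (x + s *\<^sub>R w) \<partial>\<rho>)"
  by (simp add: avg_op_def[of \<rho> s "(avg_op \<rho> s ^^ n) f"])

lemma avg_op_pow_scale:
  "(avg_op \<mu> 1 ^^ n) (\<lambda>y. f (s *\<^sub>R y)) x = (avg_op \<mu> s ^^ n) f (s *\<^sub>R x)"
proof (induction n arbitrary: x)
  case (Suc n)
  then have "(avg_op \<mu> 1 ^^ n) (\<lambda>y. f (s *\<^sub>R y)) = (\<lambda>x. (avg_op \<mu> s ^^ n) f (s *\<^sub>R x))" by auto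
  then show ?case by (simp only: avg_op_pow_Suc scaleR_add_right scaleR_one)
qed simp

lemma avg_op_pow_linear:
  assumes \<mu>: "borel_prob \<mu>" and T: "linear T" and f: "bdd_borel f" and T': "T \<in> borel_measurable borel"
    and prob: "borel_prob (distr \<mu> borel T)"
  shows "(avg_op (distr \<mu> borel T) s ^^ n) f (T x) = (avg_op \<mu> s ^^ n) (f \<circ> T) x"
proof (induction n arbitrary: x)
  case (Suc n)
  interpret borel_prob \<mu> by fact
  interpret t: borel_prob "distr \<mu> borel T" by fact
  have [measurable]: "(avg_op (distr \<mu> borel T) s ^^ n) f \<in> borel_measurable borel"
    using t.bdd_borel_avg_op_pow[OF f] by (simp add: bdd_borel_def)
  have [measurable]: "T \<in> borel_measurable borel" by fact
  have "(avg_op (distr \<mu> borel T) s ^^ Suc n) f (T x) = (\<integral>w. (avg_op (distr \<mu> borel T) s ^^ n) f (T x + s *\<^sub>R T w) \<partial>\<mu>)"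
    unfolding avg_op_pow_Suc by (subst integral_distr) auto
  also have "\<dots> = (\<integral>w. (avg_op \<mu> s ^^ n) (f \<circ> T) (x + s *\<^sub>R w) \<partial>\<mu>)"
    unfolding Suc[symmetric] by (simp add: linear_add[OF T] linear_scale[OF T])
  finally show ?case by (simp only: avg_op_pow_Suc)
qed simp

text \<open>The threshold \<open>t_f\<close> may depend on the functional, but finitely many
  functionals control the norm. The extra factor 2 in \<open>\<kappa>\<close> keeps the exponent
  strictly below the smallest threshold of a basis vector.\<close>

lemma exp_norm_integrable:
  fixes X :: "'w \<Rightarrow> 'a::euclidean_space"
  assumes X[measurable]: "X \<in> borel_measurable M"
    and ex: "\<And>f. \<exists>t_f>0. \<forall>t. 0 < t \<and> t < t_f \<longrightarrow> integrable M (\<lambda>\<omega>. exp (t * \<bar>f \<bullet> X \<omega>\<bar>))"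
  shows "\<exists>\<kappa>>0. integrable M (\<lambda>\<omega>. exp (\<kappa> * norm (X \<omega>)))"
proof -
  obtain T where T: "\<And>f. 0 < T f" "\<And>f t. 0 < t \<Longrightarrow> t < T f \<Longrightarrow> integrable M (\<lambda>\<omega>. exp (t * \<bar>f \<bullet> X \<omega>\<bar>))"
    using ex by metis
  define \<kappa> where "\<kappa> = Min (T ` Basis) / (2 * DIM('a))"
  have m: "0 < Min (T ` Basis)" using T(1) by simp
  then have \<kappa>: "0 < \<kappa>" by (simp add: \<kappa>_def)
  have "integrable M (\<lambda>\<omega>. exp (\<kappa> * DIM('a) * \<bar>b \<bullet> X \<omega>\<bar>))" if "b \<in> Basis" for b
  proof (rule T(2))
    have "Min (T ` Basis) \<le> T b" using that by simp
    moreover have "\<kappa> * DIM('a) = Min (T ` Basis) / 2" by (simp add: \<kappa>_def)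
    ultimately show "\<kappa> * DIM('a) < T b" using m by linarith
  qed (use \<kappa> in simp)
  then have "integrable M (\<lambda>\<omega>. \<Sum>b\<in>Basis. exp (\<kappa> * DIM('a) * \<bar>b \<bullet> X \<omega>\<bar>))" by simp
  then have "integrable M (\<lambda>\<omega>. exp (\<kappa> * norm (X \<omega>)))"
    by (rule integrable_real_bound) (use exp_norm_le_sum[of \<kappa>] \<kappa> in auto)
  then show ?thesis using \<kappa> by blast
qed

section \<open>Mean and covariance forced by weak convergence\<close>

locale exp_moments = borel_prob \<mu> for \<mu> :: "'a::euclidean_space measure" +
  fixes \<kappa> :: real
  assumes \<kappa>_pos: "0 < \<kappa>" and exp_int: "integrable \<mu> (\<lambda>y. exp (\<kappa> * norm y))"
begin

lemma integrable_quadratic_exp: "integrable \<mu> (\<lambda>y. norm y ^ 2 * exp (\<kappa> / 2 * norm y))"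
proof -
  have "\<bar>norm y ^ 2 * exp (\<kappa> / 2 * norm y)\<bar> \<le> (4 / \<kappa>) ^ 2 * exp (\<kappa> * norm y)" for y :: 'a
  proof -
    have "(\<kappa> / 4 * norm y) ^ 2 \<le> exp (real 2 * (\<kappa> / 4 * norm y))" using \<kappa>_pos by (intro power_le_exp) simp
    then have "norm y ^ 2 \<le> (4 / \<kappa>) ^ 2 * exp (\<kappa> / 2 * norm y)"
      using \<kappa>_pos by (simp add: power_mult_distrib power_divide field_simps)
    then have "norm y ^ 2 * exp (\<kappa> / 2 * norm y) \<le> (4 / \<kappa>) ^ 2 * exp (\<kappa> / 2 * norm y) * exp (\<kappa> / 2 * norm y)"
      by (rule mult_right_mono) simp
    then show ?thesis by (simp add: mult.assoc exp_add[symmetric])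
  qed
  then show ?thesis by (intro integrable_real_bound[OF integrable_mult_right[OF exp_int]]) auto
qed

lemma integrable_square: "integrable \<mu> (\<lambda>y. norm y ^ 2)"
  using \<kappa>_pos by (intro integrable_real_bound[OF integrable_quadratic_exp]) (auto simp: mult_le_cancel_left1)

lemma integrable_linear: "integrable \<mu> (\<lambda>y. u \<bullet> y)"
proof (rule integrable_real_bound)
  show "integrable \<mu> (\<lambda>y. norm u * (1 + norm y ^ 2))"
    by (intro integrable_mult_right Bochner_Integration.integrable_add integrable_square integrable_const)
  fix y :: 'a
  have "norm y \<le> 1 + norm y ^ 2"
  proof -
    have "(norm y - 1)\<^sup>2 = norm y ^ 2 - 2 * norm y + 1" by (simp add: power2_diff)
    then show ?thesis using zero_le_power2[of "norm y - 1"] norm_ge_zero[of y] by linarith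
  qed
  from mult_left_mono[OF this norm_ge_zero[of u]] Cauchy_Schwarz_ineq2[of u y]
  show "\<bar>u \<bullet> y\<bar> \<le> norm u * (1 + norm y ^ 2)" by linarith
qed simp

lemma integrable_bilinear: "integrable \<mu> (\<lambda>y. (u \<bullet> y) * (w \<bullet> y))"
proof (rule integrable_real_bound)
  show "integrable \<mu> (\<lambda>y. (norm u * norm w) * norm y ^ 2)" by (intro integrable_mult_right integrable_square)
  fix y
  have "\<bar>(u \<bullet> y) * (w \<bullet> y)\<bar> \<le> (norm u * norm y) * (norm w * norm y)"
    unfolding abs_mult by (intro mult_mono Cauchy_Schwarz_ineq2) auto
  then show "\<bar>(u \<bullet> y) * (w \<bullet> y)\<bar> \<le> (norm u * norm w) * norm y ^ 2" by (simp add: power2_eq_square mult_ac)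
qed simp

text \<open>Exponentials are eigenfunctions of the averaging operator, so a pointwise bound is
  propagated through \<open>n\<close> steps. This is Chernoff's bound for the sum.\<close>

lemma avg_op_pow_le_exp:
  assumes f: "bdd_borel f" and le: "\<And>z. f z \<le> c * exp (w \<bullet> z)" and w: "integrable \<mu> (\<lambda>y. exp (w \<bullet> y))"
  shows "(avg_op \<mu> 1 ^^ n) f x \<le> c * (\<integral>y. exp (w \<bullet> y) \<partial>\<mu>) ^ n * exp (w \<bullet> x)"
proof (induction n arbitrary: x)
  case 0
  show ?case using le by simp
next
  case (Suc n)
  let ?g = "\<integral>y. exp (w \<bullet> y) \<partial>\<mu>"
  have "(avg_op \<mu> 1 ^^ Suc n) f x = (\<integral>y. (avg_op \<mu> 1 ^^ n) f (x + 1 *\<^sub>R y) \<partial>\<mu>)" by (simp add: avg_op_def)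
  also have "\<dots> \<le> (\<integral>y. (c * ?g ^ n * exp (w \<bullet> x)) * exp (w \<bullet> y) \<partial>\<mu>)"
  proof (rule integral_mono)
    show "integrable \<mu> (\<lambda>y. (avg_op \<mu> 1 ^^ n) f (x + 1 *\<^sub>R y))"
      by (intro integrable_bdd_borel bdd_borel_affine bdd_borel_avg_op_pow f)
    show "(avg_op \<mu> 1 ^^ n) f (x + 1 *\<^sub>R y) \<le> (c * ?g ^ n * exp (w \<bullet> x)) * exp (w \<bullet> y)" for y
      using Suc[of "x + y"] by (simp add: inner_add_right exp_add mult_ac)
  qed (intro integrable_mult_right w)
  also have "\<dots> = c * ?g ^ Suc n * exp (w \<bullet> x)" by simp
  finally show ?case .
qed

end

locale normalized_limit = exp_moments \<mu> \<kappa> + g: borel_prob \<gamma>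
  for \<mu> :: "'a::euclidean_space measure" and \<kappa> and \<gamma> :: "'a measure" +
  assumes weak: "\<And>\<phi>. continuous_on UNIV \<phi> \<Longrightarrow> (\<And>x. \<bar>\<phi> x\<bar> \<le> 1) \<Longrightarrow>
      (\<lambda>n. (avg_op \<mu> (1 / sqrt (real n)) ^^ n) \<phi> 0) \<longlonglongrightarrow> (\<integral>x. \<phi> x \<partial>\<gamma>)"
begin

text \<open>If the mean \<open>m\<close> of \<open>\<mu>\<close> were nonzero then \<open>E exp (- \<lambda> (m \<bullet> Y)) < 1\<close> for small \<open>\<lambda>\<close>, so by
  Chernoff's bound the normalized sums would leave every half space \<open>m \<bullet> x \<le> a\<close>.\<close>

lemma mean_zero: "(\<integral>y. u \<bullet> y \<partial>\<mu>) = 0"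
proof (rule ccontr)
  assume nz: "\<not> ?thesis"
  have "\<exists>m. 0 < (\<integral>y. m \<bullet> y \<partial>\<mu>)"
  proof (cases "0 < (\<integral>y. u \<bullet> y \<partial>\<mu>)")
    case False
    with nz have "0 < (\<integral>y. (- u) \<bullet> y \<partial>\<mu>)" by simp
    then show ?thesis by blast
  qed blast
  then obtain m where m: "0 < (\<integral>y. m \<bullet> y \<partial>\<mu>)" by blast
  define \<xi> where "\<xi> = (\<integral>y. m \<bullet> y \<partial>\<mu>)"
  have m0: "0 < norm m" using m by auto
  define R where "R y = norm y ^ 2 * exp (\<kappa> / 2 * norm y)" for y :: 'a
  have R: "integrable \<mu> R" unfolding R_def by (rule integrable_quadratic_exp)
  define Q where "Q = (\<integral>y. R y \<partial>\<mu>)"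
  have Q: "0 \<le> Q" unfolding Q_def R_def by (intro integral_nonneg_AE) auto
  \<comment> \<open>The first entry keeps the exponent within the exponential moments. The second
    makes the quadratic term at most half of the linear gain \<open>l * \<xi>\<close>; the added 1
    keeps its denominator positive.\<close>
  define l where "l = min (\<kappa> / (2 * norm m)) (\<xi> / (2 * ((norm m)\<^sup>2 * Q + 1)))"
  have den: "0 < (norm m)\<^sup>2 * Q + 1" using Q by (simp add: add_nonneg_pos)
  have l: "0 < l" using m m0 \<kappa>_pos den by (simp add: l_def \<xi>_def)
  have l1: "l * norm m \<le> \<kappa> / 2"
  proof -
    have "l * norm m \<le> \<kappa> / (2 * norm m) * norm m" by (intro mult_right_mono) (auto simp: l_def)
    then show ?thesis using m0 by simp
  qed
  have l2: "l * ((norm m)\<^sup>2 * Q + 1) \<le> \<xi> / 2"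
  proof -
    have "l * ((norm m)\<^sup>2 * Q + 1) \<le> \<xi> / (2 * ((norm m)\<^sup>2 * Q + 1)) * ((norm m)\<^sup>2 * Q + 1)"
      using den by (intro mult_right_mono) (auto simp: l_def)
    moreover have "\<xi> / (2 * c) * c = \<xi> / 2" if "0 < c" for c :: real using that by simp
    ultimately show ?thesis using den by metis
  qed
  define w where "w = - l *\<^sub>R m"
  have nw: "norm w = l * norm m" using l by (simp add: w_def)
  have pt: "exp (w \<bullet> y) \<le> 1 + w \<bullet> y + (norm w)\<^sup>2 * R y" for y
  proof -
    have a: "\<bar>w \<bullet> y\<bar> \<le> norm w * norm y" by (rule Cauchy_Schwarz_ineq2)
    also have "\<dots> \<le> \<kappa> / 2 * norm y" using l1 nw by (intro mult_right_mono) auto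
    finally have e: "exp \<bar>w \<bullet> y\<bar> \<le> exp (\<kappa> / 2 * norm y)" by simp
    have "(w \<bullet> y)\<^sup>2 \<le> (norm w * norm y)\<^sup>2" using power_mono[OF a abs_ge_zero, of 2] by simp
    then have "(w \<bullet> y)\<^sup>2 * exp \<bar>w \<bullet> y\<bar> \<le> (norm w * norm y)\<^sup>2 * exp (\<kappa> / 2 * norm y)"
      using e by (intro mult_mono) auto
    then show ?thesis using exp_taylor_bounds(2)[of "w \<bullet> y"] by (simp add: R_def power_mult_distrib mult.assoc)
  qed
  have ib: "integrable \<mu> (\<lambda>y. 1 + w \<bullet> y + (norm w)\<^sup>2 * R y)"
    by (intro Bochner_Integration.integrable_add integrable_const integrable_linear integrable_mult_right R)
  have iw: "integrable \<mu> (\<lambda>y. exp (w \<bullet> y))" by (rule integrable_real_bound[OF ib]) (use pt in auto)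
  define G where "G = (\<integral>y. exp (w \<bullet> y) \<partial>\<mu>)"
  have G0: "0 \<le> G" unfolding G_def by (intro integral_nonneg_AE) auto
  have "G \<le> (\<integral>y. 1 + w \<bullet> y + (norm w)\<^sup>2 * R y \<partial>\<mu>)"
    unfolding G_def by (intro integral_mono iw ib pt)
  also have "\<dots> = 1 - l * \<xi> + (norm w)\<^sup>2 * Q"
  proof -
    have "(\<integral>y. w \<bullet> y \<partial>\<mu>) = - l * \<xi>" by (simp add: w_def \<xi>_def)
    then show ?thesis by (simp add: integrable_linear R prob_space[simplified] Q_def)
  qed
  also have "\<dots> < 1"
  proof -
    have "(norm w)\<^sup>2 * Q = l * (l * ((norm m)\<^sup>2 * Q))" by (simp add: nw power_mult_distrib power2_eq_square mult_ac)
    also have "\<dots> \<le> l * (\<xi> / 2)"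
    proof (rule mult_left_mono)
      show "l * ((norm m)\<^sup>2 * Q) \<le> \<xi> / 2" using l2 l by (simp add: distrib_left)
    qed (use l in simp)
    finally have "(norm w)\<^sup>2 * Q \<le> l * \<xi> / 2" by simp
    moreover have "0 < l * \<xi>" using l m by (simp add: \<xi>_def)
    ultimately show ?thesis by linarith
  qed
  finally have G1: "G < 1" .
  \<comment> \<open>A continuous substitute for the indicator of the half space, positive exactly
    where \<open>m \<bullet> x < a\<close>.\<close>
  have zero: "(\<integral>x. min 1 (max 0 (a - m \<bullet> x)) \<partial>\<gamma>) = 0" for a
  proof -
    let ?\<phi> = "\<lambda>x. min 1 (max 0 (a - m \<bullet> x))"
    have cont: "continuous_on UNIV ?\<phi>" by (intro continuous_intros)
    have "(\<lambda>n. (avg_op \<mu> (1 / sqrt (real n)) ^^ n) ?\<phi> 0) \<longlonglongrightarrow> (\<integral>x. ?\<phi> x \<partial>\<gamma>)"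
      by (rule weak[OF cont]) auto
    moreover have "(\<lambda>n. (avg_op \<mu> (1 / sqrt (real n)) ^^ n) ?\<phi> 0) \<longlonglongrightarrow> 0"
    proof (rule Lim_null_comparison)
      show "eventually (\<lambda>n. norm ((avg_op \<mu> (1 / sqrt (real n)) ^^ n) ?\<phi> 0) \<le> exp (l * a * sqrt (real n)) * G ^ n) sequentially"
        using eventually_ge_at_top[of 1]
      proof eventually_elim
        case (elim n)
        define s where "s = 1 / sqrt (real n)"
        have s: "0 < s" using elim by (simp add: s_def)
        define f where "f y = ?\<phi> (s *\<^sub>R y)" for y
        have f: "bdd_borel f" unfolding bdd_borel_def f_def by (auto intro!: exI[of _ 1])
        have "f z \<le> exp (l * a / s) * exp (w \<bullet> z)" for z
        proof (cases "s * (m \<bullet> z) \<le> a")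
          case True
          then have "m \<bullet> z \<le> a / s" using s by (simp add: field_simps)
          then have "0 \<le> l * (a / s - m \<bullet> z)" using l by simp
          then have "1 \<le> exp (l * a / s + w \<bullet> z)" by (simp add: w_def right_diff_distrib)
          moreover have "f z \<le> 1" by (simp add: f_def)
          ultimately show ?thesis by (simp add: exp_add)
        qed (simp add: f_def)
        from avg_op_pow_le_exp[OF f this iw, of n 0]
        have "(avg_op \<mu> 1 ^^ n) f 0 \<le> exp (l * a * sqrt (real n)) * G ^ n" by (simp add: G_def s_def)
        also have "(avg_op \<mu> 1 ^^ n) f 0 = (avg_op \<mu> s ^^ n) ?\<phi> 0" unfolding f_def using avg_op_pow_scale[where n=n and \<mu>=\<mu> and f="?\<phi>" and s=s and x=0] by simp
        finally have up: "(avg_op \<mu> s ^^ n) ?\<phi> 0 \<le> exp (l * a * sqrt (real n)) * G ^ n" .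
        obtain \<rho> where "\<And>f x. bdd_borel f \<Longrightarrow> (avg_op \<mu> s ^^ n) f x = (\<integral>w. f (x + w) \<partial>\<rho>)"
          using avg_op_pow_measure[OF borel_prob_axioms, where s=s and n=n] by blast
        moreover have "bdd_borel ?\<phi>" unfolding bdd_borel_def by (auto intro!: exI[of _ 1])
        ultimately have "0 \<le> (avg_op \<mu> s ^^ n) ?\<phi> 0" by (auto intro!: integral_nonneg_AE)
        with up show ?case by (simp add: s_def)
      qed
      show "(\<lambda>n. exp (l * a * sqrt (real n)) * G ^ n) \<longlonglongrightarrow> 0"
      \<comment> \<open>Writing \<open>G ^ n\<close> through \<open>ln G\<close> requires
        \<open>G\<close> to be nonzero. Then the exponent is a multiple of \<open>sqrt n\<close>
        minus a positive multiple of \<open>n\<close>.\<close>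
      proof (cases "G = 0")
        case True
        have "eventually (\<lambda>n. 0 = exp (l * a * sqrt (real n)) * G ^ n) sequentially"
          using eventually_gt_at_top[of 0] by eventually_elim (simp add: True)
        with tendsto_const show ?thesis by (rule Lim_transform_eventually)
      next
        case False
        define h where "h = - ln G"
        have h: "0 < h" using False G0 G1 by (simp add: h_def)
        have "exp (l * a * sqrt (real n)) * G ^ n = exp (l * a * sqrt (real n) - h * real n)" for n
        proof -
          have "G ^ n = exp (real n * ln G)" using False G0 by (simp add: exp_of_nat_mult)
          then show ?thesis by (simp add: exp_add[symmetric] h_def mult.commute)
        qed
        moreover define la where "la = l * a"
        have "(\<lambda>n. exp (la * sqrt (real n) - h * real n)) \<longlonglongrightarrow> 0" using h by real_asymp
        ultimately show ?thesis by (simp add: la_def)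
      qed
    qed
    ultimately show ?thesis by (rule LIMSEQ_unique)
  qed
  have ae: "AE x in \<gamma>. a - m \<bullet> x \<le> 0" for a
  proof -
    have "bdd_borel (\<lambda>x. min 1 (max 0 (a - m \<bullet> x)))" unfolding bdd_borel_def by (auto intro!: exI[of _ 1])
    then have "AE x in \<gamma>. min 1 (max 0 (a - m \<bullet> x)) = 0"
      using zero[of a] by (subst (asm) integral_nonneg_eq_0_iff_AE) (auto intro: g.integrable_bdd_borel)
    then show ?thesis by (rule eventually_mono) (auto simp: min_def max_def split: if_splits)
  qed
  have "AE x in \<gamma>. \<forall>k::nat. real k - m \<bullet> x \<le> 0" using ae by (simp add: AE_all_countable)
  then have "AE x in \<gamma>. False"
  proof (rule eventually_mono)
    fix x assume x: "\<forall>k::nat. real k - m \<bullet> x \<le> 0"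
    obtain k :: nat where "m \<bullet> x < real k" using reals_Archimedean2 by blast
    then show False using x[rule_format, of k] by linarith
  qed
  then show False by simp
qed

text \<open>If the second moment in direction \<open>u\<close> were 0, every step would almost
  surely be orthogonal to \<open>u\<close>, hence so would the normalized sums, and the limit would
  be carried by a hyperplane. Its full support forbids this.\<close>

lemma cov_pos:
  assumes supp: "measure_support \<gamma> = UNIV" and u: "u \<noteq> 0"
  shows "0 < (\<integral>y. (u \<bullet> y) * (u \<bullet> y) \<partial>\<mu>)"
proof (rule ccontr)
  assume "\<not> ?thesis"
  moreover have "0 \<le> (\<integral>y. (u \<bullet> y) * (u \<bullet> y) \<partial>\<mu>)" by (intro integral_nonneg_AE) auto
  ultimately have "(\<integral>y. (u \<bullet> y) * (u \<bullet> y) \<partial>\<mu>) = 0" by linarith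
  then have ae: "AE y in \<mu>. u \<bullet> y = 0"
    by (subst (asm) integral_nonneg_eq_0_iff_AE) (auto simp: integrable_bilinear)
  let ?\<phi> = "\<lambda>x. min 1 \<bar>u \<bullet> x\<bar>"
  have "(avg_op \<mu> s ^^ n) ?\<phi> = ?\<phi>" for s n
  proof (induction n)
    case (Suc n)
    have "avg_op \<mu> s ?\<phi> x = ?\<phi> x" for x
    proof -
      have "avg_op \<mu> s ?\<phi> x = (\<integral>y. ?\<phi> x \<partial>\<mu>)"
        unfolding avg_op_def by (intro integral_cong_AE) (use ae in \<open>auto simp: inner_add_right elim!: eventually_mono\<close>)
      then show ?thesis by (simp add: prob_space[simplified])
    qed
    then have "avg_op \<mu> s ?\<phi> = ?\<phi>" by (intro ext)
    then show ?case using Suc by simp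
  qed simp
  moreover have "(\<lambda>n. (avg_op \<mu> (1 / sqrt (real n)) ^^ n) ?\<phi> 0) \<longlonglongrightarrow> (\<integral>x. ?\<phi> x \<partial>\<gamma>)"
    by (intro weak continuous_intros) auto
  ultimately have "(\<lambda>n::nat. 0) \<longlonglongrightarrow> (\<integral>x. ?\<phi> x \<partial>\<gamma>)" by simp
  then have "(\<integral>x. ?\<phi> x \<partial>\<gamma>) = 0" using LIMSEQ_unique[OF _ tendsto_const] by blast
  moreover have "bdd_borel ?\<phi>" unfolding bdd_borel_def by (auto intro!: exI[of _ 1])
  ultimately have ae\<gamma>: "AE x in \<gamma>. ?\<phi> x = 0"
    by (subst (asm) integral_nonneg_eq_0_iff_AE) (auto intro: g.integrable_bdd_borel)
  define U where "U = {x. u \<bullet> x \<noteq> 0}"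
  have "open U" unfolding U_def by (intro open_Collect_neq continuous_intros)
  moreover have "u \<in> U" using u by (simp add: U_def)
  ultimately have "0 < emeasure \<gamma> U" using supp unfolding measure_support_def by blast
  moreover have "AE x in \<gamma>. x \<notin> U" using ae\<gamma> by (rule eventually_mono) (auto simp: U_def min_def split: if_splits)
  then have "emeasure \<gamma> U = 0"
    by (subst (asm) AE_iff_measurable[of U]) (use \<open>open U\<close> in auto)
  ultimately show False by simp
qed

end

text \<open>Gram--Schmidt for the inner product \<open>B\<close>, by induction over subsets of the
  standard basis used as index set. A dimension count supplies a vector outside the span reached so
  far.\<close>

lemma exists_orthonormal_family:
  fixes B :: "'a::euclidean_space \<Rightarrow> 'a \<Rightarrow> real"
  assumes lin: "\<And>z. linear (\<lambda>x. B x z)" and sym: "\<And>x y. B x y = B y x" and pos: "\<And>x. x \<noteq> 0 \<Longrightarrow> 0 < B x x"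
  shows "\<exists>F. \<forall>i\<in>Basis. \<forall>j\<in>Basis. B (F i) (F j) = (if i = (j :: 'a) then 1 else 0)"
proof -
  have lin2: "linear (B z)" for z
  proof -
    have "(\<lambda>x. B x z) = B z" by (intro ext sym)
    then show ?thesis using lin[of z] by simp
  qed
  have "A \<subseteq> Basis \<longrightarrow> (\<exists>F. \<forall>i\<in>A. \<forall>j\<in>A. B (F i) (F j) = (if i = (j :: 'a) then 1 else 0))" if "finite A" for A
    using that
  proof induction
    case (insert k A)
    show ?case
    proof
      assume kA: "insert k A \<subseteq> Basis"
      then obtain F where F: "\<And>i j. i \<in> A \<Longrightarrow> j \<in> A \<Longrightarrow> B (F i) (F j) = (if i = j then 1 else 0)" using insert by blast
      have "card A < DIM('a)" using kA insert psubset_card_mono[of Basis A] by auto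
      moreover have "dim (span (F ` A)) \<le> card (F ` A)" using insert by (simp add: dim_le_card')
      ultimately have "span (F ` A) \<noteq> UNIV" using card_image_le[OF insert(1), of F] by (metis dim_UNIV dual_order.strict_trans2 leD)
      then obtain z where z: "z \<notin> span (F ` A)" by blast
      define w where "w = z - (\<Sum>i\<in>A. B z (F i) *\<^sub>R F i)"
      have "(\<Sum>i\<in>A. B z (F i) *\<^sub>R F i) \<in> span (F ` A)" by (intro span_sum span_scale span_base) auto
      then have "w \<noteq> 0" using z by (auto simp: w_def)
      then have ww: "0 < B w w" by (rule pos)
      have wF: "B w (F j) = 0" if "j \<in> A" for j
      proof -
        have "B (\<Sum>i\<in>A. B z (F i) *\<^sub>R F i) (F j) = (\<Sum>i\<in>A. B z (F i) * B (F i) (F j))"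
          using linear_sum[OF lin[of "F j"], of "\<lambda>i. B z (F i) *\<^sub>R F i" A] linear_scale[OF lin[of "F j"]] by simp
        also have "\<dots> = (\<Sum>i\<in>A. if i = j then B z (F j) else 0)" using F that by (intro sum.cong) auto
        also have "\<dots> = B z (F j)" using that insert(1) by simp
        finally show ?thesis unfolding w_def using linear_diff[OF lin[of "F j"]] by simp
      qed
      define F' where "F' = F(k := (1 / sqrt (B w w)) *\<^sub>R w)"
      have nk: "F' i = F i" if "i \<in> A" for i
        using insert(2) that by (auto simp: F'_def)
      have k: "F' k = (1 / sqrt (B w w)) *\<^sub>R w" by (simp add: F'_def)
      have "B (F' k) (F' k) = 1"
        unfolding k linear_scale[OF lin] linear_scale[OF lin2] using ww by simp
      moreover have "B (F' k) (F' i) = 0" "B (F' i) (F' k) = 0" if "i \<in> A" for i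
        using wF[OF that] sym unfolding k nk[OF that] by (simp_all add: linear_scale[OF lin] linear_scale[OF lin2])
      ultimately have "\<forall>i\<in>insert k A. \<forall>j\<in>insert k A. B (F' i) (F' j) = (if i = j then 1 else 0)"
        using F nk insert(2) by auto
      then show "\<exists>F. \<forall>i\<in>insert k A. \<forall>j\<in>insert k A. B (F i) (F j) = (if i = j then 1 else 0)" by blast
    qed
  qed simp
  then show ?thesis by simp
qed

text \<open>The rows of \<open>T\<close> are orthonormal for the covariance form, which is exactly
  the statement that the image law has identity covariance.\<close>

lemma (in normalized_limit) whitening:
  assumes supp: "measure_support \<gamma> = UNIV"
  shows "\<exists>(T :: 'a \<Rightarrow> 'a) \<kappa>'. linear T \<and> bij T \<and> standardized (distr \<mu> borel T) \<kappa>'"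
proof -
  define B where "B u w = (\<integral>y. (u \<bullet> y) * (w \<bullet> y) \<partial>\<mu>)" for u w
  have "linear (\<lambda>x. B x z)" for z
    by (intro linearI) (auto simp: B_def inner_add_left distrib_right integrable_bilinear mult.assoc)
  moreover have "B x y = B y x" for x y by (simp add: B_def mult.commute)
  moreover have "0 < B x x" if "x \<noteq> 0" for x unfolding B_def by (rule cov_pos[OF supp that])
  ultimately obtain F where F: "\<And>i j. i \<in> Basis \<Longrightarrow> j \<in> Basis \<Longrightarrow> B (F i) (F j) = (if i = (j::'a) then 1 else 0)"
    using exists_orthonormal_family[of B] by blast
  define T where "T x = (\<Sum>i\<in>Basis. (F i \<bullet> x) *\<^sub>R i)" for x
  have Ti: "T x \<bullet> i = F i \<bullet> x" if "i \<in> Basis" for x i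
    using that by (simp add: T_def inner_sum_left inner_Basis if_distrib cong: if_cong)
  have T: "linear T" by (intro linearI) (auto simp: T_def inner_add_right scaleR_add_left sum.distrib scaleR_sum_right)
  \<comment> \<open>The transpose of \<open>T\<close>. It is an isometry into the covariance form,
    hence injective and by dimension surjective, which makes \<open>T\<close> injective.\<close>
  define H where "H a = (\<Sum>i\<in>Basis. (a \<bullet> i) *\<^sub>R F i)" for a :: 'a
  have H: "linear H" by (intro linearI) (auto simp: H_def inner_add_left scaleR_add_left sum.distrib scaleR_sum_right)
  have linB: "linear (\<lambda>x. B x z)" "linear (B z)" for z
    by (intro linearI; auto simp: B_def inner_add_left distrib_right distrib_left integrable_bilinear mult_ac)+
  have "B (H a) (H a) = a \<bullet> a" for a
  proof -
    have "B (H a) (H a) = (\<Sum>i\<in>Basis. \<Sum>j\<in>Basis. (a \<bullet> i) * ((a \<bullet> j) * B (F j) (F i)))"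
      unfolding H_def linear_sum[OF linB(1)] linear_sum[OF linB(2)] linear_scale[OF linB(1)] linear_scale[OF linB(2)]
      by (simp add: sum_distrib_left)
    also have "\<dots> = (\<Sum>i\<in>Basis. \<Sum>j\<in>Basis. if j = i then (a \<bullet> i) * (a \<bullet> i) else 0)"
      using F by (intro sum.cong refl) auto
    also have "\<dots> = (\<Sum>i\<in>Basis. (a \<bullet> i) * (a \<bullet> i))" by (intro sum.cong refl) simp
    also have "\<dots> = a \<bullet> a" by (rule euclidean_inner[symmetric])
    finally show ?thesis .
  qed
  moreover have "B 0 0 = 0" by (simp add: B_def)
  ultimately have "inj H" using linear_injective_0[OF H] by (metis inner_eq_zero_iff)
  then have "surj H" using H linear_injective_imp_surjective by blast
  have HT: "x \<bullet> H a = a \<bullet> T x" for x a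
    unfolding H_def T_def by (simp add: inner_sum_right inner_commute mult.commute)
  have "inj T" unfolding linear_injective_0[OF T]
  proof (intro allI impI)
    fix x assume "T x = 0"
    obtain a where "x = H a" using \<open>surj H\<close> by blast
    then have "x \<bullet> x = 0" using HT[of x a] \<open>T x = 0\<close> by simp
    then show "x = 0" by simp
  qed
  then have bij: "bij T" using T linear_injective_imp_surjective by (auto simp: bij_def)
  have [measurable]: "T \<in> borel_measurable borel" using linear_continuous_on[of T UNIV] T
    by (simp add: borel_measurable_continuous_onI linear_conv_bounded_linear)
  have "prob_space (distr \<mu> borel T)" by (rule prob_space_distr) simp
  then have bp: "borel_prob (distr \<mu> borel T)" by (simp add: borel_prob_def borel_prob_axioms_def)
  obtain K where K: "0 < K" "\<And>x. norm (T x) \<le> K * norm x" using linear_bounded_pos[OF T] by (auto simp: mult.commute)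
  have "standardized (distr \<mu> borel T) (\<kappa> / K)"
    unfolding standardized_def standardized_axioms_def
  proof (intro conjI allI impI bp)
    show "0 < \<kappa> / K" using \<kappa>_pos K by simp
    have "\<kappa> / K * norm (T y) \<le> \<kappa> * norm y" for y
      using mult_left_mono[OF K(2)[of y], of "\<kappa> / K"] \<kappa>_pos K(1) by simp
    then have "integrable \<mu> (\<lambda>y. exp (\<kappa> / K * norm (T y)))"
      by (intro integrable_real_bound[OF exp_int]) auto
    then show "integrable (distr \<mu> borel T) (\<lambda>y. exp (\<kappa> / K * norm y))"
      by (subst integrable_distr_eq) auto
    fix i :: 'a assume i: "i \<in> Basis"
    show "(\<integral>y. y \<bullet> i \<partial>distr \<mu> borel T) = 0"
      by (subst integral_distr) (auto simp: Ti[OF i] mean_zero)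
    fix j :: 'a assume j: "j \<in> Basis"
    show "(\<integral>y. (y \<bullet> i) * (y \<bullet> j) \<partial>distr \<mu> borel T) = (if i = j then 1 else 0)"
      using F[OF i j] by (subst integral_distr) (auto simp: Ti[OF i] Ti[OF j] B_def)
  qed
  then show ?thesis using T bij by blast
qed

section \<open>Identification of the limit law\<close>

lemma std_gauss_smooth_lipschitz:
  fixes f :: "'a::euclidean_space \<Rightarrow> real"
  assumes f: "bdd_borel f" and L: "\<And>x y. \<bar>f x - f y\<bar> \<le> L * dist x y" and \<epsilon>: "0 \<le> \<epsilon>"
  shows "\<bar>avg_op std_gauss \<epsilon> f x - f x\<bar> \<le> L * \<epsilon> * (\<integral>z. norm (z::'a) \<partial>std_gauss)"
proof -
  have i1: "integrable std_gauss (\<lambda>z. f (x + \<epsilon> *\<^sub>R z))"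
    by (intro std_gauss.integrable_bdd_borel std_gauss.bdd_borel_affine f)
  have i2: "integrable std_gauss (\<lambda>z::'a. norm z)" using integrable_norm_power_std_gauss[of 1] by simp
  have "avg_op std_gauss \<epsilon> f x - f x = (\<integral>z. f (x + \<epsilon> *\<^sub>R z) - f x \<partial>std_gauss)"
    unfolding avg_op_def using i1 by (simp add: std_gauss.prob_space[simplified])
  also have "\<bar>\<dots>\<bar> \<le> (\<integral>z. \<bar>f (x + \<epsilon> *\<^sub>R z) - f x\<bar> \<partial>std_gauss)" by (rule integral_abs_bound)
  also have "\<dots> \<le> (\<integral>z. L * \<epsilon> * norm (z::'a) \<partial>std_gauss)"
  proof (rule integral_mono)
    fix z :: 'a
    show "\<bar>f (x + \<epsilon> *\<^sub>R z) - f x\<bar> \<le> L * \<epsilon> * norm z"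
      using L[of "x + \<epsilon> *\<^sub>R z" x] \<epsilon> by (simp add: dist_norm)
  qed (use i1 i2 in auto)
  finally show ?thesis by simp
qed

text \<open>Lindeberg replacement after smoothing \<open>f\<close> at scale
  \<open>sqrt (q / n)\<close>; the Lipschitz constant pays for the smoothing. With \<open>q\<close>
  about \<open>sqrt n\<close> the replacement error and the smoothing error both vanish.\<close>

lemma (in standardized) lipschitz_clt:
  assumes f: "f \<in> borel_measurable borel" "\<And>x. \<bar>f x\<bar> \<le> 1" and L: "\<And>x y. \<bar>f x - f y\<bar> \<le> L * dist x y"
  shows "(\<lambda>n. (avg_op \<mu> (1 / sqrt (real n)) ^^ n) f 0) \<longlonglongrightarrow> (\<integral>z. f z \<partial>std_gauss)"
proof -
  obtain C where C: "0 \<le> C" and lind: "\<forall>\<nu> m1 m2 m3 n q f x. approx_isotropic (\<nu> :: 'a measure) m1 m2 m3 \<longrightarrow> 0 < n \<longrightarrow> 0 < q \<longrightarrow>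
     f \<in> borel_measurable borel \<longrightarrow> (\<forall>y. \<bar>f y\<bar> \<le> 1) \<longrightarrow>
     \<bar>(avg_op \<nu> (1 / sqrt (real n)) ^^ n) (avg_op std_gauss (sqrt (real q / real n)) f) x
        - avg_op std_gauss 1 (avg_op std_gauss (sqrt (real q / real n)) f) x\<bar>
       \<le> C * (m1 * sqrt (real n) + m2 * (1 + ln (real n)) + (m3 + 1) / sqrt (real q))"
    using lindeberg by blast
  have bf: "bdd_borel f" using f by (auto simp: bdd_borel_def)
  define N where "N = (\<integral>z. norm (z::'a) \<partial>std_gauss)"
  have N: "0 \<le> N" unfolding N_def by (intro integral_nonneg_AE) auto
  obtain b :: 'a where b: "b \<in> Basis" using nonempty_Basis by blast
  have L0: "0 \<le> L" using L[of 0 b] b abs_ge_zero[of "f 0 - f b"] by simp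
  define q where "q n = nat \<lceil>sqrt (real n)\<rceil>" for n
  have bound: "\<bar>(avg_op \<mu> (1 / sqrt (real n)) ^^ n) f 0 - (\<integral>z. f z \<partial>std_gauss)\<bar>
      \<le> C * (W' + 1) / sqrt (sqrt (real n)) + 2 * L * N * sqrt ((sqrt (real n) + 1) / real n)" if n: "1 \<le> n" for n
  proof -
    define \<epsilon> where "\<epsilon> = sqrt (real (q n) / real n)"
    have \<epsilon>: "0 \<le> \<epsilon>" by (simp add: \<epsilon>_def)
    have "0 < sqrt (real n)" using n by simp
    then have c0: "0 < \<lceil>sqrt (real n)\<rceil>" by simp
    then have qn: "sqrt (real n) \<le> real (q n)" "real (q n) \<le> sqrt (real n) + 1" "0 < q n"
      unfolding q_def by (auto simp: of_nat_nat)
    define g where "g = avg_op std_gauss \<epsilon> f"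
    have bg: "bdd_borel g" unfolding g_def by (rule std_gauss.bdd_borel_avg_op[OF bf])
    have gf: "\<bar>g x - f x\<bar> \<le> L * \<epsilon> * N" for x unfolding g_def N_def by (rule std_gauss_smooth_lipschitz[OF bf L \<epsilon>])
    obtain \<rho> where "borel_prob \<rho>" and \<rho>: "\<And>f x. bdd_borel f \<Longrightarrow> (avg_op \<mu> (1 / sqrt (real n)) ^^ n) f x = (\<integral>w. f (x + w) \<partial>\<rho>)"
      using avg_op_pow_measure[OF borel_prob_axioms] by blast
    interpret \<rho>: borel_prob \<rho> by fact
    have "\<bar>(\<integral>w. g w \<partial>\<rho>) - (\<integral>w. f w \<partial>\<rho>)\<bar> \<le> L * \<epsilon> * N"
      using \<rho>.avg_op_diff_bound[OF bg bf gf, of 1 0] by (simp add: avg_op_def)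
    moreover have "\<bar>(\<integral>w. g w \<partial>std_gauss) - (\<integral>w. f w \<partial>std_gauss)\<bar> \<le> L * \<epsilon> * N"
      using std_gauss.avg_op_diff_bound[OF bg bf gf, of 1 0] by (simp add: avg_op_def)
    moreover have "\<bar>(\<integral>w. g w \<partial>\<rho>) - (\<integral>w. g w \<partial>std_gauss)\<bar> \<le> C * ((W' + 1) / sqrt (real (q n)))"
      using lind[rule_format, OF approx_isotropic_self _ qn(3) f, of n 0] n \<rho>[OF bg, of 0] unfolding g_def[symmetric] \<epsilon>_def[symmetric]
      by (simp add: avg_op_def[of std_gauss 1])
    ultimately have "\<bar>(\<integral>w. f w \<partial>\<rho>) - (\<integral>w. f w \<partial>std_gauss)\<bar> \<le> C * ((W' + 1) / sqrt (real (q n))) + 2 * L * N * \<epsilon>"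
      by (simp add: mult_ac)
    also have "\<dots> \<le> C * ((W' + 1) / sqrt (sqrt (real n))) + 2 * L * N * sqrt ((sqrt (real n) + 1) / real n)"
    proof (intro add_mono mult_left_mono)
      have "0 \<le> W'" using W_nonneg[of 0] W_nonneg[of 3] by (simp add: W'_def)
      then show "(W' + 1) / sqrt (real (q n)) \<le> (W' + 1) / sqrt (sqrt (real n))"
        using qn n by (intro divide_left_mono mult_pos_pos) auto
      show "\<epsilon> \<le> sqrt ((sqrt (real n) + 1) / real n)"
        unfolding \<epsilon>_def using qn(2) by (intro real_sqrt_le_mono divide_right_mono) auto
    qed (use C L0 N in auto)
    finally show ?thesis using \<rho>[OF bf, of 0] by simp
  qed
  have "(\<lambda>n. (avg_op \<mu> (1 / sqrt (real n)) ^^ n) f 0 - (\<integral>z. f z \<partial>std_gauss)) \<longlonglongrightarrow> 0"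
  proof (rule Lim_null_comparison)
    show "eventually (\<lambda>n. norm ((avg_op \<mu> (1 / sqrt (real n)) ^^ n) f 0 - (\<integral>z. f z \<partial>std_gauss))
        \<le> C * (W' + 1) / sqrt (sqrt (real n)) + 2 * L * N * sqrt ((sqrt (real n) + 1) / real n)) sequentially"
      using eventually_ge_at_top[of 1] by eventually_elim (use bound in simp)
    have "(\<lambda>n. c / sqrt (sqrt (real n)) + d * sqrt ((sqrt (real n) + 1) / real n)) \<longlonglongrightarrow> 0" for c d :: real
    proof -
      have "(\<lambda>n. 1 / sqrt (sqrt (real n))) \<longlonglongrightarrow> 0" "(\<lambda>n. sqrt ((sqrt (real n) + 1) / real n)) \<longlonglongrightarrow> 0" by real_asymp+
      from tendsto_add[OF tendsto_mult_left[OF this(1), of c] tendsto_mult_left[OF this(2), of d]] show ?thesis by simp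
    qed
    then show "(\<lambda>n. C * (W' + 1) / sqrt (sqrt (real n)) + 2 * L * N * sqrt ((sqrt (real n) + 1) / real n)) \<longlonglongrightarrow> 0" .
  qed
  then show ?thesis by (simp add: LIM_zero_iff)
qed

text \<open>The cut-offs \<open>max 0 (1 - k * infdist x C)\<close> are Lipschitz and converge
  boundedly to the indicator of a closed set \<open>C\<close>. By complements the measures agree on
  open sets, an intersection-stable generator.\<close>

lemma borel_prob_eqI_lipschitz:
  fixes \<mu> \<nu> :: "'a::euclidean_space measure"
  assumes "borel_prob \<mu>" "borel_prob \<nu>"
    and eq: "\<And>f L. (\<And>x. 0 \<le> f x \<and> f x \<le> (1::real)) \<Longrightarrow> (\<And>x y. \<bar>f x - f y\<bar> \<le> L * dist x y) \<Longrightarrow> (\<integral>x. f x \<partial>\<mu>) = (\<integral>x. f x \<partial>\<nu>)"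
  shows "\<mu> = \<nu>"
proof -
  interpret \<mu>: borel_prob \<mu> by fact
  interpret \<nu>: borel_prob \<nu> by fact
  have closed: "measure \<mu> C = measure \<nu> C" if C: "closed C" for C
  proof (cases "C = {}")
    case False
    define f where "f k x = max 0 (1 - real k * infdist x C)" for k :: nat and x
    have Cb[measurable]: "C \<in> sets borel" using C by auto
    have cont: "continuous_on UNIV (f k)" for k unfolding f_def by (intro continuous_intros)
    have [measurable]: "f k \<in> borel_measurable borel" for k by (rule borel_measurable_continuous_onI[OF cont])
    have f01: "0 \<le> f k x \<and> f k x \<le> 1" for k x unfolding f_def using infdist_nonneg[of x C] by auto
    have lip: "\<bar>f k x - f k y\<bar> \<le> real k * dist x y" for k x y
    proof -
      have "\<bar>f k x - f k y\<bar> \<le> \<bar>real k * infdist x C - real k * infdist y C\<bar>" unfolding f_def by linarith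
      also have "\<dots> = real k * \<bar>infdist x C - infdist y C\<bar>" by (simp add: abs_mult right_diff_distrib[symmetric])
      also have "\<dots> \<le> real k * dist x y" by (intro mult_left_mono infdist_triangle_abs) auto
      finally show ?thesis .
    qed
    have lim: "(\<lambda>k. f k x) \<longlonglongrightarrow> indicator C x" for x
    proof (cases "x \<in> C")
      case True
      then show ?thesis by (simp add: f_def)
    next
      case False
      then have "0 < infdist x C" using C \<open>C \<noteq> {}\<close> in_closed_iff_infdist_zero infdist_nonneg[of x C] by (metis less_le)
      then obtain k0 :: nat where k0: "1 < real k0 * infdist x C" using ex_less_of_nat_mult by blast
      have "eventually (\<lambda>k. 0 = f k x) sequentially" using eventually_ge_at_top[of k0]
      proof eventually_elim
        case (elim k)
        have "real k0 * infdist x C \<le> real k * infdist x C" using elim by (intro mult_right_mono infdist_nonneg) auto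
        then show ?case using k0 by (simp add: f_def)
      qed
      then show ?thesis using False by (auto intro: Lim_transform_eventually[OF tendsto_const])
    qed
    have conv: "(\<lambda>k. \<integral>x. f k x \<partial>\<rho>) \<longlonglongrightarrow> measure \<rho> C" if "borel_prob \<rho>" for \<rho>
    proof -
      interpret borel_prob \<rho> by fact
      have "(\<lambda>k. \<integral>x. f k x \<partial>\<rho>) \<longlonglongrightarrow> (\<integral>x. indicator C x \<partial>\<rho>)"
        by (rule integral_dominated_convergence[where w="\<lambda>_. 1"]) (use lim f01 in auto)
      then show ?thesis by simp
    qed
    have "(\<integral>x. f k x \<partial>\<mu>) = (\<integral>x. f k x \<partial>\<nu>)" for k by (rule eq[OF f01 lip])
    then show ?thesis using conv[OF assms(1)] conv[OF assms(2)] by (simp add: LIMSEQ_unique)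
  qed simp
  show ?thesis
  proof (rule measure_eqI_generator_eq[where E="{S. open S}" and \<Omega>=UNIV and A="\<lambda>_. UNIV"])
    fix S :: "'a set" assume "S \<in> {S. open S}"
    then have S: "open S" by simp
    then have "measure \<mu> (- S) = measure \<nu> (- S)" by (intro closed) auto
    then have "1 - measure \<mu> S = 1 - measure \<nu> S"
      using \<mu>.prob_compl[of S] \<nu>.prob_compl[of S] S by (auto simp: Compl_eq_Diff_UNIV)
    then show "emeasure \<mu> S = emeasure \<nu> S" by (simp add: \<mu>.emeasure_eq_measure \<nu>.emeasure_eq_measure)
  qed (auto simp: Int_stable_def borel_def)
qed

text \<open>For Lipschitz \<open>f\<close> the same sequence of averages converges once by weak
  convergence, tested on \<open>f \<circ> T\<close>, and once by the central limit theorem for the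
  image law. Uniqueness of limits identifies the two integrals.\<close>

lemma (in normalized_limit) distr_limit_eq_std_gauss:
  fixes T :: "'a \<Rightarrow> 'a"
  assumes T: "linear T" and std: "standardized (distr \<mu> borel T) \<kappa>'"
  shows "distr \<gamma> borel T = std_gauss"
proof (rule borel_prob_eqI_lipschitz)
  interpret s: standardized "distr \<mu> borel T" \<kappa>' by fact
  have [measurable]: "T \<in> borel_measurable borel" using linear_continuous_on[of T UNIV] T
    by (simp add: borel_measurable_continuous_onI linear_conv_bounded_linear)
  have "prob_space (distr \<gamma> borel T)" by (rule g.prob_space_distr) simp
  then show "borel_prob (distr \<gamma> borel T)" by (simp add: borel_prob_def borel_prob_axioms_def)
  show "borel_prob std_gauss" by (rule std_gauss.borel_prob_axioms)
  fix f :: "'a \<Rightarrow> real" and L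
  assume f01: "\<And>x. 0 \<le> f x \<and> f x \<le> 1" and lip: "\<And>x y. \<bar>f x - f y\<bar> \<le> L * dist x y"
  have "L-lipschitz_on UNIV f" if "0 \<le> L" using lip that by (intro lipschitz_onI) (auto simp: dist_norm)
  moreover obtain b :: 'a where b: "b \<in> Basis" using nonempty_Basis by blast
  then have "0 \<le> L" using lip[of 0 b] abs_ge_zero[of "f 0 - f b"] by simp
  ultimately have cont: "continuous_on UNIV f" using lipschitz_on_continuous_on by blast
  have [measurable]: "f \<in> borel_measurable borel" by (rule borel_measurable_continuous_onI[OF cont])
  have f1: "\<bar>f x\<bar> \<le> 1" for x using f01[of x] by auto
  have bf: "bdd_borel f" using f1 by (auto simp: bdd_borel_def)
  have "continuous_on UNIV (f \<circ> T)"
    using cont T by (intro continuous_on_compose) (auto simp: linear_conv_bounded_linear linear_continuous_on intro: continuous_on_subset)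
  then have "(\<lambda>n. (avg_op \<mu> (1 / sqrt (real n)) ^^ n) (f \<circ> T) 0) \<longlonglongrightarrow> (\<integral>x. (f \<circ> T) x \<partial>\<gamma>)"
    by (rule weak) (use f1 in auto)
  also have "(\<lambda>n. (avg_op \<mu> (1 / sqrt (real n)) ^^ n) (f \<circ> T) 0) = (\<lambda>n. (avg_op (distr \<mu> borel T) (1 / sqrt (real n)) ^^ n) f 0)"
    using avg_op_pow_linear[OF borel_prob_axioms T bf _ s.borel_prob_axioms, of _ _ 0] linear_0[OF T] by (simp add: fun_eq_iff)
  finally have "(\<integral>x. (f \<circ> T) x \<partial>\<gamma>) = (\<integral>x. f x \<partial>std_gauss)"
    using s.lipschitz_clt[OF _ f1 lip] by (simp add: LIMSEQ_unique)
  then show "(\<integral>x. f x \<partial>distr \<gamma> borel T) = (\<integral>x. f x \<partial>std_gauss)"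
    by (subst integral_distr) (auto simp: comp_def)
qed

text \<open>In the coordinates \<open>T\<close> the functional is
  \<open>z \<mapsto> w \<bullet> z\<close>, its Laplace transform is
  \<open>exp ((norm w)\<^sup>2 / 2)\<close>, and the standard Gaussian measure tilted by it has mean
  \<open>w\<close>. The mean formula for the dominating point therefore reads
  \<open>T a = w\<close>.\<close>

lemma dominating_point_image:
  fixes \<gamma> :: "'a::euclidean_space measure" and T :: "'a \<Rightarrow> 'a" and g :: "'a \<Rightarrow>\<^sub>L real"
  assumes T: "linear T" "bij T" and \<gamma>: "sets \<gamma> = sets borel" "distr \<gamma> borel T = std_gauss"
    and a: "a = (\<integral>x. exp (blinfun_apply g x - ln (laplace \<gamma> g)) *\<^sub>R x \<partial>\<gamma>)"
  shows "blinfun_apply g x = T a \<bullet> T x"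
proof -
  define T' where "T' = inv T"
  have T': "linear T'" unfolding T'_def using T by (intro inj_linear_imp_inv_linear bij_is_inj)
  have TT': "T (T' z) = z" "T' (T z) = z" for z
    using T(2) by (auto simp: T'_def bij_is_surj surj_f_inv_f bij_is_inj)
  have bT': "bounded_linear T'" using T' by (simp add: linear_conv_bounded_linear)
  have meas[measurable]: "T \<in> borel_measurable borel" "T' \<in> borel_measurable borel"
    using T(1) T' by (auto simp: borel_measurable_continuous_onI linear_continuous_on linear_conv_bounded_linear)
  have \<gamma>eq: "\<gamma> = distr std_gauss borel T'"
  proof -
    have "distr std_gauss borel T' = distr \<gamma> borel (T' \<circ> T)"
      unfolding \<gamma>(2)[symmetric] by (subst distr_distr) (auto simp: measurable_cong_sets[OF \<gamma>(1) refl])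
    also have "T' \<circ> T = (\<lambda>x. x)" by (simp add: fun_eq_iff TT')
    also have "distr \<gamma> borel (\<lambda>x. x) = \<gamma>" using \<gamma>(1) by (intro distr_id2) simp
    finally show ?thesis by simp
  qed
  define w where "w = (\<Sum>i\<in>Basis. blinfun_apply g (T' i) *\<^sub>R i)"
  have gw: "blinfun_apply g (T' z) = w \<bullet> z" for z
  proof -
    have "blinfun_apply g (T' z) = blinfun_apply g (T' (\<Sum>i\<in>Basis. (z \<bullet> i) *\<^sub>R i))" by (simp add: euclidean_representation)
    also have "\<dots> = (\<Sum>i\<in>Basis. (z \<bullet> i) * blinfun_apply g (T' i))"
      by (simp add: linear_sum[OF T'] linear_scale[OF T'] blinfun.sum_right blinfun.scaleR_right)
    also have "\<dots> = w \<bullet> z" unfolding w_def inner_sum_left inner_scaleR_left by (simp add: inner_commute mult.commute)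
    finally show ?thesis .
  qed
  have [measurable]: "blinfun_apply g \<in> borel_measurable borel"
    by (intro borel_measurable_continuous_onI linear_continuous_on blinfun.bounded_linear_right)
  have "laplace \<gamma> g = (\<integral>z. exp (w \<bullet> z) \<partial>std_gauss)"
    unfolding laplace_def \<gamma>eq by (subst integral_distr) (auto simp: gw)
  then have lap: "ln (laplace \<gamma> g) = (norm w)\<^sup>2 / 2" by (simp add: std_gauss_mgf)
  have iz: "integrable std_gauss (\<lambda>z::'a. z)"
    using integrable_norm_power_std_gauss[of 1] by (intro integrable_norm_cancel[of std_gauss "\<lambda>z. z"]) auto
  have z0: "(\<integral>z. z \<partial>std_gauss) = (0::'a)"
  proof (rule euclidean_eqI)
    fix i :: 'a assume i: "i \<in> Basis"
    have "(\<integral>z. z \<partial>std_gauss) \<bullet> i = (\<integral>z. z \<bullet> i \<partial>std_gauss)" using iz by simp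
    then show "(\<integral>z. z \<partial>std_gauss) \<bullet> i = 0 \<bullet> i" using std_gauss_mean[OF i] by simp
  qed
  have "a = (\<integral>z. exp (w \<bullet> z - (norm w)\<^sup>2 / 2) *\<^sub>R T' z \<partial>std_gauss)"
    unfolding a lap by (subst \<gamma>eq, subst integral_distr) (auto simp: gw)
  also have "\<dots> = (\<integral>z. T' (z + w) \<partial>std_gauss)" by (rule std_gauss_shift_integral[symmetric]) measurable
  also have "\<dots> = T' (\<integral>z. z + w \<partial>std_gauss)"
    using iz by (intro integral_bounded_linear[OF bT']) auto
  also have "\<dots> = T' w" using iz z0 by (simp add: std_gauss.prob_space[simplified])
  finally have "T a = w" by (simp add: TT')
  then show ?thesis using gw[of "T x"] by (simp add: TT')
qed

text \<open>A functional that is nonnegative on the slices vanishes on their hyperplane, since the diameter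
  of the slice at height \<open>s\<close> is of larger order than \<open>s\<close>.\<close>

lemma slice_functional_proportional:
  fixes f g :: "'a::real_normed_vector \<Rightarrow> real"
  assumes f: "linear f" and g: "linear g" and fx: "0 < f x0" and \<beta>: "0 < \<beta>" and \<delta>: "0 < \<delta>"
    and nn: "\<And>y s. f y = 0 \<Longrightarrow> norm y \<le> \<beta> * sqrt s \<Longrightarrow> 0 < s \<Longrightarrow> s \<le> \<delta> \<Longrightarrow> 0 \<le> g (y + s *\<^sub>R x0)"
  shows "g z = (f z / f x0) * g x0"
proof -
  have ge: "0 \<le> g y" if fy: "f y = 0" for y
  proof (rule ccontr)
    assume "\<not> ?thesis"
    then have gy: "g y < 0" by simp
    then have ny: "0 < norm y" using linear_0[OF g] by auto
    define A where "A = \<beta> / norm y * (- g y)"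
    have A: "0 < A" unfolding A_def using \<beta> ny gy by (intro mult_pos_pos divide_pos_pos) auto
    \<comment> \<open>So small that the contribution \<open>s * g x0\<close> cannot outweigh
      \<open>- sqrt s * A\<close>, the value of \<open>g\<close> at \<open>y\<close> rescaled to the
      full permitted length \<open>\<beta> * sqrt s\<close>.\<close>
    define s where "s = min \<delta> ((A / (2 * (\<bar>g x0\<bar> + 1)))\<^sup>2)"
    have s: "0 < s" "s \<le> \<delta>" using \<delta> A by (auto simp: s_def)
    have "sqrt s \<le> sqrt ((A / (2 * (\<bar>g x0\<bar> + 1)))\<^sup>2)" unfolding s_def by (intro real_sqrt_le_mono) simp
    also have "\<dots> = A / (2 * (\<bar>g x0\<bar> + 1))" using A by simp
    finally have ss: "sqrt s * (\<bar>g x0\<bar> + 1) \<le> A / 2" by (simp add: field_simps)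
    define y' where "y' = (\<beta> * sqrt s / norm y) *\<^sub>R y"
    have "f y' = 0" "norm y' \<le> \<beta> * sqrt s"
      using fy ny \<beta> s by (auto simp: y'_def linear_scale[OF f])
    from nn[OF this s] have "0 \<le> \<beta> * sqrt s / norm y * g y + s * g x0"
      by (simp add: y'_def linear_add[OF g] linear_scale[OF g])
    also have "\<beta> * sqrt s / norm y * g y = sqrt s * (- A)" by (simp add: A_def)
    also have "s * g x0 = sqrt s * (sqrt s * g x0)" using s by (simp add: mult.assoc[symmetric])
    finally have "0 \<le> sqrt s * (sqrt s * g x0 - A)" by (simp add: algebra_simps)
    then have "A \<le> sqrt s * g x0" using s by (simp add: zero_le_mult_iff)
    also have "\<dots> \<le> sqrt s * (\<bar>g x0\<bar> + 1)" using s by (intro mult_left_mono) auto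
    also have "\<dots> \<le> A / 2" by (rule ss)
    finally show False using A by simp
  qed
  have zero: "g y = 0" if "f y = 0" for y
    using ge[OF that] ge[of "- y"] that by (simp add: linear_neg[OF f] linear_neg[OF g])
  have "f (z - (f z / f x0) *\<^sub>R x0) = 0" using fx by (simp add: linear_diff[OF f] linear_scale[OF f])
  from zero[OF this] show ?thesis by (simp add: linear_diff[OF g] linear_scale[OF g])
qed

section \<open>Transfer to the original coordinates\<close>

theorem theorem4:
  fixes M :: "'w measure" and N :: "'v measure"
    and X :: "'w \<Rightarrow> real ^ 'd" and Xs :: "nat \<Rightarrow> 'w \<Rightarrow> real ^ 'd"
    and S :: "nat \<Rightarrow> 'w \<Rightarrow> real ^ 'd"
    and G :: "'v \<Rightarrow> real ^ 'd"
    and \<gamma> :: "(real ^ 'd) measure"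
    and b :: "nat \<Rightarrow> real"
    and D :: "(real ^ 'd) set" and a0 :: "real ^ 'd"
  assumes "prob_space M"
    and "X \<in> borel_measurable M"
    and "prob_space.indep_vars M (\<lambda>_. borel) Xs {1..}"
    and "\<And>j. j \<ge> 1 \<Longrightarrow> distr M borel (Xs j) = distr M borel X"
    and "\<And>n \<omega>. S n \<omega> = (\<Sum>j=1..n. Xs j \<omega>)"
    and "gaussian_measure \<gamma>" and "centered \<gamma>"
    and "measure_support \<gamma> = UNIV"
    and "weakly_converges (\<lambda>n. distr M borel (\<lambda>\<omega>. S n \<omega> /\<^sub>R sqrt (real n))) \<gamma>"
    and "\<And>f :: real ^ 'd. \<exists>t_f>0. \<forall>t. 0 < t \<and> t < t_f \<longrightarrow>
           integrable M (\<lambda>\<omega>. exp (t * \<bar>f \<bullet> X \<omega>\<bar>))"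
    and "\<And>n. n \<ge> 1 \<Longrightarrow> b n > 0"
    and "filterlim (\<lambda>n. b n / sqrt (real n)) at_top sequentially"
    and "(\<lambda>n. b n / real n powr (2/3)) \<longlonglongrightarrow> 0"
    and "open D" and "convex D"
    and "D \<inter> H_space \<gamma> \<noteq> {}" and "0 \<notin> closure D"
    and "dominating_point D \<gamma> a0"
    and "\<exists>\<beta>>0. contains_slices \<gamma> D a0 (\<lambda>s. \<beta> * sqrt s)"
    and "prob_space N" and "G \<in> borel_measurable N" and "distr N borel G = \<gamma>"
  shows "(\<lambda>n. \<P>(\<omega> in M. S n \<omega> \<in> (*\<^sub>R) (b n) ` D)
            / \<P>(\<omega> in N. G \<omega> \<in> (*\<^sub>R) (real n powr (-1/2) * b n) ` D)) \<longlonglongrightarrow> 1"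
proof -
  interpret M: prob_space M by fact
  interpret N: prob_space N by fact
  have [measurable]: "X \<in> borel_measurable M" "G \<in> borel_measurable N" by fact+
  define \<mu> where "\<mu> = distr M borel X"
  have "prob_space \<mu>" unfolding \<mu>_def by (rule M.prob_space_distr) simp
  then interpret mu: borel_prob \<mu> by (simp add: borel_prob_def borel_prob_axioms_def \<mu>_def)
  have "prob_space \<gamma>" unfolding assms(22)[symmetric] by (rule N.prob_space_distr) simp
  moreover have s\<gamma>: "sets \<gamma> = sets borel" unfolding assms(22)[symmetric] by simp
  ultimately interpret g: borel_prob \<gamma> by (simp add: borel_prob_def borel_prob_axioms_def)
  obtain \<kappa> where \<kappa>: "0 < \<kappa>" "integrable M (\<lambda>\<omega>. exp (\<kappa> * norm (X \<omega>)))"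
    using exp_norm_integrable[OF assms(2,10)] by blast
  have rv[measurable]: "Xs j \<in> borel_measurable M" if "1 \<le> j" for j
    using assms(3) that by (auto simp: M.indep_vars_def)
  have Sm[measurable]: "S n \<in> borel_measurable M" for n
    unfolding assms(5)[abs_def] by (intro borel_measurable_sum rv) auto
  have law: "distr M borel (Xs j) = \<mu>" if "1 \<le> j" for j using assms(4)[OF that] by (simp add: \<mu>_def)
  have expS: "M.expectation (\<lambda>\<omega>. h (S n \<omega>)) = (avg_op \<mu> 1 ^^ n) h 0" if "bdd_borel h" for h n
    using M.expectation_iid_sum[OF assms(3) law that, of 0 n] by (simp add: assms(5))
  interpret L: normalized_limit \<mu> \<kappa> \<gamma>
  proof
    show "0 < \<kappa>" by fact
    show "integrable \<mu> (\<lambda>y. exp (\<kappa> * norm y))" unfolding \<mu>_def using \<kappa>(2) by (subst integrable_distr_eq) auto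
    fix \<phi> :: "real ^ 'd \<Rightarrow> real" assume cont: "continuous_on UNIV \<phi>" and \<phi>1: "\<And>x. \<bar>\<phi> x\<bar> \<le> 1"
    have [measurable]: "\<phi> \<in> borel_measurable borel" by (rule borel_measurable_continuous_onI[OF cont])
    have "\<phi> \<in> bcontfun" using cont \<phi>1 by (auto simp: bcontfun_def bounded_iff)
    then have app: "apply_bcontfun (Bcontfun \<phi>) = \<phi>" by (rule Bcontfun_inverse)
    have "(\<lambda>n. \<integral>x. \<phi> x \<partial>distr M borel (\<lambda>\<omega>. S n \<omega> /\<^sub>R sqrt (real n))) \<longlonglongrightarrow> (\<integral>x. \<phi> x \<partial>\<gamma>)"
      using assms(9)[unfolded weakly_converges_def, rule_format, of "Bcontfun \<phi>"] unfolding app .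
    moreover have "(\<integral>x. \<phi> x \<partial>distr M borel (\<lambda>\<omega>. S n \<omega> /\<^sub>R sqrt (real n))) = (avg_op \<mu> (1 / sqrt (real n)) ^^ n) \<phi> 0" for n
    proof -
      have "bdd_borel (\<lambda>y. \<phi> ((1 / sqrt (real n)) *\<^sub>R y))" using \<phi>1 by (auto simp: bdd_borel_def)
      from expS[OF this, of n] show ?thesis
        unfolding avg_op_pow_scale by (subst integral_distr) (auto simp: inverse_eq_divide)
    qed
    ultimately show "(\<lambda>n. (avg_op \<mu> (1 / sqrt (real n)) ^^ n) \<phi> 0) \<longlonglongrightarrow> (\<integral>x. \<phi> x \<partial>\<gamma>)" by simp
  qed
  obtain T :: "real ^ 'd \<Rightarrow> real ^ 'd" and \<kappa>' where T: "linear T" "bij T" and std: "standardized (distr \<mu> borel T) \<kappa>'"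
    using L.whitening[OF assms(8)] by blast
  interpret s: standardized "distr \<mu> borel T" \<kappa>' by fact
  have T\<gamma>: "distr \<gamma> borel T = std_gauss" by (rule L.distr_limit_eq_std_gauss[OF T(1) std])
  have [measurable]: "T \<in> borel_measurable borel"
    using T(1) by (simp add: borel_measurable_continuous_onI linear_continuous_on linear_conv_bounded_linear)
  define T' where "T' = inv T"
  have T': "linear T'" unfolding T'_def using T by (intro inj_linear_imp_inv_linear bij_is_inj)
  have TT': "T (T' z) = z" "T' (T z) = z" for z
    using T(2) by (auto simp: T'_def bij_is_surj surj_f_inv_f bij_is_inj)
  have memT: "T y \<in> (*\<^sub>R) c ` T ` D \<longleftrightarrow> y \<in> (*\<^sub>R) c ` D" for c y
  proof -
    have "(*\<^sub>R) c ` T ` D = T ` (*\<^sub>R) c ` D" by (auto simp: image_iff linear_scale[OF T(1)])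
    then show ?thesis using T(2) by (auto simp: bij_is_inj inj_image_mem_iff)
  qed

  obtain g :: "(real ^ 'd) \<Rightarrow>\<^sub>L real" where gD: "D \<subseteq> {x. blinfun_apply g x \<ge> blinfun_apply g a0}"
    and ga: "a0 = (\<integral>x. exp (blinfun_apply g x - ln (laplace \<gamma> g)) *\<^sub>R x \<partial>\<gamma>)" and fr: "a0 \<in> frontier D"
    using assms(18) unfolding dominating_point_def by blast
  define v where "v = T a0"
  have gv: "blinfun_apply g x = v \<bullet> T x" for x unfolding v_def by (rule dominating_point_image[OF T s\<gamma> T\<gamma> ga])
  have "a0 \<noteq> 0" using fr assms(17) by (auto simp: frontier_def)
  then have "v \<noteq> 0" using T linear_injective_0[OF T(1)] by (auto simp: v_def bij_is_inj)
  obtain \<beta> where \<beta>: "0 < \<beta>" and "contains_slices \<gamma> D a0 (\<lambda>s. \<beta> * sqrt s)" using assms(19) by blast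
  then obtain f :: "(real ^ 'd) \<Rightarrow>\<^sub>L real" and x0 \<delta> where \<delta>: "0 < \<delta>" and fx: "0 < blinfun_apply f x0"
    and sl: "{y + s *\<^sub>R x0 | y s. blinfun_apply f y = 0 \<and> norm y \<le> \<beta> * sqrt s \<and> 0 < s \<and> s \<le> \<delta>} \<subseteq> (\<lambda>x. x - a0) ` D"
    unfolding contains_slices_def by blast
  have slice: "a0 + (y + s *\<^sub>R x0) \<in> D" if "blinfun_apply f y = 0" "norm y \<le> \<beta> * sqrt s" "0 < s" "s \<le> \<delta>" for y s
  proof -
    have "y + s *\<^sub>R x0 \<in> (\<lambda>x. x - a0) ` D" using sl that by blast
    then obtain x where "x \<in> D" "y + s *\<^sub>R x0 = x - a0" by blast
    then show ?thesis by simp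
  qed
  have lin: "linear (blinfun_apply f)" "linear (blinfun_apply g)"
    by (auto intro: bounded_linear.linear blinfun.bounded_linear_right)
  have gnn: "0 \<le> blinfun_apply g (y + s *\<^sub>R x0)"
    if "blinfun_apply f y = 0" "norm y \<le> \<beta> * sqrt s" "0 < s" "s \<le> \<delta>" for y s
    using slice[OF that] gD by (auto simp: blinfun.add_right)
  \<comment> \<open>The slices are parallel to the kernel of \<open>f\<close>, while the tilt is
    governed by \<open>g\<close>. Proportionality, with \<open>0 < g x0\<close> shown next,
    identifies the two kernels, so the slices lie along the supporting hyperplane used for
    tilting.\<close>
  have gprop: "blinfun_apply g z = (blinfun_apply f z / blinfun_apply f x0) * blinfun_apply g x0" for z
    by (rule slice_functional_proportional[OF lin fx \<beta> \<delta> gnn])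
  have gx0: "0 < blinfun_apply g x0"
  proof -
    have "0 \<le> blinfun_apply g (0 + \<delta> *\<^sub>R x0)" using \<delta> \<beta> by (intro gnn) auto
    then have "0 \<le> blinfun_apply g x0" using \<delta> by (simp add: blinfun.scaleR_right zero_le_mult_iff)
    moreover have "blinfun_apply g x0 \<noteq> 0"
    proof
      assume "blinfun_apply g x0 = 0"
      then have "blinfun_apply g a0 = 0" using gprop[of a0] by simp
      then show False using gv[of a0] \<open>v \<noteq> 0\<close> by (simp add: v_def)
    qed
    ultimately show ?thesis by simp
  qed
  \<comment> \<open>\<open>T'\<close> stretches lengths by at most \<open>K\<close>, so the image of
    \<open>D\<close> has slices of diameter governed by \<open>\<beta> / K\<close>.\<close>
  obtain K where K: "0 < K" "\<And>x. norm (T' x) \<le> K * norm x" using linear_bounded_pos[OF T'] by (auto simp: mult.commute)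

  have "(\<lambda>n. (avg_op (distr \<mu> borel T) 1 ^^ n) (indicator ((*\<^sub>R) (b n) ` T ` D)) 0
      / measure std_gauss ((*\<^sub>R) (real n powr (-1/2) * b n) ` T ` D)) \<longlonglongrightarrow> 1"
  proof (rule s.tilted_ratio_limit)
    have "T ` D = T' -` D" using TT' by (auto simp: image_iff) metis
    moreover have "continuous_on UNIV T'" using T' by (simp add: linear_continuous_on linear_conv_bounded_linear)
    ultimately show oTD: "open (T ` D)" using open_vimage[OF assms(14)] by simp
    show "convex (T ` D)" by (rule convex_linear_image[OF T(1) assms(15)])
    show "v \<bullet> v \<le> v \<bullet> y" if "y \<in> T ` D" for y
    proof -
      obtain x where x: "x \<in> D" "y = T x" using \<open>y \<in> T ` D\<close> by blast
      have "blinfun_apply g a0 \<le> blinfun_apply g x" using gD x(1) by blast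
      then show ?thesis unfolding gv x(2) by (simp add: v_def)
    qed
    show "0 < v \<bullet> T x0" using gx0 gv by simp
    show "0 < \<beta> / K" using \<beta> K by simp
    show "0 < \<delta>" by fact
    show "v + (y + s *\<^sub>R T x0) \<in> T ` D" if y: "v \<bullet> y = 0" "norm y \<le> \<beta> / K * sqrt s" and s: "0 < s" "s \<le> \<delta>" for y s
    proof -
      have "blinfun_apply g (T' y) = 0" using y(1) by (simp add: gv TT')
      then have "blinfun_apply f (T' y) = 0" using gprop[of "T' y"] gx0 fx by simp
      moreover have "norm (T' y) \<le> \<beta> * sqrt s"
        using order_trans[OF K(2)[of y] mult_left_mono[OF y(2), of K]] K(1) by simp
      ultimately have "a0 + (T' y + s *\<^sub>R x0) \<in> D" using s by (intro slice)
      then have "T (a0 + (T' y + s *\<^sub>R x0)) \<in> T ` D" by blast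
      then show ?thesis by (simp add: linear_add[OF T(1)] linear_scale[OF T(1)] TT' v_def)
    qed
  qed (use assms(11-13) in auto)
  then show ?thesis
  proof (rule Lim_transform_eventually)
    show "eventually (\<lambda>n. (avg_op (distr \<mu> borel T) 1 ^^ n) (indicator ((*\<^sub>R) (b n) ` T ` D)) 0
        / measure std_gauss ((*\<^sub>R) (real n powr (-1/2) * b n) ` T ` D)
      = \<P>(\<omega> in M. S n \<omega> \<in> (*\<^sub>R) (b n) ` D) / \<P>(\<omega> in N. G \<omega> \<in> (*\<^sub>R) (real n powr (-1/2) * b n) ` D)) sequentially"
      using eventually_ge_at_top[of 1]
    proof eventually_elim
      case (elim n)
      have bn: "0 < b n" by (rule assms(11)[OF elim])
      have xn: "0 < real n powr (-1/2) * b n" using bn elim by simp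
      have "open ((*\<^sub>R) c ` D)" if "0 < c" for c using assms(14) that by (intro open_scaling) auto
      then have bD[measurable]: "(*\<^sub>R) (b n) ` D \<in> sets borel" and xD[measurable]: "(*\<^sub>R) (real n powr (-1/2) * b n) ` D \<in> sets borel"
        using bn xn by auto
      have TD: "T ` D \<in> sets borel"
      proof -
        have "T ` D = T' -` D" using TT' by (auto simp: image_iff) metis
        moreover have "T' \<in> borel_measurable borel"
          using T' by (simp add: borel_measurable_continuous_onI linear_continuous_on linear_conv_bounded_linear)
        ultimately show ?thesis using measurable_sets[of T' borel borel D] assms(14) by auto
      qed
      have bTD: "bdd_borel (indicator ((*\<^sub>R) (b n) ` T ` D))" using bn TD by (intro bdd_borel_indicator s.borel_scaled)
      have xTD[measurable]: "(*\<^sub>R) (real n powr (-1/2) * b n) ` T ` D \<in> sets borel" using xn TD by (intro s.borel_scaled)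
      have "(avg_op (distr \<mu> borel T) 1 ^^ n) (indicator ((*\<^sub>R) (b n) ` T ` D)) 0
          = (avg_op \<mu> 1 ^^ n) (indicator ((*\<^sub>R) (b n) ` T ` D) \<circ> T) 0"
        using avg_op_pow_linear[OF mu.borel_prob_axioms T(1) bTD _ s.borel_prob_axioms, where x=0 and n=n and s=1] linear_0[OF T(1)] by simp
      also have "indicator ((*\<^sub>R) (b n) ` T ` D) \<circ> T = (indicator ((*\<^sub>R) (b n) ` D) :: _ \<Rightarrow> real)"
        by (simp add: fun_eq_iff indicator_def memT)
      also have "(avg_op \<mu> 1 ^^ n) (indicator ((*\<^sub>R) (b n) ` D)) 0 = M.expectation (\<lambda>\<omega>. indicator ((*\<^sub>R) (b n) ` D) (S n \<omega>))"
        by (rule expS[symmetric]) (intro bdd_borel_indicator bD)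
      also have "\<dots> = M.expectation (indicator {\<omega> \<in> space M. S n \<omega> \<in> (*\<^sub>R) (b n) ` D})"
        by (intro Bochner_Integration.integral_cong) (auto simp: indicator_def)
      also have "\<dots> = \<P>(\<omega> in M. S n \<omega> \<in> (*\<^sub>R) (b n) ` D)" by simp
      finally have num: "(avg_op (distr \<mu> borel T) 1 ^^ n) (indicator ((*\<^sub>R) (b n) ` T ` D)) 0 = \<P>(\<omega> in M. S n \<omega> \<in> (*\<^sub>R) (b n) ` D)" .
      let ?c = "real n powr (-1/2) * b n"
      have "measure std_gauss ((*\<^sub>R) ?c ` T ` D) = measure \<gamma> (T -` ((*\<^sub>R) ?c ` T ` D) \<inter> space \<gamma>)"
        unfolding T\<gamma>[symmetric] by (rule measure_distr) measurable
      also have "T -` ((*\<^sub>R) ?c ` T ` D) \<inter> space \<gamma> = (*\<^sub>R) ?c ` D" using memT[of _ ?c] by auto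
      also have "measure \<gamma> ((*\<^sub>R) ?c ` D) = measure N (G -` ((*\<^sub>R) ?c ` D) \<inter> space N)"
        unfolding assms(22)[symmetric] by (rule measure_distr) measurable
      also have "G -` ((*\<^sub>R) ?c ` D) \<inter> space N = {\<omega> \<in> space N. G \<omega> \<in> (*\<^sub>R) ?c ` D}" by auto
      finally show ?case unfolding num by simp
    qed
  qed
qed

end
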